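(* Let $q\ge2$ and let $(F_0,F_\infty)$ be a pair of transverse elements of $\mathrm{SO}_0(q+1,q)/P_q$. The space $\Omega(F_0)\cap\Omega(F_\infty)$ has two connected components. If $q\equiv1$ or $2\bmod4$, these two components are swapped by the involution $i$. If $q\equiv 3$ or $0\bmod 4$, each of the two components is stable by $i$.
   Context: $\mathbb{R}^{q+1,q}$ is $\mathbb{R}^{2q+1}$ with a nondegenerate symmetric bilinear form of signature $(q+1,q)$; $\mathrm{SO}_0(q+1,q)$ is the identity component of its isometry group. $\mathrm{SO}_0(q+1,q)/P_q$ is the space of $q$-dimensional (maximal) isotropic subspaces. Two such subspaces $F,G$ are transverse if $F\oplus G^\perp=\mathbb{R}^{q+1,q}$; $\Omega(F)$ is the set of those transverse to $F$. Let $\mathcal U$ be the unipotent radical of the stabilizer of $F_\infty$. The map $u\mapsto u\cdot F_0$ is a diffeomorphism $\mathcal U\to\Omega(F_\infty)$; the involution $i(u\cdot F_0)=u^{-1}\cdot F_0$ preserves $\Omega(F_0)\cap\Omega(F_\infty)$ and hence acts on its set of connected components. *)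

theory Defs
  imports "HOL-Analysis.Analysis" "HOL-Algebra.Coset"
begin

type_synonym 'n form = "real^'n \<Rightarrow> real^'n \<Rightarrow> real"

definition nondegenerate_symmetric_form :: "'n::finite form \<Rightarrow> bool" where
  "nondegenerate_symmetric_form b \<longleftrightarrow>
     bilinear b \<and> (\<forall>x y. b x y = b y x) \<and> (\<forall>x. (\<forall>y. b x y = 0) \<longrightarrow> x = 0)"

definition direct_sum_eq_UNIV :: "(real^'n::finite) set \<Rightarrow> (real^'n) set \<Rightarrow> bool" where
  "direct_sum_eq_UNIV S T \<longleftrightarrow> S \<inter> T = {0} \<and> {x + y | x y. x \<in> S \<and> y \<in> T} = UNIV"

definition has_signature :: "'n::finite form \<Rightarrow> nat \<Rightarrow> nat \<Rightarrow> bool" where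
  "has_signature b p m \<longleftrightarrow>
     (\<exists>P N. subspace P \<and> subspace N \<and> dim P = p \<and> dim N = m \<and> direct_sum_eq_UNIV P N \<and>
        (\<forall>x\<in>P. \<forall>y\<in>N. b x y = 0) \<and>
        (\<forall>x\<in>P. x \<noteq> 0 \<longrightarrow> b x x > 0) \<and> (\<forall>x\<in>N. x \<noteq> 0 \<longrightarrow> b x x < 0))"

definition form_orthogonal :: "'n::finite form \<Rightarrow> (real^'n) set \<Rightarrow> (real^'n) set" where
  "form_orthogonal b F = {x. \<forall>y\<in>F. b x y = 0}"

definition isometry_group :: "'n::finite form \<Rightarrow> (real^'n^'n) set" where
  "isometry_group b = {A. invertible A \<and> (\<forall>x y. b (A *v x) (A *v y) = b x y)}"

definition SO0 :: "'n::finite form \<Rightarrow> (real^'n^'n) set" where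
  "SO0 b = connected_component_set (isometry_group b) (mat 1)"

definition act :: "real^'n^'n \<Rightarrow> (real^'n::finite) set \<Rightarrow> (real^'n) set" where
  "act g F = (\<lambda>x. g *v x) ` F"

definition isotropic_subspaces :: "'n::finite form \<Rightarrow> nat \<Rightarrow> (real^'n) set set" where
  "isotropic_subspaces b k = {F. subspace F \<and> dim F = k \<and> (\<forall>x\<in>F. \<forall>y\<in>F. b x y = 0)}"

text \<open>The topology on the space of isotropic \<open>k\<close>-dimensional subspaces, seen as a homogeneous
  space: the final topology for the orbit maps \<open>g \<mapsto> g F\<close> from the identity component. When the
  action is transitive (as it is for \<open>k = q\<close> in signature \<open>(q + 1, q)\<close>) each single orbit map
  already induces it, so it is the quotient topology of the group by the stabilizer of any
  \<open>F\<close>; quantifying over all \<open>F\<close> avoids choosing a base point.\<close>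

definition isotropic_topology :: "'n::finite form \<Rightarrow> nat \<Rightarrow> (real^'n) set topology" where
  "isotropic_topology b k = topology (\<lambda>W. W \<subseteq> isotropic_subspaces b k \<and>
     (\<forall>F \<in> isotropic_subspaces b k.
        openin (top_of_set (SO0 b)) {g \<in> SO0 b. act g F \<in> W}))"

lemma openin_isotropic_topology:
  "openin (isotropic_topology b k) W \<longleftrightarrow> W \<subseteq> isotropic_subspaces b k \<and>
     (\<forall>F \<in> isotropic_subspaces b k.
        openin (top_of_set (SO0 b)) {g \<in> SO0 b. act g F \<in> W})"
proof -
  have "istopology (\<lambda>W. W \<subseteq> isotropic_subspaces b k \<and>
     (\<forall>F \<in> isotropic_subspaces b k.
        openin (top_of_set (SO0 b)) {g \<in> SO0 b. act g F \<in> W}))"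
    unfolding istopology_def
  proof (intro conjI allI impI ballI)
    fix S T F
    assume S: "S \<subseteq> isotropic_subspaces b k \<and> (\<forall>F \<in> isotropic_subspaces b k.
        openin (top_of_set (SO0 b)) {g \<in> SO0 b. act g F \<in> S})"
      and T: "T \<subseteq> isotropic_subspaces b k \<and> (\<forall>F \<in> isotropic_subspaces b k.
        openin (top_of_set (SO0 b)) {g \<in> SO0 b. act g F \<in> T})"
      and F: "F \<in> isotropic_subspaces b k"
    have "{g \<in> SO0 b. act g F \<in> S \<inter> T} = {g \<in> SO0 b. act g F \<in> S} \<inter> {g \<in> SO0 b. act g F \<in> T}"
      by blast
    then show "openin (top_of_set (SO0 b)) {g \<in> SO0 b. act g F \<in> S \<inter> T}"
      using S T F by (simp add: openin_Int)
  next
    fix \<K> F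
    assume K: "\<forall>K\<in>\<K>. K \<subseteq> isotropic_subspaces b k \<and> (\<forall>F \<in> isotropic_subspaces b k.
        openin (top_of_set (SO0 b)) {g \<in> SO0 b. act g F \<in> K})"
      and F: "F \<in> isotropic_subspaces b k"
    have "{g \<in> SO0 b. act g F \<in> \<Union>\<K>} = \<Union> ((\<lambda>K. {g \<in> SO0 b. act g F \<in> K}) ` \<K>)"
      by blast
    moreover have "openin (top_of_set (SO0 b)) (\<Union> ((\<lambda>K. {g \<in> SO0 b. act g F \<in> K}) ` \<K>))"
      using K F by (intro openin_Union) blast
    ultimately show "openin (top_of_set (SO0 b)) {g \<in> SO0 b. act g F \<in> \<Union>\<K>}"
      by simp
  qed blast+
  then show ?thesis
    unfolding isotropic_topology_def by (simp add: topology_inverse')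
qed

definition transverse :: "'n::finite form \<Rightarrow> (real^'n) set \<Rightarrow> (real^'n) set \<Rightarrow> bool" where
  "transverse b F G \<longleftrightarrow> direct_sum_eq_UNIV F (form_orthogonal b G)"

definition Omega :: "'n::finite form \<Rightarrow> nat \<Rightarrow> (real^'n) set \<Rightarrow> (real^'n) set set" where
  "Omega b k F = {G \<in> isotropic_subspaces b k. transverse b G F}"

definition matrix_group :: "(real^'n^'n::finite) set \<Rightarrow> (real^'n^'n) monoid" where
  "matrix_group S = \<lparr>carrier = S, monoid.mult = (**), one = mat 1\<rparr>"

text \<open>The power is taken by iterating the linear map, since \<open>^\<close> is not the matrix power.\<close>

definition unipotent :: "real^'n^'n::finite \<Rightarrow> bool" where
  "unipotent A \<longleftrightarrow> (\<exists>k. \<forall>x. ((\<lambda>y. (A - mat 1) *v y) ^^ k) x = 0)"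

text \<open>The largest closed connected normal subgroup consisting of unipotent elements, written as
  the union of all such subgroups.\<close>

definition unipotent_radical :: "(real^'n^'n::finite) set \<Rightarrow> (real^'n^'n) set" where
  "unipotent_radical P = \<Union> {N. N \<lhd> matrix_group P \<and> closedin (top_of_set P) N \<and>
     connected N \<and> (\<forall>A\<in>N. unipotent A)}"

definition stabilizer :: "'n::finite form \<Rightarrow> (real^'n) set \<Rightarrow> (real^'n^'n) set" where
  "stabilizer b F = {g \<in> SO0 b. act g F = F}"

text \<open>The map \<open>u F\<^sub>0 \<mapsto> u\<inverse> F\<^sub>0\<close>, for \<open>u\<close> in the unipotent radical of the stabilizer of \<open>F\<^sub>\<infinity>\<close>;
  it is only meaningful on subspaces transverse to \<open>F\<^sub>\<infinity>\<close>.\<close>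

definition opp_involution ::
  "'n::finite form \<Rightarrow> (real^'n) set \<Rightarrow> (real^'n) set \<Rightarrow> (real^'n) set \<Rightarrow> (real^'n) set" where
  "opp_involution b F0 Finf F =
     act (matrix_inv (THE u. u \<in> unipotent_radical (stabilizer b Finf) \<and> act u F0 = F)) F0"

end

(* Write V = F0 + R l + Finf with l orthogonal to both isotropic subspaces.  The unipotent radical
   is exp(n), where n consists of the skew maps N = A + v \<and> l with A in the second exterior power
   of Finf and v in Finf, and exp(N) F0 is transverse to F0 iff N is injective on F0.  For q even
   this says that A is nondegenerate, for q odd that the alternating form A + v \<and> l on F0 + R l is.
   Such a pair is A = z1 \<and> z2 + z3 \<and> z4 + ... with z1, ..., zq a basis of Finf (and v = zq for q odd;
   for q even, v is irrelevant up to homotopy), and bases of Finf form two path components, so there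
   are at most two components.  The Pfaffian of the form, read off from a fixed basis of F0
   (and l), is continuous, nonzero and takes both signs, so there are exactly two.
   The involution replaces N by -N and multiplies the Pfaffian by (-1)^((q + 1) div 2). *)

theory Submission
  imports Defs
begin

section \<open>Pfaffians and ordered bases\<close>

text \<open>Three points shape the argument. The topology on isotropic subspaces is known only
  through the orbit maps, so paths are built as matrix paths \<open>exp3 (N t)\<close> and pushed
  forward, while openness is tested after pulling back to \<open>SO0 b\<close>. The Pfaffian must
  then be a function of the subspace alone and not of a chosen \<open>N\<close>; it is taken of an
  antisymmetrised projection, whose dependence on the group element is explicit. The unipotent
  radical is a union over all admissible normal subgroups, so identifying it requires a bound on
  every such subgroup; conjugation by ever larger transvections provides it. Elementary moves of
  ordered bases serve twice: on \<open>Finf\<close> they produce paths of subspaces, on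
  \<open>F0\<close> they preserve the sign of the Pfaffian. One combinatorial reduction thus
  replaces the study of the components of the general linear group.\<close>

definition multilinear_list :: "('v::real_vector list \<Rightarrow> real) \<Rightarrow> bool" where
  "multilinear_list g \<longleftrightarrow> (\<forall>xs ys. linear (\<lambda>u. g (xs @ u # ys)))"

definition antisymmetric_list :: "('v list \<Rightarrow> real) \<Rightarrow> bool" where
  "antisymmetric_list g \<longleftrightarrow> (\<forall>xs u v ys. g (xs @ u # v # ys) = - g (xs @ v # u # ys))"

text \<open>The alternating sum over the entry that is removed from the list and paired with
  \<open>x\<close>. On alternating \<open>g\<close> it is, up to normalisation, the exterior product
  of the one-form \<open>\<omega> x\<close> with \<open>g\<close>.\<close>

fun contract :: "('v \<Rightarrow> 'v \<Rightarrow> real) \<Rightarrow> 'v \<Rightarrow> ('v list \<Rightarrow> real) \<Rightarrow> 'v list \<Rightarrow> real" where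
  "contract \<omega> x g [] = 0"
| "contract \<omega> x g (y # ys) = \<omega> x y * g ys - contract \<omega> x (\<lambda>zs. g (y # zs)) ys"

text \<open>Expansion along the first row. For a list of length \<open>2 * n\<close> this is the
  Pfaffian of its Gram matrix under an alternating \<open>\<omega>\<close>; for every other length
  it is 0.\<close>

fun pfaffian :: "('v \<Rightarrow> 'v \<Rightarrow> real) \<Rightarrow> nat \<Rightarrow> 'v list \<Rightarrow> real" where
  "pfaffian \<omega> 0 xs = (if xs = [] then 1 else 0)"
| "pfaffian \<omega> (Suc n) [] = 0"
| "pfaffian \<omega> (Suc n) (x # xs) = contract \<omega> x (pfaffian \<omega> n) xs"

lemma contract_lincomb:
  "contract \<omega> x (\<lambda>zs. a * g zs + c * h zs) ys = a * contract \<omega> x g ys + c * contract \<omega> x h ys"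
  by (induction ys arbitrary: g h) (simp_all add: algebra_simps)

lemma contract_uminus: "contract \<omega> x (\<lambda>zs. - g zs) ys = - contract \<omega> x g ys"
  by (induction ys arbitrary: g) (simp_all add: algebra_simps)

lemma contract_diff:
  "contract \<omega> x (\<lambda>zs. g zs - h zs) ys = contract \<omega> x g ys - contract \<omega> x h ys"
  using contract_lincomb[of \<omega> x 1 g "-1" h ys] by simp

lemma contract_mult: "contract \<omega> x (\<lambda>zs. a * g zs) ys = a * contract \<omega> x g ys"
  using contract_lincomb[of \<omega> x a g 0 g ys] by simp

lemma contract_zero [simp]: "contract \<omega> x (\<lambda>zs. 0) ys = 0"
  by (induction ys) simp_all

text \<open>Both sides sum over ordered pairs of removed entries, and removing the same two entries
  in the opposite order changes the sign: exterior multiplications by one-forms anticommute.\<close>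

lemma contract_anticommute:
  "contract \<omega> x (contract \<omega> y g) zs = - contract \<omega> y (contract \<omega> x g) zs"
proof (induction zs arbitrary: g)
  case (Cons z zs)
  show ?case
    using Cons[of "\<lambda>ws. g (z # ws)"] by (simp add: contract_diff contract_mult)
qed simp

lemma antisymmetric_list_Cons:
  assumes "antisymmetric_list g" shows "antisymmetric_list (\<lambda>zs. g (y # zs))"
  unfolding antisymmetric_list_def
proof (intro allI)
  fix xs u v ys
  have "g ((y # xs) @ u # v # ys) = - g ((y # xs) @ v # u # ys)"
    using assms unfolding antisymmetric_list_def by blast
  then show "g (y # xs @ u # v # ys) = - g (y # xs @ v # u # ys)" by simp
qed

lemma multilinear_list_Cons:
  assumes "multilinear_list g" shows "multilinear_list (\<lambda>zs. g (y # zs))"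
  unfolding multilinear_list_def
proof (intro allI)
  fix xs ys
  have "linear (\<lambda>u. g ((y # xs) @ u # ys))"
    using assms unfolding multilinear_list_def by blast
  then show "linear (\<lambda>u. g (y # xs @ u # ys))" by simp
qed

lemma antisymmetric_list_contract:
  assumes "antisymmetric_list g"
  shows "antisymmetric_list (contract \<omega> x g)"
proof -
  have "contract \<omega> x g (xs @ u # v # ys) = - contract \<omega> x g (xs @ v # u # ys)" for xs u v ys
    using assms
  proof (induction xs arbitrary: g)
    case Nil
    have "(\<lambda>zs. g (v # u # zs)) = (\<lambda>zs. - g (u # v # zs))"
      using Nil unfolding antisymmetric_list_def by (metis append_Nil)
    then show ?case by (simp add: contract_uminus)
  next
    case (Cons a xs)
    have "g (xs @ v # u # ys) = - g (xs @ u # v # ys)"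
      using Cons.prems unfolding antisymmetric_list_def by blast
    then show ?case
      using Cons.IH[OF antisymmetric_list_Cons[OF Cons.prems, of a]] by simp
  qed
  then show ?thesis unfolding antisymmetric_list_def by blast
qed

lemma multilinear_list_contract:
  assumes "\<And>x. linear (\<omega> x)" and "multilinear_list g"
  shows "multilinear_list (contract \<omega> x g)"
proof -
  have "linear (\<lambda>u. contract \<omega> x g (xs @ u # ys))" for xs ys
    using assms(2)
  proof (induction xs arbitrary: g)
    case Nil
    have l: "linear (\<lambda>u. g (u # zs))" for zs
    proof -
      have "linear (\<lambda>u. g ([] @ u # zs))"
        using Nil unfolding multilinear_list_def by blast
      then show ?thesis by simp
    qed
    have "linear (\<lambda>u. contract \<omega> x (\<lambda>zs. g (u # zs)) ys)"
      by (rule linearI)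
        (simp_all add: linear_add[OF l] linear_scale[OF l]
          contract_lincomb[of _ _ 1 _ 1, simplified] contract_mult)
    moreover have "linear (\<lambda>u. \<omega> x u * g ys)"
      using assms(1)[of x] by (intro linearI) (simp_all add: linear_add linear_scale algebra_simps)
    ultimately show ?case by (simp add: linear_compose_sub)
  next
    case (Cons a xs)
    have lin: "linear (\<lambda>u. g (xs @ u # ys))"
      using Cons.prems unfolding multilinear_list_def by blast
    have "linear (\<lambda>u. \<omega> x a * g (xs @ u # ys))"
      by (intro linearI) (simp_all add: linear_add[OF lin] linear_scale[OF lin] algebra_simps)
    then show ?case
      using linear_compose_sub[OF _ Cons.IH[OF multilinear_list_Cons[OF Cons.prems, of a]]]
      by simp
  qed
  then show ?thesis unfolding multilinear_list_def by blast
qed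

lemma contract_linear_left:
  assumes "\<And>y. linear (\<lambda>x. \<omega> x y)"
  shows "linear (\<lambda>x. contract \<omega> x g ys)"
proof (induction ys arbitrary: g)
  case Nil
  then show ?case by (simp add: linear_zero)
next
  case (Cons a ys)
  have "linear (\<lambda>x. \<omega> x a * g ys)"
    by (intro linearI)
      (simp_all add: linear_add[OF assms[of a]] linear_scale[OF assms[of a]] algebra_simps)
  then show ?case using Cons[of "\<lambda>zs. g (a # zs)"] by (simp add: linear_compose_sub)
qed

lemma multilinear_list_pfaffian:
  assumes "\<And>x. linear (\<omega> x)" "\<And>y. linear (\<lambda>x. \<omega> x y)"
  shows "multilinear_list (pfaffian \<omega> n)"
proof (induction n)
  case 0
  then show ?case by (simp add: multilinear_list_def linear_zero)
next
  case (Suc n)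
  have "linear (\<lambda>u. pfaffian \<omega> (Suc n) (xs @ u # ys))" for xs ys
  proof (cases xs)
    case Nil
    then show ?thesis using contract_linear_left[of \<omega> "pfaffian \<omega> n" ys] assms(2) by simp
  next
    case (Cons a as)
    then show ?thesis
      using multilinear_list_contract[of \<omega> "pfaffian \<omega> n" a] Suc assms(1)
      by (simp add: multilinear_list_def)
  qed
  then show ?case unfolding multilinear_list_def by blast
qed

text \<open>For the first two entries the claim comes down to \<open>contract_anticommute\<close>;
  an exchange further back is inherited through \<open>antisymmetric_list_contract\<close>.\<close>

lemma antisymmetric_list_pfaffian:
  assumes "\<And>x y. \<omega> x y = - \<omega> y x"
  shows "antisymmetric_list (pfaffian \<omega> n)"
proof (induction n)
  case 0
  then show ?case by (simp add: antisymmetric_list_def)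
next
  case (Suc n)
  have "pfaffian \<omega> (Suc n) (xs @ u # v # ys) = - pfaffian \<omega> (Suc n) (xs @ v # u # ys)" for xs u v ys
  proof (cases xs)
    case Nil
    have "contract \<omega> u (\<lambda>zs. pfaffian \<omega> n (v # zs)) ys = - contract \<omega> v (\<lambda>zs. pfaffian \<omega> n (u # zs)) ys"
    proof (cases n)
      case (Suc m)
      then show ?thesis using contract_anticommute[of \<omega> u v "pfaffian \<omega> m" ys] by simp
    qed simp
    then show ?thesis using Nil assms[of u v] by simp
  next
    case (Cons a as)
    then show ?thesis
      using antisymmetric_list_contract[OF Suc, of \<omega> a] unfolding antisymmetric_list_def
      by (metis append_Cons pfaffian.simps(3))
  qed
  then show ?case unfolding antisymmetric_list_def by blast
qed

lemma contract_cong: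
  assumes "\<And>y. y \<in> set ys \<Longrightarrow> \<omega> x y = \<omega>' x y" and "\<And>zs. set zs \<subseteq> set ys \<Longrightarrow> g zs = h zs"
  shows "contract \<omega> x g ys = contract \<omega>' x h ys"
  using assms
proof (induction ys arbitrary: g h)
  case (Cons a ys)
  have "contract \<omega> x (\<lambda>zs. g (a # zs)) ys = contract \<omega>' x (\<lambda>zs. h (a # zs)) ys"
    by (intro Cons.IH) (auto intro: Cons.prems(1) intro!: Cons.prems(2))
  moreover have "g ys = h ys" using Cons.prems(2)[of ys] by auto
  ultimately show ?case using Cons.prems(1)[of a] by simp
qed simp

lemma pfaffian_cong:
  assumes "\<And>x y. x \<in> set xs \<Longrightarrow> y \<in> set xs \<Longrightarrow> \<omega> x y = \<omega>' x y"
  shows "pfaffian \<omega> n xs = pfaffian \<omega>' n xs"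
  using assms
proof (induction n arbitrary: xs)
  case (Suc n)
  show ?case
  proof (cases xs)
    case (Cons a as)
    have "contract \<omega> a (pfaffian \<omega> n) as = contract \<omega>' a (pfaffian \<omega>' n) as"
    proof (rule contract_cong)
      show "\<omega> a y = \<omega>' a y" if "y \<in> set as" for y
        using Suc.prems Cons that by simp
      show "pfaffian \<omega> n zs = pfaffian \<omega>' n zs" if "set zs \<subseteq> set as" for zs
        using Suc.prems Cons that by (intro Suc.IH) auto
    qed
    then show ?thesis using Cons by simp
  qed simp
qed simp

lemma contract_eq_zero: "(\<And>y. y \<in> set ys \<Longrightarrow> \<omega> x y = 0) \<Longrightarrow> contract \<omega> x g ys = 0"
  by (induction ys arbitrary: g) simp_all

lemma contract_uminus_form: "contract (\<lambda>x y. - \<omega> x y) x g ys = - contract \<omega> x g ys"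
  by (induction ys arbitrary: g) simp_all

text \<open>Each of the \<open>n\<close> pairings contributes one sign. With
  \<open>n = (q + 1) div 2\<close> this is the origin of the condition modulo 4.\<close>

lemma pfaffian_uminus: "pfaffian (\<lambda>x y. - \<omega> x y) n xs = (-1) ^ n * pfaffian \<omega> n xs"
proof (induction n arbitrary: xs)
  case (Suc n)
  then have "pfaffian (\<lambda>x y. - \<omega> x y) n = (\<lambda>xs. (-1) ^ n * pfaffian \<omega> n xs)" by blast
  then show ?case by (cases xs) (simp_all add: contract_uminus_form contract_mult)
qed simp

text \<open>The pair \<open>x\<close>, \<open>y\<close> splits off as a 2 by 2 block of the Gram
  matrix. Normal forms are evaluated by peeling off such blocks.\<close>

lemma pfaffian_hyperbolic:
  assumes "\<And>z. z \<in> set zs \<Longrightarrow> \<omega> x z = 0" and "\<And>z. z \<in> set zs \<Longrightarrow> \<omega> y z = 0"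
  shows "pfaffian \<omega> (Suc n) (x # y # zs) = \<omega> x y * pfaffian \<omega> n zs"
  using contract_eq_zero[of zs \<omega> x] assms(1) by simp

lemma continuous_on_contract:
  assumes "\<And>x y. continuous_on S (\<lambda>t. \<omega> t x y)" and "\<And>zs. continuous_on S (\<lambda>t. g t zs)"
  shows "continuous_on S (\<lambda>t. contract (\<omega> t) x (g t) ys)"
  using assms(2)
proof (induction ys arbitrary: g)
  case (Cons a ys)
  show ?case
    using Cons.IH[of "\<lambda>t zs. g t (a # zs)"] Cons.prems assms(1)
    by (auto intro!: continuous_intros)
qed simp

lemma continuous_on_pfaffian:
  assumes "\<And>x y. continuous_on S (\<lambda>t. \<omega> t x y)"
  shows "continuous_on S (\<lambda>t. pfaffian (\<omega> t) n xs)"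
proof (induction n arbitrary: xs)
  case (Suc n)
  then show ?case
    by (cases xs) (auto intro!: continuous_on_contract[OF assms])
qed simp

section \<open>Elementary moves between ordered bases\<close>

text \<open>Since \<open>c > 0\<close>, the segment from \<open>u\<close> to \<open>c *\<^sub>R u + s\<close> passes through bases only.\<close>

inductive basis_step :: "'v::real_vector list \<Rightarrow> 'v list \<Rightarrow> bool" where
  basis_stepI: "c > 0 \<Longrightarrow> s \<in> span (set xs \<union> set ys) \<Longrightarrow>
     basis_step (xs @ u # ys) (xs @ (c *\<^sub>R u + s) # ys)"

abbreviation basis_steps :: "'v::real_vector list \<Rightarrow> 'v list \<Rightarrow> bool" where
  "basis_steps \<equiv> basis_step\<^sup>*\<^sup>*"

lemma antisymmetric_list_repeated:
  fixes g :: "'v list \<Rightarrow> real"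
  assumes "antisymmetric_list g"
  shows "g (xs @ a # ys @ a # zs) = 0"
proof (induction ys arbitrary: xs)
  case Nil
  have "g (xs @ a # a # zs) = - g (xs @ a # a # zs)"
    using assms unfolding antisymmetric_list_def by blast
  then show ?case by simp
next
  case (Cons y ys)
  have "g (xs @ a # y # (ys @ a # zs)) = - g (xs @ y # a # (ys @ a # zs))"
    using assms unfolding antisymmetric_list_def by blast
  then show ?case using Cons[of "xs @ [y]"] by simp
qed

lemma alternating_zero_span:
  assumes "antisymmetric_list g" "multilinear_list g" "s \<in> span (set xs \<union> set ys)"
  shows "g (xs @ s # ys) = 0"
proof -
  have lin: "linear (\<lambda>u. g (xs @ u # ys))"
    using assms(2) unfolding multilinear_list_def by blast
  have "g (xs @ a # ys) = 0" if "a \<in> set xs \<union> set ys" for a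
  proof (cases "a \<in> set xs")
    case True
    then obtain p r where "xs = p @ a # r" by (meson split_list)
    then show ?thesis using antisymmetric_list_repeated[OF assms(1), of p a r ys] by simp
  next
    case False
    then have "a \<in> set ys" using that by simp
    then obtain p r where "ys = p @ a # r" by (meson split_list)
    then show ?thesis using antisymmetric_list_repeated[OF assms(1), of xs a p r] by simp
  qed
  note z = this
  have "(\<lambda>u. g (xs @ u # ys)) s = 0"
    using lin z assms(3) by (rule linear_eq_0_on_span)
  then show ?thesis by simp
qed

text \<open>The summand \<open>s\<close> contributes nothing to an alternating function, so its
  value is multiplied by \<open>c > 0\<close>. This makes the sign of a Pfaffian an invariant of the
  moves.\<close>

lemma basis_step_alternating:
  assumes "antisymmetric_list g" "multilinear_list g" "basis_step z z'"
  shows "sgn (g z') = sgn (g z)"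
  using assms(3)
proof cases
  case (basis_stepI c s xs ys u)
  have lin: "linear (\<lambda>u. g (xs @ u # ys))"
    using assms(2) unfolding multilinear_list_def by blast
  have "g (xs @ (c *\<^sub>R u + s) # ys) = c * g (xs @ u # ys)"
    using alternating_zero_span[OF assms(1,2) basis_stepI(4)]
      linear_add[OF lin, of "c *\<^sub>R u" s] linear_scale[OF lin, of c u] by simp
  then have "g z' = c * g z" using basis_stepI(1,2) by simp
  then show ?thesis using basis_stepI(3) by (simp add: sgn_mult)
qed

lemma basis_steps_alternating:
  assumes "basis_steps z z'" "antisymmetric_list g" "multilinear_list g"
  shows "sgn (g z') = sgn (g z)"
  using assms(1) by induction (use basis_step_alternating[OF assms(2,3)] in auto)

lemma span_replace:
  fixes u s :: "'v::real_vector"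
  assumes "c \<noteq> 0" "s \<in> span S"
  shows "span (insert (c *\<^sub>R u + s) S) = span (insert u S)"
proof (rule subset_antisym)
  have "s \<in> span (insert u S)" using assms(2) span_mono[of S "insert u S"] by blast
  moreover have "S \<subseteq> span (insert u S)" using span_superset[of "insert u S"] by blast
  ultimately show "span (insert (c *\<^sub>R u + s) S) \<subseteq> span (insert u S)"
    by (intro span_minimal) (auto intro: span_add span_scale span_base)
  have s': "s \<in> span (insert (c *\<^sub>R u + s) S)"
    using assms(2) span_mono[of S "insert (c *\<^sub>R u + s) S"] by blast
  have "u = (1 / c) *\<^sub>R ((c *\<^sub>R u + s) - s)" using assms(1) by simp
  also have "\<dots> \<in> span (insert (c *\<^sub>R u + s) S)"
    by (intro span_scale span_diff s' span_base) simp
  finally have "u \<in> span (insert (c *\<^sub>R u + s) S)" .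
  moreover have "S \<subseteq> span (insert (c *\<^sub>R u + s) S)"
    using span_superset[of "insert (c *\<^sub>R u + s) S"] by blast
  ultimately show "span (insert u S) \<subseteq> span (insert (c *\<^sub>R u + s) S)"
    by (intro span_minimal) auto
qed

lemma basis_step_span:
  assumes "basis_step z z'" shows "length z' = length z" "span (set z') = span (set z)"
  using assms by (cases; simp add: span_replace)+

lemma basis_steps_span:
  assumes "basis_steps z z'" shows "length z' = length z \<and> span (set z') = span (set z)"
  using assms by induction (simp_all add: basis_step_span)

text \<open>A quarter turn written as three shears: \<open>(a, d)\<close>,
  \<open>(a + d, d)\<close>, \<open>(a + d, - a)\<close>, \<open>(d, - a)\<close>.\<close>

lemma basis_steps_swap: "basis_steps (xs @ a # d # ys) (xs @ d # (- a) # ys)"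
proof -
  have "basis_step (xs @ a # d # ys) (xs @ (1 *\<^sub>R a + d) # d # ys)"
    by (rule basis_stepI) (auto intro: span_base)
  moreover have "basis_step ((xs @ [a + d]) @ d # ys) ((xs @ [a + d]) @ (1 *\<^sub>R d + - (a + d)) # ys)"
    by (rule basis_stepI) (simp, rule span_neg, rule span_base, simp)
  moreover have "basis_step (xs @ (a + d) # (- a) # ys) (xs @ (1 *\<^sub>R (a + d) + - a) # (- a) # ys)"
    by (rule basis_stepI) (auto intro: span_base)
  ultimately show ?thesis
    by simp
qed

text \<open>Two quarter turns make a half turn, so signs can be changed in pairs.\<close>

lemma basis_steps_rotate: "basis_steps (xs @ a # d # ys) (xs @ (- a) # (- d) # ys)"
  by (rule rtranclp_trans[OF basis_steps_swap[of xs a d ys] basis_steps_swap[of xs d "- a" ys]])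

text \<open>Exchange argument on the first vector \<open>u\<close> of \<open>bs\<close>. If
  \<open>c\<close> lies in the span of \<open>as\<close> and \<open>u\<close>, its coefficient at
  \<open>u\<close> is nonzero and \<open>u\<close> is replaced by \<open>c\<close>; otherwise
  \<open>c\<close> is produced behind \<open>u\<close> and exchanged with it by a quarter turn. The
  sign \<open>\<sigma>\<close> remains because a move scales by positive factors only.\<close>

lemma basis_steps_move_front:
  assumes "c \<in> span (set as \<union> set bs)" "c \<notin> span (set as)"
  shows "\<exists>\<sigma> bs'. (\<sigma> = 1 \<or> \<sigma> = -1) \<and> basis_steps (as @ bs) (as @ (\<sigma> *\<^sub>R c) # bs')"
  using assms
proof (induction bs arbitrary: as)
  case (Cons u bs)
  have direct: ?case if "c = k *\<^sub>R u + s" "s \<in> span (set as \<union> set bs)" "k \<noteq> 0" for k s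
  proof -
    have "basis_step (as @ u # bs) (as @ (\<bar>k\<bar> *\<^sub>R u + sgn k *\<^sub>R s) # bs)"
      using that by (intro basis_stepI) (auto intro: span_scale)
    moreover have "\<bar>k\<bar> *\<^sub>R u + sgn k *\<^sub>R s = sgn k *\<^sub>R c"
      using that(1) by (simp add: algebra_simps abs_sgn)
    ultimately have "basis_steps (as @ u # bs) (as @ (sgn k *\<^sub>R c) # bs)" by simp
    moreover have "sgn k = 1 \<or> sgn k = -1" using that(3) by (simp add: sgn_if)
    ultimately show ?thesis by blast
  qed
  show ?case
  proof (cases "c \<in> span (set (as @ [u]))")
    case True
    then have "c \<in> span (insert u (set as))" by simp
    then obtain k where k: "c - k *\<^sub>R u \<in> span (set as)" by (auto simp: span_insert)
    then have "k \<noteq> 0" using Cons.prems(2) by auto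
    moreover have "c - k *\<^sub>R u \<in> span (set as \<union> set bs)" using k span_mono by blast
    ultimately show ?thesis using direct[of k "c - k *\<^sub>R u"] by simp
  next
    case False
    have "c \<in> span (set (as @ [u]) \<union> set bs)" using Cons.prems(1) by simp
    from Cons.IH[OF this False] obtain \<sigma> bs' where \<sigma>: "\<sigma> = 1 \<or> \<sigma> = -1"
      and st: "basis_steps (as @ u # bs) (as @ u # (\<sigma> *\<^sub>R c) # bs')"
      by auto
    have "basis_steps (as @ u # bs) (as @ (\<sigma> *\<^sub>R c) # (- u) # bs')"
      using st basis_steps_swap[of as u "\<sigma> *\<^sub>R c" bs'] by (rule rtranclp_trans)
    then show ?thesis using \<sigma> by blast
  qed
qed simp

text \<open>Gaussian elimination by moves. A wrong sign is repaired by a half turn together with the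
  following vector, which exists at every place but the last; hence the two alternatives.\<close>

lemma basis_steps_reach:
  assumes "length bs = length cs" "cs \<noteq> []" "set cs \<subseteq> span (set as \<union> set bs)"
    and "\<And>p c r. cs = p @ c # r \<Longrightarrow> c \<notin> span (set as \<union> set p)"
  shows "basis_steps (as @ bs) (as @ cs) \<or> basis_steps (as @ bs) (as @ butlast cs @ [- last cs])"
  using assms
proof (induction cs arbitrary: as bs)
  case (Cons c cs)
  have "c \<notin> span (set as)" using Cons.prems(4)[of "[]" c cs] by simp
  then obtain \<sigma> bs' where \<sigma>: "\<sigma> = 1 \<or> \<sigma> = -1"
    and st: "basis_steps (as @ bs) (as @ (\<sigma> *\<^sub>R c) # bs')"
    using basis_steps_move_front[of c as bs] Cons.prems(3) by auto
  have len: "length bs' = length cs"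
    using basis_steps_span[OF st] Cons.prems(1) by simp
  show ?case
  proof (cases "cs = []")
    case True
    then show ?thesis using \<sigma> st len by auto
  next
    case False
    have "\<exists>bs''. basis_steps (as @ bs) (as @ c # bs'')"
    proof (cases "\<sigma> = 1")
      case True
      then show ?thesis using st by auto
    next
      case neg: False
      obtain d ds where "bs' = d # ds" using len False by (cases bs') auto
      then have "basis_steps (as @ (\<sigma> *\<^sub>R c) # bs') (as @ c # (- d) # ds)"
        using basis_steps_rotate[of as "- c" d ds] neg \<sigma> by simp
      then show ?thesis using st rtranclp_trans by metis
    qed
    then obtain bs'' where st2: "basis_steps (as @ bs) ((as @ [c]) @ bs'')" by auto
    have "length bs'' = length cs" using basis_steps_span[OF st2] Cons.prems(1) by simp
    moreover have "set cs \<subseteq> span (set (as @ [c]) \<union> set bs'')"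
      using basis_steps_span[OF st2] Cons.prems(3) by (simp add: sup_assoc)
    moreover have "d \<notin> span (set (as @ [c]) \<union> set p)" if "cs = p @ d # r" for p d r
      using Cons.prems(4)[of "c # p" d r] that by simp
    ultimately have "basis_steps ((as @ [c]) @ bs'') ((as @ [c]) @ cs) \<or>
        basis_steps ((as @ [c]) @ bs'') ((as @ [c]) @ butlast cs @ [- last cs])"
      using False by (intro Cons.IH) auto
    then show ?thesis using st2 False by (auto intro: rtranclp_trans)
  qed
qed simp

lemma independent_list:
  fixes cs :: "'v::euclidean_space list"
  assumes "span (set cs) = W" "length cs = dim W" "cs = p @ c # r"
  shows "c \<notin> span (set p \<union> set r)"
proof
  assume "c \<in> span (set p \<union> set r)"
  then have "span (set p \<union> set r) = W"
    using assms(1,3) by (simp add: insert_absorb span_redundant)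
  then have "dim W \<le> card (set p \<union> set r)"
    by (metis dim_le_card' dim_span finite_UnI finite_set)
  also have "\<dots> \<le> length p + length r"
    by (metis add_mono card_Un_le card_length le_trans)
  finally show False using assms(2,3) by simp
qed

text \<open>The alternatives are the two orientations of \<open>W\<close>. Only the bound by two is
  claimed here; the Pfaffian separates them later.\<close>

lemma basis_steps_dichotomy:
  fixes z e :: "'v::euclidean_space list"
  assumes "span (set z) = W" "length z = dim W" "span (set e) = W" "length e = dim W" "e \<noteq> []"
  shows "basis_steps z e \<or> basis_steps z (butlast e @ [- last e])"
proof -
  have "c \<notin> span (set [] \<union> set p)" if "e = p @ c # r" for p c r
    using independent_list[OF assms(3,4) that] span_mono[of "set p" "set p \<union> set r"] by auto
  then show ?thesis
    using basis_steps_reach[of z e "[]"] assms span_superset[of "set e"] by auto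
qed

section \<open>Alternating maps as sums of wedges\<close>

text \<open>The skew map belonging to the bivector of \<open>x\<close> and \<open>y\<close> when
  \<open>b\<close> turns vectors into functionals.\<close>

definition wedge :: "('v \<Rightarrow> 'v \<Rightarrow> real) \<Rightarrow> 'v \<Rightarrow> 'v \<Rightarrow> 'v \<Rightarrow> 'v::real_vector" where
  "wedge b x y p = b x p *\<^sub>R y - b y p *\<^sub>R x"

text \<open>Consecutive entries are paired, and an unpaired last entry is paired with
  \<open>l\<close>, so that one formula serves both parities of \<open>q\<close>.\<close>

fun wedge_sum :: "('v \<Rightarrow> 'v \<Rightarrow> real) \<Rightarrow> 'v \<Rightarrow> 'v list \<Rightarrow> 'v \<Rightarrow> 'v::real_vector" where
  "wedge_sum b l [] p = 0"
| "wedge_sum b l [x] p = wedge b x l p"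
| "wedge_sum b l (x # y # zs) p = wedge b x y p + wedge_sum b l zs p"

text \<open>The exponential series of a map whose cube vanishes, as \<open>nilrad_cube\<close>
  guarantees for the maps in question.\<close>

definition exp3 :: "('v \<Rightarrow> 'v) \<Rightarrow> 'v \<Rightarrow> 'v::real_vector" where
  "exp3 N x = x + N x + (1/2) *\<^sub>R N (N x)"

definition dual_lists :: "('v \<Rightarrow> 'v \<Rightarrow> real) \<Rightarrow> 'v list \<Rightarrow> 'v list \<Rightarrow> bool" where
  "dual_lists b z ps \<longleftrightarrow> length ps = length z \<and>
     (\<forall>i<length z. \<forall>j<length z. b (z ! i) (ps ! j) = (if i = j then 1 else 0))"

lemma in_span_list_sum:
  "x \<in> span (set z) \<Longrightarrow> \<exists>a. x = (\<Sum>i<length z. a i *\<^sub>R z ! i)"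
proof (induction z arbitrary: x)
  case (Cons y z)
  from Cons.prems obtain k where "x - k *\<^sub>R y \<in> span (set z)" by (auto simp: span_insert)
  from Cons.IH[OF this] obtain a where a: "x - k *\<^sub>R y = (\<Sum>i<length z. a i *\<^sub>R z ! i)" by blast
  have "x = (\<Sum>i<length (y # z). (case i of 0 \<Rightarrow> k | Suc j \<Rightarrow> a j) *\<^sub>R (y # z) ! i)"
    using a unfolding length_Cons sum.lessThan_Suc_shift by (simp add: algebra_simps)
  then show ?case by (rule exI[of _ "\<lambda>i. case i of 0 \<Rightarrow> k | Suc j \<Rightarrow> a j"])
qed simp

lemma bilinear_annihilator_exists:
  fixes b :: "'v::euclidean_space \<Rightarrow> 'v \<Rightarrow> real"
  assumes b: "bilinear b" and W: "subspace W" and S: "dim S < dim W"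
  shows "\<exists>p\<in>W. p \<noteq> 0 \<and> (\<forall>x\<in>S. b x p = 0)"
proof -
  define B where "B x = adjoint (b x) 1" for x
  have lin: "linear (b x)" for x using b by (simp add: bilinear_def)
  have B: "b x y = B x \<bullet> y" for x y
    using adjoint_works[OF lin[of x], of y 1] by (simp add: B_def inner_commute)
  have "linear B"
  proof (rule linearI)
    show "B (x + y) = B x + B y" for x y
      by (rule vector_eq_rdot[THEN iffD1])
        (auto simp: inner_add_left B[symmetric] bilinear_ladd[OF b])
    show "B (r *\<^sub>R x) = r *\<^sub>R B x" for r x
      by (rule vector_eq_rdot[THEN iffD1])
        (auto simp: B[symmetric] bilinear_lmul[OF b])
  qed
  then have dB: "dim (B ` S) \<le> dim S" by (rule dim_image_le)
  define C where "C = {y \<in> UNIV. \<forall>x\<in>span (B ` S). orthogonal x y}"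
  have C: "dim C + dim (span (B ` S)) = dim (UNIV :: 'v set)"
    unfolding C_def by (rule dim_subspace_orthogonal_to_vectors) auto
  have "subspace C"
    unfolding C_def by (auto simp: subspace_def orthogonal_def inner_add_right)
  then have "dim {x + y | x y. x \<in> W \<and> y \<in> C} + dim (W \<inter> C) = dim W + dim C"
    using W by (rule dim_sums_Int[rotated])
  moreover have "dim {x + y | x y. x \<in> W \<and> y \<in> C} \<le> dim (UNIV :: 'v set)"
    by (rule dim_subset) simp
  ultimately have "dim (W \<inter> C) > 0" using C dB S by simp
  then have "\<not> W \<inter> C \<subseteq> {0}" by (metis dim_eq_0 less_numeral_extra(3))
  then obtain p where p: "p \<in> W" "p \<in> C" "p \<noteq> 0" by blast
  have "b x p = 0" if "x \<in> S" for x
    using p(2) span_base[of "B x" "B ` S"] that by (auto simp: C_def B orthogonal_def)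
  then show ?thesis using p by blast
qed

section \<open>Splittings into two dual isotropic subspaces and an anisotropic line\<close>

locale split_form =
  fixes b :: "real^'n::finite \<Rightarrow> real^'n \<Rightarrow> real" and q :: nat and F0 Fi :: "(real^'n) set"
    and l :: "real^'n"
  assumes bilin: "bilinear b" and sym: "b x y = b y x"
    and sub0: "subspace F0" and subi: "subspace Fi" and dim0: "dim F0 = q" and dimi: "dim Fi = q"
    and iso0: "x \<in> F0 \<Longrightarrow> y \<in> F0 \<Longrightarrow> b x y = 0"
    and isoi: "x \<in> Fi \<Longrightarrow> y \<in> Fi \<Longrightarrow> b x y = 0"
    and l0: "x \<in> F0 \<Longrightarrow> b x l = 0" and li: "x \<in> Fi \<Longrightarrow> b x l = 0" and ll: "b l l \<noteq> 0"
    and decomp: "\<exists>p\<in>F0. \<exists>a. \<exists>f\<in>Fi. x = p + a *\<^sub>R l + f"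
    and perf0: "p \<in> F0 \<Longrightarrow> (\<And>f. f \<in> Fi \<Longrightarrow> b f p = 0) \<Longrightarrow> p = 0"
    and perfi: "f \<in> Fi \<Longrightarrow> (\<And>p. p \<in> F0 \<Longrightarrow> b f p = 0) \<Longrightarrow> f = 0"
    and card: "CARD('n) = 2 * q + 1" and qpos: "q > 0"
begin

text \<open>The hypotheses are symmetric in the two isotropic subspaces, so every result proved for
  \<open>Fi\<close> can be used for \<open>F0\<close>.\<close>

lemma swap: "split_form b q Fi F0 l"
proof
  show "\<exists>p\<in>Fi. \<exists>a. \<exists>f\<in>F0. x = p + a *\<^sub>R l + f" for x
    using decomp[of x] by (metis add.commute add.left_commute)
  show "p = 0" if "p \<in> Fi" "\<And>f. f \<in> F0 \<Longrightarrow> b f p = 0" for p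
    using perfi[OF that(1)] that(2) sym by metis
  show "f = 0" if "f \<in> F0" "\<And>p. p \<in> Fi \<Longrightarrow> b f p = 0" for f
    using perf0[OF that(1)] that(2) sym by metis
qed (use bilin sym sub0 subi dim0 dimi iso0 isoi l0 li ll card qpos in auto)

lemmas b_simps = bilinear_ladd[OF bilin] bilinear_radd[OF bilin] bilinear_lmul[OF bilin]
  bilinear_rmul[OF bilin] bilinear_lneg[OF bilin] bilinear_rneg[OF bilin]
  bilinear_lzero[OF bilin] bilinear_rzero[OF bilin] bilinear_lsub[OF bilin] bilinear_rsub[OF bilin]

lemma l0': "x \<in> F0 \<Longrightarrow> b l x = 0" and li': "x \<in> Fi \<Longrightarrow> b l x = 0"
  using l0 li sym by metis+

lemma nondeg: assumes "\<And>y. b x y = 0" shows "x = 0"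
proof -
  obtain p a f where x: "p \<in> F0" "f \<in> Fi" "x = p + a *\<^sub>R l + f" using decomp by blast
  have "a * b l l = 0" using assms[of l] x l0 li by (simp add: b_simps)
  then have a: "a = 0" using ll by simp
  have "b g p = 0" if "g \<in> Fi" for g
    using assms[of g] x that isoi li a sym by (simp add: b_simps)
  then have p: "p = 0" using perf0 x(1) by blast
  have "b f r = 0" if "r \<in> F0" for r using assms[of r] x a p by simp
  then have "f = 0" using perfi x(2) by blast
  then show ?thesis using x a p by simp
qed

definition Oi :: "(real^'n) set" where "Oi = form_orthogonal b Fi"

lemma Oi_iff: "x \<in> Oi \<longleftrightarrow> (\<forall>f\<in>Fi. b x f = 0)"
  by (simp add: Oi_def form_orthogonal_def)

lemma Fi_Oi: "Fi \<subseteq> Oi" using isoi by (auto simp: Oi_iff)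

lemma l_Oi: "l \<in> Oi" using li' by (simp add: Oi_iff)

lemma subspace_Oi: "subspace Oi"
  by (auto simp: subspace_def Oi_iff b_simps)

lemma Oi_decomp: assumes "x \<in> Oi" shows "\<exists>a. \<exists>f\<in>Fi. x = a *\<^sub>R l + f"
proof -
  obtain p a f where x: "p \<in> F0" "f \<in> Fi" "x = p + a *\<^sub>R l + f" using decomp by blast
  have "b g p = 0" if "g \<in> Fi" for g
    using assms x that isoi li li' sym[of p g] by (auto simp: b_simps Oi_iff)
  then have "p = 0" using perf0 x(1) by blast
  then show ?thesis using x by auto
qed

lemma Oi_l_Fi: assumes "x \<in> Oi" "b x l = 0" shows "x \<in> Fi"
proof -
  obtain a f where x: "f \<in> Fi" "x = a *\<^sub>R l + f" using Oi_decomp assms(1) by blast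
  then have "a = 0" using assms(2) ll li by (simp add: b_simps)
  then show ?thesis using x by simp
qed

lemma Oi_Int_F0: "x \<in> Oi \<Longrightarrow> x \<in> F0 \<Longrightarrow> x = 0"
  using perf0[of x] sym[of x] by (auto simp: Oi_iff)

lemma Oi_b_Fi: "x \<in> Oi \<Longrightarrow> f \<in> Fi \<Longrightarrow> b x f = 0" "x \<in> Oi \<Longrightarrow> f \<in> Fi \<Longrightarrow> b f x = 0"
  using sym by (auto simp: Oi_iff)

text \<open>If \<open>S\<close> spanned less than \<open>Fi\<close>, a dimension count would give a
  nonzero vector of \<open>F0\<close> annihilated by \<open>S\<close>.\<close>

lemma span_eq_Fi:
  assumes "S \<subseteq> Fi" "\<And>p. p \<in> F0 \<Longrightarrow> (\<And>x. x \<in> S \<Longrightarrow> b x p = 0) \<Longrightarrow> p = 0"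
  shows "span S = Fi"
proof -
  have "\<not> dim S < dim F0"
    using bilinear_annihilator_exists[OF bilin sub0, of S] assms(2) by blast
  moreover have "span S \<subseteq> Fi" using assms(1) subi by (simp add: span_minimal)
  ultimately show ?thesis
    using subspace_dim_equal[of "span S" Fi] subi dim0 dimi by simp
qed

lemma dual_list_exists:
  assumes z: "span (set z) = Fi" "length z = q"
  shows "\<exists>ps. dual_lists b z ps \<and> set ps \<subseteq> F0"
proof -
  have sz: "set z \<subseteq> Fi" using z(1) span_superset by blast
  have "\<exists>p\<in>F0. \<forall>j<q. b (z ! j) p = (if j = i then 1 else 0)" if i: "i < q" for i
  proof -
    \<comment> \<open>The other \<open>q - 1\<close> vectors have a common nonzero annihilator
      \<open>p\<close> in \<open>F0\<close>. It cannot annihilate \<open>z ! i\<close> as well,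
      since it would then annihilate \<open>Fi\<close>; a multiple of \<open>p\<close> is the dual
      vector.\<close>
    define S where "S = set (take i z @ drop (Suc i) z)"
    have "dim S \<le> card S" unfolding S_def by (intro dim_le_card') simp
    also have "\<dots> \<le> length (take i z @ drop (Suc i) z)" unfolding S_def by (rule card_length)
    also have "\<dots> < q" using i z(2) by simp
    finally obtain p where p: "p \<in> F0" "p \<noteq> 0" "\<And>x. x \<in> S \<Longrightarrow> b x p = 0"
      using bilinear_annihilator_exists[OF bilin sub0, of S] dim0 by blast
    have j: "z ! j \<in> S" if "j < q" "j \<noteq> i" for j
    proof (cases "j < i")
      case True
      then have "take i z ! j \<in> set (take i z)" using i z(2) by (intro nth_mem) simp
      then show ?thesis using True by (simp add: S_def)
    next
      case False
      then have "drop (Suc i) z ! (j - Suc i) \<in> set (drop (Suc i) z)"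
        using that z(2) by (intro nth_mem) simp
      then show ?thesis using False that z(2) by (simp add: S_def)
    qed
    have ne: "b (z ! i) p \<noteq> 0"
    proof
      assume 0: "b (z ! i) p = 0"
      have "b x p = 0" if "x \<in> set z" for x
        using that j p(3) 0 z(2) by (metis in_set_conv_nth)
      moreover have "linear (\<lambda>x. b x p)" using bilin by (simp add: bilinear_def)
      ultimately have "b x p = 0" if "x \<in> Fi" for x
        using linear_eq_0_on_span[of "\<lambda>x. b x p" "set z" x] that z(1) by blast
      then show False using perf0 p by blast
    qed
    show ?thesis
    proof (intro bexI allI impI)
      show "(1 / b (z ! i) p) *\<^sub>R p \<in> F0" using p(1) sub0 by (simp add: subspace_scale)
      show "b (z ! j) ((1 / b (z ! i) p) *\<^sub>R p) = (if j = i then 1 else 0)" if "j < q" for j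
        using ne j[OF that] p(3) by (auto simp: b_simps)
    qed
  qed
  then obtain f where f: "\<And>i. i < q \<Longrightarrow> f i \<in> F0"
    "\<And>i j. i < q \<Longrightarrow> j < q \<Longrightarrow> b (z ! j) (f i) = (if j = i then 1 else 0)" by metis
  then show ?thesis
    by (intro exI[of _ "map f [0..<q]"]) (auto simp: dual_lists_def z(2))
qed

lemma dual_list_span:
  assumes z: "span (set z) = Fi" "length z = q" and ps: "dual_lists b z ps" "set ps \<subseteq> F0"
  shows "span (set ps) = F0"
proof -
  interpret sw: split_form b q Fi F0 l by (rule swap)
  show ?thesis
  proof (rule sw.span_eq_Fi[OF ps(2)])
    fix x assume x: "x \<in> Fi" "\<And>p. p \<in> set ps \<Longrightarrow> b p x = 0"
    obtain a where a: "x = (\<Sum>i<q. a i *\<^sub>R z ! i)"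
      using in_span_list_sum[of x z] x(1) z by auto
    have "a j = 0" if j: "j < q" for j
    proof -
      have lin: "linear (\<lambda>x. b x (ps ! j))" using bilin by (simp add: bilinear_def)
      have "0 = b x (ps ! j)" using x(2)[of "ps ! j"] j ps(1) z(2) sym[of x] by (simp add: dual_lists_def)
      also have "\<dots> = (\<Sum>i<q. a i * b (z ! i) (ps ! j))"
        unfolding a by (simp add: linear_sum[OF lin] linear_scale[OF lin])
      also have "\<dots> = (\<Sum>i<q. if i = j then a i else 0)"
        by (rule sum.cong) (use ps(1) z(2) j in \<open>auto simp: dual_lists_def\<close>)
      also have "\<dots> = a j" using j by simp
      finally show ?thesis by simp
    qed
    then show "x = 0" using a by simp
  qed
qed

lemma dual_lists_flip: "dual_lists b z ps \<longleftrightarrow> dual_lists b ps z"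
  unfolding dual_lists_def using sym by (metis (no_types, lifting))

lemma ex_basis_list: "\<exists>z. span (set z) = Fi \<and> length z = q"
proof -
  obtain B where B: "B \<subseteq> Fi" "independent B" "Fi \<subseteq> span B" "card B = dim Fi"
    by (rule basis_exists)
  obtain z where "set z = B" "distinct z"
    using finite_distinct_list[of B] B(2) independent_imp_finite by blast
  moreover have "span B = Fi" using B subi by (simp add: span_minimal subset_antisym)
  ultimately show ?thesis using B(4) dimi by (metis distinct_card)
qed

lemma riesz:
  fixes \<phi> :: "real^'n \<Rightarrow> real"
  assumes "linear \<phi>" shows "\<exists>v\<in>Fi. \<forall>p\<in>F0. b v p = \<phi> p"
proof -
  obtain z where z: "span (set z) = Fi" "length z = q" using ex_basis_list by blast
  obtain ps where ps: "dual_lists b z ps" "set ps \<subseteq> F0" using dual_list_exists[OF z] by blast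
  have len: "length ps = q" using ps(1) z by (simp add: dual_lists_def)
  define v where "v = (\<Sum>i<q. \<phi> (ps ! i) *\<^sub>R z ! i)"
  have "z ! i \<in> Fi" if "i < q" for i using that z span_base nth_mem by metis
  then have v: "v \<in> Fi" unfolding v_def using subi by (auto intro!: subspace_sum subspace_scale)
  have 1: "b v (ps ! j) = \<phi> (ps ! j)" if j: "j < q" for j
  proof -
    have lin: "linear (\<lambda>x. b x (ps ! j))" using bilin by (simp add: bilinear_def)
    have "b v (ps ! j) = (\<Sum>i<q. \<phi> (ps ! i) * b (z ! i) (ps ! j))"
      unfolding v_def by (simp add: linear_sum[OF lin] linear_scale[OF lin])
    also have "\<dots> = (\<Sum>i<q. if i = j then \<phi> (ps ! i) else 0)"
      by (rule sum.cong) (use ps(1) z(2) j in \<open>auto simp: dual_lists_def\<close>)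
    finally show ?thesis using j by simp
  qed
  have lin: "linear (\<lambda>p. b v p - \<phi> p)"
    using assms bilin by (simp add: bilinear_def linear_compose_sub)
  have "b v p - \<phi> p = 0" if "p \<in> F0" for p
  proof (rule linear_eq_0_on_span[OF lin])
    show "p \<in> span (set ps)" using dual_list_span[OF z ps] that by simp
    show "b v x - \<phi> x = 0" if "x \<in> set ps" for x
      using that 1 len by (metis in_set_conv_nth right_minus_eq)
  qed
  then show ?thesis using v by auto
qed

text \<open>The Lie algebra of the unipotent radical: skew maps that lower the flag of
  \<open>Fi\<close>, \<open>Oi\<close> and the whole space by one step, which gives
  \<open>N (N (N x)) = 0\<close>.\<close>

definition nilrad :: "(real^'n \<Rightarrow> real^'n) \<Rightarrow> bool" where
  "nilrad N \<longleftrightarrow> linear N \<and> (\<forall>x y. b (N x) y = - b x (N y)) \<and> (\<forall>x. N x \<in> Oi) \<and>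
     (\<forall>x\<in>Oi. N x \<in> Fi) \<and> (\<forall>x\<in>Fi. N x = 0)"

lemma nilrad_linear: "nilrad N \<Longrightarrow> linear N" by (simp add: nilrad_def)
lemma nilrad_skew: "nilrad N \<Longrightarrow> b (N x) y = - b x (N y)" by (simp add: nilrad_def)
lemma nilrad_Oi: "nilrad N \<Longrightarrow> N x \<in> Oi" by (simp add: nilrad_def)
lemma nilrad_Fi: "nilrad N \<Longrightarrow> x \<in> Oi \<Longrightarrow> N x \<in> Fi" by (simp add: nilrad_def)
lemma nilrad_0: "nilrad N \<Longrightarrow> x \<in> Fi \<Longrightarrow> N x = 0" by (simp add: nilrad_def)
lemma nilrad_cube: "nilrad N \<Longrightarrow> N (N (N x)) = 0" by (simp add: nilrad_def)
lemma nilrad_self: "nilrad N \<Longrightarrow> b (N x) x = 0" using nilrad_skew[of N x x] sym[of x "N x"] by simp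

lemma nilrad_add: assumes "nilrad M" "nilrad N" shows "nilrad (\<lambda>x. M x + N x)"
  using assms subi subspace_Oi
  by (auto simp: nilrad_def linear_compose_add b_simps subspace_add)

lemma nilrad_scale: assumes "nilrad N" shows "nilrad (\<lambda>x. c *\<^sub>R N x)"
  using assms subi subspace_Oi
  by (auto simp: nilrad_def linear_compose_scale_right b_simps subspace_scale)

lemma nilrad_uminus: "nilrad N \<Longrightarrow> nilrad (\<lambda>x. - N x)"
  using nilrad_scale[of N "-1"] by simp

lemma nilrad_zero: "nilrad (\<lambda>x. 0)"
  using subi subspace_Oi by (auto simp: nilrad_def linear_zero b_simps subspace_0)

lemma linear_wedge: "linear (wedge b x y)"
  by (rule linearI) (simp_all add: wedge_def b_simps algebra_simps)

lemma wedge_skew: "b (wedge b x y p) p' = - b p (wedge b x y p')"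
  using sym[of p x] sym[of p y] by (simp add: wedge_def b_simps)

lemma nilrad_wedge:
  assumes "x \<in> Fi" "y \<in> Oi"
  shows "nilrad (wedge b x y)"
  unfolding nilrad_def
proof (intro conjI allI ballI)
  show "linear (wedge b x y)" by (rule linear_wedge)
  show "b (wedge b x y p) p' = - b p (wedge b x y p')" for p p' by (rule wedge_skew)
  show "wedge b x y p \<in> Oi" for p
    using assms Fi_Oi subspace_Oi unfolding wedge_def by (auto intro!: subspace_diff subspace_scale)
  show "wedge b x y p \<in> Fi" if "p \<in> Oi" for p
    using Oi_b_Fi(2)[OF that assms(1)] assms(1) subi by (simp add: wedge_def subspace_scale subspace_neg)
  show "wedge b x y p = 0" if "p \<in> Fi" for p
    using Oi_b_Fi(1)[OF assms(2) that] isoi[OF assms(1) that] by (simp add: wedge_def)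
qed

lemma nilrad_wedge_sum: "set z \<subseteq> Fi \<Longrightarrow> nilrad (wedge_sum b l z)"
proof (induction z rule: induct_list012)
  case 1
  have "wedge_sum b l [] = (\<lambda>p. 0)" by auto
  then show ?case using nilrad_zero by simp
next
  case (2 x)
  have "wedge_sum b l [x] = wedge b x l" by auto
  then show ?case using nilrad_wedge[of x l] l_Oi 2 by simp
next
  case (3 x y zs)
  have "wedge_sum b l (x # y # zs) = (\<lambda>p. wedge b x y p + wedge_sum b l zs p)" by auto
  moreover have "nilrad (wedge b x y)" using 3 Fi_Oi by (intro nilrad_wedge) auto
  ultimately show ?case using nilrad_add 3 by simp
qed

lemma wedge_sum_append:
  "even (length z) \<Longrightarrow> wedge_sum b l (z @ w) p = wedge_sum b l z p + wedge_sum b l w p"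
  by (induction z rule: induct_list012) auto

lemma wedge_sum_in_span: "wedge_sum b l z p \<in> span (insert l (set z))"
proof (induction z rule: induct_list012)
  case (2 x)
  have "wedge b x l p \<in> span (insert l (set [x]))"
    unfolding wedge_def by (intro span_diff span_scale span_base) auto
  then show ?case by simp
next
  case (3 x y zs)
  have "wedge_sum b l zs p \<in> span (insert l (set (x # y # zs)))"
    using 3(1) span_mono[of "insert l (set zs)" "insert l (set (x # y # zs))"] by auto
  moreover have "wedge b x y p \<in> span (insert l (set (x # y # zs)))"
    unfolding wedge_def by (intro span_diff span_scale span_base) auto
  ultimately show ?case by (simp add: span_add)
qed (simp add: span_zero)

lemma dual_lists_Cons:
  assumes "dual_lists b (x # z) (p # ps)"
  shows "dual_lists b z ps" "b x p = 1" "\<And>y. y \<in> set z \<Longrightarrow> b y p = 0" "\<And>r. r \<in> set ps \<Longrightarrow> b x r = 0"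
proof -
  have len: "length ps = length z" using assms by (simp add: dual_lists_def)
  have *: "b ((x # z) ! i) ((p # ps) ! j) = (if i = j then 1 else 0)" if "i < Suc (length z)" "j < Suc (length z)" for i j
    using assms that by (simp add: dual_lists_def)
  show "dual_lists b z ps" unfolding dual_lists_def
    using *[of "Suc i" "Suc j" for i j] len by simp
  show "b x p = 1" using *[of 0 0] by simp
  show "b y p = 0" if "y \<in> set z" for y
  proof -
    obtain i where "i < length z" "y = z ! i" using \<open>y \<in> set z\<close> by (metis in_set_conv_nth)
    then show ?thesis using *[of "Suc i" 0] by simp
  qed
  show "b x r = 0" if "r \<in> set ps" for r
  proof -
    obtain i where "i < length z" "r = ps ! i" using \<open>r \<in> set ps\<close> len by (metis in_set_conv_nth)
    then show ?thesis using *[of 0 "Suc i"] by simp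
  qed
qed

lemma b_span_zero:
  assumes "u \<in> span S" "\<And>s. s \<in> S \<Longrightarrow> b s p = 0" shows "b u p = 0"
proof -
  have "linear (\<lambda>x. b x p)" using bilin by (simp add: bilinear_def)
  then show ?thesis using linear_eq_0_on_span[of "\<lambda>x. b x p" S u] assms by blast
qed

text \<open>Pairing the sum with the dual vectors \<open>p\<close> and \<open>p'\<close> of the
  first pair reads off \<open>- b y' w\<close> and \<open>b y w\<close>: the later terms lie in the
  span of \<open>l\<close> and \<open>zs\<close>, which \<open>p\<close> and \<open>p'\<close>
  annihilate. The pairs are thus peeled off one by one.\<close>

lemma wedge_sum_zero:
  assumes "dual_lists b z ps" "set ps \<subseteq> F0" "wedge_sum b l z w = 0" "w \<in> F0" "x \<in> set z"
  shows "b x w = 0"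
  using assms
proof (induction z arbitrary: ps rule: induct_list012)
  case (2 y)
  then have "b y w *\<^sub>R l = 0" using l0' by (simp add: wedge_def)
  then show ?case using ll 2 by (auto simp: b_simps)
next
  case (3 y y' zs)
  then obtain p p' rs where ps: "ps = p # p' # rs"
    by (cases ps; cases "tl ps") (auto simp: dual_lists_def)
  have d1: "dual_lists b (y # y' # zs) (p # p' # rs)" using 3 ps by simp
  note c1 = dual_lists_Cons[OF d1]
  note c2 = dual_lists_Cons[OF c1(1)]
  have lp: "b l p = 0" "b l p' = 0" using 3(4) ps l0' by auto
  have s: "b (wedge_sum b l zs w) p = 0" "b (wedge_sum b l zs w) p' = 0"
    using b_span_zero[OF wedge_sum_in_span[of zs w]] lp c1(3) c2(3) by auto
  have z: "wedge b y y' w + wedge_sum b l zs w = 0" using 3(5) by simp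
  have "b (wedge b y y' w + wedge_sum b l zs w) p = - b y' w"
    using s c1(2) c1(3)[of y'] by (simp add: wedge_def b_simps)
  then have y': "b y' w = 0" using z by (simp add: b_simps)
  have "b (wedge b y y' w + wedge_sum b l zs w) p' = b y w"
    using s c2(2) c1(4)[of p'] by (simp add: wedge_def b_simps)
  then have y: "b y w = 0" using z by (simp add: b_simps)
  have "wedge_sum b l zs w = 0" using z y y' by (simp add: wedge_def)
  then show ?case using 3(1)[OF c2(1)] 3 ps y y' by auto
qed simp

end

section \<open>The big cell\<close>

context split_form begin

lemma exp3_linear: "linear N \<Longrightarrow> linear (exp3 N)"
  by (rule linearI) (simp_all add: exp3_def linear_add linear_scale algebra_simps)

text \<open>Skewness moves all factors to one side. The terms of degree one cancel, those of degree
  two cancel because \<open>b (N x) (N y)\<close> is \<open>- b x (N (N y))\<close>, and higher ones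
  contain the cube of \<open>N\<close>.\<close>

lemma exp3_isometry:
  assumes "nilrad N" shows "b (exp3 N x) (exp3 N y) = b x y"
proof -
  note sk = nilrad_skew[OF assms]
  have "b (N (N x)) y = b x (N (N y))" "b (N x) (N (N y)) = 0" "b (N (N x)) (N y) = 0"
    "b (N (N x)) (N (N y)) = 0" "b (N x) (N y) = - b x (N (N y))"
    using sk nilrad_cube[OF assms] by (simp_all add: b_simps)
  then show ?thesis by (simp add: exp3_def b_simps sk)
qed

lemma exp3_inverse:
  assumes "nilrad N" shows "exp3 N (exp3 (\<lambda>x. - N x) x) = x"
proof -
  note lin = nilrad_linear[OF assms]
  show ?thesis
    by (simp add: exp3_def linear_add[OF lin] linear_scale[OF lin] linear_neg[OF lin]
        linear_diff[OF lin] nilrad_cube[OF assms] linear_0[OF lin] algebra_simps flip: scaleR_2)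
qed

lemma exp3_inverse': "nilrad N \<Longrightarrow> exp3 (\<lambda>x. - N x) (exp3 N x) = x"
  using exp3_inverse[OF nilrad_uminus, of N x] by simp

lemma exp3_Fi: "nilrad N \<Longrightarrow> x \<in> Fi \<Longrightarrow> exp3 N x = x"
  using nilrad_0[of N x] nilrad_0[of N 0] subspace_0[OF subi] by (simp add: exp3_def)

lemma exp3_diff_Oi: "nilrad N \<Longrightarrow> exp3 N x - x \<in> Oi"
  using subspace_Oi nilrad_Oi[of N] by (auto simp: exp3_def intro!: subspace_add subspace_scale)

lemma exp3_diff_Fi: "nilrad N \<Longrightarrow> x \<in> Oi \<Longrightarrow> exp3 N x - x \<in> Fi"
  using subi nilrad_Fi[of N] nilrad_Oi[of N] by (auto simp: exp3_def intro!: subspace_add subspace_scale)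

lemma transverse_Fi: "transverse b G Fi \<longleftrightarrow> direct_sum_eq_UNIV G Oi"
  by (simp add: transverse_def Oi_def)

lemma Omega_Fi_iff: "G \<in> Omega b q Fi \<longleftrightarrow> subspace G \<and> dim G = q \<and>
    (\<forall>x\<in>G. \<forall>y\<in>G. b x y = 0) \<and> direct_sum_eq_UNIV G Oi"
  by (simp add: Omega_def isotropic_subspaces_def transverse_Fi)

lemma direct_sum_F0: "direct_sum_eq_UNIV F0 Oi"
  unfolding direct_sum_eq_UNIV_def
proof
  show "F0 \<inter> Oi = {0}"
    using Oi_Int_F0 subspace_0[OF sub0] subspace_0[OF subspace_Oi] by blast
  have "\<exists>p r. x = p + r \<and> p \<in> F0 \<and> r \<in> Oi" for x
  proof -
    obtain p a f where x: "p \<in> F0" "f \<in> Fi" "x = p + a *\<^sub>R l + f" using decomp by blast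
    moreover have "a *\<^sub>R l + f \<in> Oi"
      using x l_Oi Fi_Oi subspace_Oi by (auto intro: subspace_add subspace_scale)
    ultimately show ?thesis by (metis add.assoc)
  qed
  then show "{x + y |x y. x \<in> F0 \<and> y \<in> Oi} = UNIV" by blast
qed

lemma F0_Omega: "F0 \<in> Omega b q Fi"
  using sub0 dim0 iso0 direct_sum_F0 by (simp add: Omega_Fi_iff)

lemma dim_Oi: "dim Oi = q + 1"
proof -
  have "dim {x + y |x y. x \<in> F0 \<and> y \<in> Oi} + dim (F0 \<inter> Oi) = dim F0 + dim Oi"
    by (rule dim_sums_Int[OF sub0 subspace_Oi])
  then show ?thesis
    using direct_sum_F0 dim0 card by (simp add: direct_sum_eq_UNIV_def)
qed

lemma direct_sum_OiI:
  assumes "subspace G" "dim G = q" "\<And>x. x \<in> G \<Longrightarrow> x \<in> Oi \<Longrightarrow> x = 0"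
  shows "direct_sum_eq_UNIV G Oi"
proof -
  have i: "G \<inter> Oi = {0}"
    using assms(3) subspace_0[OF assms(1)] subspace_0[OF subspace_Oi] by blast
  have "dim {x + y |x y. x \<in> G \<and> y \<in> Oi} + dim (G \<inter> Oi) = dim G + dim Oi"
    by (rule dim_sums_Int[OF assms(1) subspace_Oi])
  then have "dim {x + y |x y. x \<in> G \<and> y \<in> Oi} = dim (UNIV :: (real^'n) set)"
    using i assms(2) dim_Oi card by simp
  then have "{x + y |x y. x \<in> G \<and> y \<in> Oi} = UNIV"
    using subspace_sums[OF assms(1) subspace_Oi] by (intro subspace_dim_equal) auto
  then show ?thesis using i by (simp add: direct_sum_eq_UNIV_def)
qed

section \<open>Projection along the orthogonal of \<open>Fi\<close>, and exponential
  coordinates\<close>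

definition proj :: "(real^'n) set \<Rightarrow> real^'n \<Rightarrow> real^'n" where
  "proj G x = (THE y. y \<in> G \<and> x - y \<in> Oi)"

lemma proj_ex1: assumes "G \<in> Omega b q Fi" shows "\<exists>!y. y \<in> G \<and> x - y \<in> Oi"
proof -
  have G: "subspace G" "G \<inter> Oi = {0}" "{x + y |x y. x \<in> G \<and> y \<in> Oi} = UNIV"
    using assms by (auto simp: Omega_Fi_iff direct_sum_eq_UNIV_def)
  obtain y r where "x = y + r" "y \<in> G" "r \<in> Oi" using G(3) by blast
  then have ex: "y \<in> G \<and> x - y \<in> Oi" by simp
  have "y' = y" if "y' \<in> G \<and> x - y' \<in> Oi" for y'
  proof -
    have "(x - y) - (x - y') \<in> Oi" using ex that subspace_Oi by (blast intro: subspace_diff)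
    moreover have "y' - y \<in> G" using ex that G(1) by (blast intro: subspace_diff)
    ultimately have "y' - y \<in> G \<inter> Oi" by simp
    then show ?thesis using G(2) by simp
  qed
  then show ?thesis using ex by blast
qed

lemma proj_in: "G \<in> Omega b q Fi \<Longrightarrow> proj G x \<in> G"
  and proj_diff: "G \<in> Omega b q Fi \<Longrightarrow> x - proj G x \<in> Oi"
  using theI'[OF proj_ex1[of G x]] by (auto simp: proj_def)

lemma proj_eqI: "G \<in> Omega b q Fi \<Longrightarrow> y \<in> G \<Longrightarrow> x - y \<in> Oi \<Longrightarrow> proj G x = y"
  using proj_ex1[of G x] proj_in[of G x] proj_diff[of G x] by blast

lemma proj_linear: assumes G: "G \<in> Omega b q Fi" shows "linear (proj G)"
proof (rule linearI)
  have s: "subspace G" using G by (simp add: Omega_Fi_iff)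
  show "proj G (x + y) = proj G x + proj G y" for x y
  proof (rule proj_eqI[OF G])
    show "proj G x + proj G y \<in> G" using proj_in[OF G] s by (simp add: subspace_add)
    have "(x - proj G x) + (y - proj G y) \<in> Oi"
      using proj_diff[OF G] subspace_Oi by (blast intro: subspace_add)
    then show "x + y - (proj G x + proj G y) \<in> Oi" by (simp add: algebra_simps)
  qed
  show "proj G (r *\<^sub>R x) = r *\<^sub>R proj G x" for r x
  proof (rule proj_eqI[OF G])
    show "r *\<^sub>R proj G x \<in> G" using proj_in[OF G] s by (simp add: subspace_scale)
    have "r *\<^sub>R (x - proj G x) \<in> Oi"
      using proj_diff[OF G] subspace_Oi by (blast intro: subspace_scale)
    then show "r *\<^sub>R x - r *\<^sub>R proj G x \<in> Oi" by (simp add: algebra_simps)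
  qed
qed

lemma proj_Oi: "G \<in> Omega b q Fi \<Longrightarrow> x \<in> Oi \<Longrightarrow> proj G x = 0"
  by (rule proj_eqI) (auto simp: Omega_Fi_iff subspace_0)

text \<open>\<open>g\<close> moves each vector within its class modulo \<open>Oi\<close>, so the
  image of \<open>F0\<close> meets \<open>Oi\<close> as trivially as \<open>F0\<close> does.\<close>

lemma isometry_image_Omega:
  assumes lin: "linear g" and iso: "\<And>x y. b (g x) (g y) = b x y"
    and Oi: "\<And>x. x \<in> Oi \<Longrightarrow> g x \<in> Oi" and diff: "\<And>x. g x - x \<in> Oi"
  shows "g ` F0 \<in> Omega b q Fi"
proof -
  have inj: "inj g"
    unfolding linear_injective_0[OF lin]
  proof (intro allI impI)
    fix x assume "g x = 0"
    then have "b x y = 0" for y using iso[of x y] by (simp add: b_simps)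
    then show "x = 0" by (rule nondeg)
  qed
  have s: "subspace (g ` F0)" using lin sub0 by (rule linear_subspace_image)
  have d: "dim (g ` F0) = q"
    using dim_image_eq[OF lin, of F0] inj dim0 by (metis inj_on_subset subset_UNIV)
  have "direct_sum_eq_UNIV (g ` F0) Oi"
  proof (rule direct_sum_OiI[OF s d])
    fix y assume y: "y \<in> g ` F0" "y \<in> Oi"
    then obtain x where x: "x \<in> F0" "y = g x" by blast
    have "g x - (g x - x) \<in> Oi" using y(2) diff[of x] unfolding x(2) by (rule subspace_diff[OF subspace_Oi])
    then have "x = 0" using Oi_Int_F0 x(1) by simp
    then show "y = 0" using x linear_0[OF lin] by simp
  qed
  then show ?thesis using s d iso iso0 by (auto simp: Omega_Fi_iff)
qed

lemma exp3_Oi: assumes "nilrad N" "x \<in> Oi" shows "exp3 N x \<in> Oi"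
proof -
  have "(exp3 N x - x) + x \<in> Oi"
    using exp3_diff_Oi[OF assms(1), of x] assms(2) subspace_Oi by (blast intro: subspace_add)
  then show ?thesis by simp
qed

lemma exp3_image_Omega: "nilrad N \<Longrightarrow> exp3 N ` F0 \<in> Omega b q Fi"
  by (rule isometry_image_Omega)
    (auto simp: exp3_linear nilrad_linear exp3_isometry exp3_Oi exp3_diff_Oi)

text \<open>Surjectivity of the orbit map of the unipotent radical. \<open>N\<close> is computed
  from the projections onto \<open>G\<close> and \<open>F0\<close> along \<open>Oi\<close>, without
  a logarithm.\<close>

lemma Omega_exp3: assumes G: "G \<in> Omega b q Fi" shows "\<exists>N. nilrad N \<and> G = exp3 N ` F0"
proof -
  define \<gamma> where "\<gamma> = proj G"
  define \<pi> where "\<pi> = proj F0"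
  have lg: "linear \<gamma>" and lp: "linear \<pi>"
    using proj_linear G F0_Omega by (auto simp: \<gamma>_def \<pi>_def)
  have g: "\<gamma> x \<in> G" "x - \<gamma> x \<in> Oi" and p: "\<pi> x \<in> F0" "x - \<pi> x \<in> Oi" for x
    using proj_in proj_diff G F0_Omega by (auto simp: \<gamma>_def \<pi>_def)
  have gOi: "\<gamma> x = 0" and pOi: "\<pi> x = 0" if "x \<in> Oi" for x
    using proj_Oi G F0_Omega that by (auto simp: \<gamma>_def \<pi>_def)
  have isoG: "b (\<gamma> x) (\<gamma> x) = 0" for x using G g(1) by (auto simp: Omega_Fi_iff)
  have "linear (\<lambda>x. b (\<gamma> x) l / b l l)"
    by (rule linearI) (simp_all add: linear_add[OF lg] linear_scale[OF lg] b_simps add_divide_distrib)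
  then obtain v where v: "v \<in> Fi" "\<And>p. p \<in> F0 \<Longrightarrow> b v p = b (\<gamma> p) l / b l l"
    using riesz by metis
  \<comment> \<open>On \<open>F0\<close> write \<open>\<gamma> p = p + c l + m\<close>. Skewness of
    the wanted \<open>N\<close> forces \<open>N l = - (b l l) v\<close>, and then
    \<open>p + N p + N (N p) / 2 = \<gamma> p\<close> forces
    \<open>N p = c l + m + (c * b l l / 2) v\<close>. The coefficient
    \<open>b (\<gamma> x) l / 2\<close> is this correction, and \<open>- b x l\<close> produces the
    value at \<open>l\<close>.\<close>
  define N where "N x = \<gamma> x - \<pi> x + (b (\<gamma> x) l / 2 - b x l) *\<^sub>R v" for x
  have linN: "linear N"
    by (rule linearI) (simp_all add: N_def linear_add[OF lg] linear_scale[OF lg]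
        linear_add[OF lp] linear_scale[OF lp] b_simps algebra_simps add_divide_distrib)
  have dOi: "\<gamma> x - \<pi> x \<in> Oi" for x
  proof -
    have "(x - \<pi> x) - (x - \<gamma> x) \<in> Oi" using g p subspace_Oi by (blast intro: subspace_diff)
    then show ?thesis by simp
  qed
  \<comment> \<open>The last equation expresses the isotropy of \<open>\<gamma> x\<close>; it is
    what makes \<open>b (N x) x\<close> vanish, and polarisation then gives skewness.\<close>
  have struct: "\<exists>c m. m \<in> Fi \<and> \<gamma> x = \<pi> x + c *\<^sub>R l + m \<and> b (\<gamma> x) l = c * b l l \<and> b v x = c \<and>
      2 * b m (\<pi> x) + c * c * b l l = 0" for x
  proof -
    obtain c m where cm: "m \<in> Fi" "\<gamma> x - \<pi> x = c *\<^sub>R l + m" using Oi_decomp[OF dOi] by blast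
    then have gx: "\<gamma> x = \<pi> x + c *\<^sub>R l + m" by (simp add: algebra_simps)
    have gl: "b (\<gamma> x) l = c * b l l" unfolding gx using l0 li p(1) cm(1) by (simp add: b_simps)
    have "\<gamma> (x - \<pi> x) = 0" using gOi p(2) by blast
    then have "\<gamma> (\<pi> x) = \<gamma> x" by (simp add: linear_diff[OF lg])
    then have "b v (\<pi> x) = c" using v(2)[OF p(1), of x] gl ll by simp
    moreover have "b v (x - \<pi> x) = 0" using Oi_b_Fi(2)[OF p(2) v(1)] .
    ultimately have bv: "b v x = c" by (simp add: b_simps)
    have "2 * b m (\<pi> x) + c * c * b l l = 0"
      using isoG[of x] sym[of "\<pi> x" m] l0 l0' li li' iso0 isoi p(1)[of x] cm(1)
      unfolding gx by (simp add: b_simps algebra_simps)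
    then show ?thesis using cm(1) gx gl bv by blast
  qed
  have self: "b (N x) x = 0" for x
  proof -
    obtain c m where cm: "m \<in> Fi" "\<gamma> x = \<pi> x + c *\<^sub>R l + m" "b (\<gamma> x) l = c * b l l" "b v x = c"
      "2 * b m (\<pi> x) + c * c * b l l = 0" using struct[of x] by blast
    obtain a f where af: "f \<in> Fi" "x - \<pi> x = a *\<^sub>R l + f" using Oi_decomp[OF p(2)] by blast
    then have x: "x = \<pi> x + a *\<^sub>R l + f" by (simp add: algebra_simps)
    have xl: "b x l = a * b l l" by (subst x) (use l0 li p(1) af(1) in \<open>simp add: b_simps\<close>)
    have lx: "b l x = a * b l l" using xl sym by simp
    have mx: "b m x = b m (\<pi> x)"
      by (subst x) (use isoi li cm(1) af(1) in \<open>simp add: b_simps\<close>)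
    have "b (N x) x = c * b l x + b m x + (b (\<gamma> x) l / 2 - b x l) * b v x"
      using cm(2) by (simp add: N_def b_simps)
    also have "\<dots> = c * (a * b l l) + b m (\<pi> x) + (c * b l l / 2 - a * b l l) * c"
      by (simp only: lx mx xl cm(3,4))
    also have "\<dots> = (2 * b m (\<pi> x) + c * c * b l l) / 2" by (simp add: field_simps)
    finally show ?thesis using cm(5) by simp
  qed
  have skew: "b (N x) y = - b x (N y)" for x y
    using self[of "x + y"] self[of x] self[of y] sym[of x "N y"]
    by (simp add: linear_add[OF linN] b_simps)
  have NOi: "N x \<in> Oi" for x
    unfolding N_def using dOi v(1) Fi_Oi subspace_Oi by (blast intro: subspace_add subspace_scale)
  have NFi: "N x = (- b x l) *\<^sub>R v" if "x \<in> Oi" for x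
    using gOi[OF that] pOi[OF that] by (simp add: N_def b_simps)
  have nilrad: "nilrad N"
    unfolding nilrad_def using linN skew NOi NFi v(1) subi li Fi_Oi
    by (auto simp: subspace_scale subspace_neg)
  have ex: "exp3 N x = \<gamma> x" if x: "x \<in> F0" for x
  proof -
    have px: "\<pi> x = x"
      using proj_eqI[OF F0_Omega x, of x] subspace_0[OF subspace_Oi] by (simp add: \<pi>_def)
    obtain c m where cm: "m \<in> Fi" "\<gamma> x = \<pi> x + c *\<^sub>R l + m" "b (\<gamma> x) l = c * b l l" "b v x = c"
      "2 * b m (\<pi> x) + c * c * b l l = 0" using struct[of x] by blast
    have Nx: "N x = c *\<^sub>R l + (m + (c * b l l / 2) *\<^sub>R v)"
      using cm(2,3) l0[OF x] by (simp add: N_def)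
    have "N (m + (c * b l l / 2) *\<^sub>R v) = 0"
      using nilrad_0[OF nilrad] cm(1) v(1) subi by (simp add: subspace_add subspace_scale)
    then have "N (N x) = (- c * b l l) *\<^sub>R v"
      unfolding Nx using NFi[OF l_Oi]
      by (simp add: linear_add[OF linN] linear_scale[OF linN])
    then show ?thesis unfolding exp3_def Nx cm(2) px by (simp add: algebra_simps)
  qed
  have "G = \<gamma> ` F0"
  proof
    show "\<gamma> ` F0 \<subseteq> G" using g(1) by blast
    show "G \<subseteq> \<gamma> ` F0"
    proof
      fix y assume y: "y \<in> G"
      have "\<pi> y - y \<in> Oi" using p(2)[of y] subspace_neg[OF subspace_Oi] by force
      then have "\<gamma> (\<pi> y) = y" unfolding \<gamma>_def using y G by (intro proj_eqI) auto
      then show "y \<in> \<gamma> ` F0" using p(1) by (metis imageI)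
    qed
  qed
  also have "\<gamma> ` F0 = exp3 N ` F0" using ex by auto
  finally show ?thesis using nilrad by blast
qed

lemma nilrad_exp3_inj_F0:
  assumes N: "nilrad N"
  shows "exp3 N ` F0 \<in> Omega b q F0 \<longleftrightarrow> (\<forall>p\<in>F0. N p = 0 \<longrightarrow> p = 0)"
proof -
  interpret sw: split_form b q Fi F0 l by (rule swap)
  define G where "G = exp3 N ` F0"
  have G: "subspace G" "dim G = q" "\<forall>x\<in>G. \<forall>y\<in>G. b x y = 0"
    using exp3_image_Omega[OF N] by (auto simp: Omega_Fi_iff G_def)
  have O0: "x \<in> sw.Oi \<longleftrightarrow> (\<forall>y\<in>F0. b x y = 0)" for x by (rule sw.Oi_iff)
  \<comment> \<open>Orthogonality of \<open>exp3 N p\<close> to \<open>p\<close> gives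
    \<open>b (N p) (N p) = 0\<close>. As \<open>l\<close> is anisotropic, \<open>N p\<close> has no
    component along \<open>l\<close>, so it lies in \<open>Fi\<close> and the quadratic term
    vanishes; orthogonality to all of \<open>F0\<close> then kills \<open>N p\<close>.\<close>
  have key: "N p = 0" if p: "p \<in> F0" "exp3 N p \<in> sw.Oi" for p
  proof -
    have "b (exp3 N p) p = 0" using p O0 by blast
    then have "b (N (N p)) p = 0" using nilrad_self[OF N, of p] iso0 p(1) by (simp add: exp3_def b_simps)
    then have 0: "b (N p) (N p) = 0" using nilrad_skew[OF N, of "N p" p] by simp
    obtain a f where af: "f \<in> Fi" "N p = a *\<^sub>R l + f" using Oi_decomp nilrad_Oi[OF N] by blast
    then have "a = 0" using 0 ll li li' isoi by (simp add: b_simps)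
    then have Np: "N p \<in> Fi" using af by simp
    then have "exp3 N p = p + N p" using nilrad_0[OF N] by (simp add: exp3_def)
    then have "b (N p) y = 0" if "y \<in> F0" for y
      using p that O0 iso0 by (auto simp: b_simps)
    then show ?thesis using perfi Np by blast
  qed
  have "G \<in> Omega b q F0 \<longleftrightarrow> (\<forall>x\<in>G. x \<in> sw.Oi \<longrightarrow> x = 0)"
  proof
    assume "G \<in> Omega b q F0"
    then show "\<forall>x\<in>G. x \<in> sw.Oi \<longrightarrow> x = 0"
      unfolding sw.Omega_Fi_iff direct_sum_eq_UNIV_def by blast
  next
    assume "\<forall>x\<in>G. x \<in> sw.Oi \<longrightarrow> x = 0"
    then show "G \<in> Omega b q F0"
      using G sw.direct_sum_OiI[OF G(1,2)] by (simp add: sw.Omega_Fi_iff)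
  qed
  also have "\<dots> \<longleftrightarrow> (\<forall>p\<in>F0. N p = 0 \<longrightarrow> p = 0)"
  proof (intro iffI ballI impI)
    fix p assume *: "\<forall>x\<in>G. x \<in> sw.Oi \<longrightarrow> x = 0" and p: "p \<in> F0" "N p = 0"
    have "exp3 N p = p" using p linear_0[OF nilrad_linear[OF N]] by (simp add: exp3_def)
    then have "p \<in> G" using p(1) unfolding G_def by (metis imageI)
    then show "p = 0" using * p(1) O0 iso0 by blast
  next
    fix x assume *: "\<forall>p\<in>F0. N p = 0 \<longrightarrow> p = 0" and x: "x \<in> G" "x \<in> sw.Oi"
    obtain p where p: "p \<in> F0" "x = exp3 N p" using x(1) by (auto simp: G_def)
    then have "p = 0" using * key x(2) by blast
    then show "x = 0" using p(2) linear_0[OF exp3_linear[OF nilrad_linear[OF N]]] by simp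
  qed
  finally show ?thesis by (simp add: G_def)
qed

text \<open>Symplectic Gram-Schmidt. For \<open>b (N p) p' = 1\<close>, subtracting the wedge of
  \<open>N p\<close> and \<open>N p'\<close> kills \<open>p\<close> and \<open>p'\<close> and keeps
  the old kernel, so the rank drops by at least two. The last clause bounds the length of
  \<open>z\<close> by the rank of \<open>N\<close>.\<close>

lemma skew_wedge_sum:
  assumes "linear N" "\<And>x y. b (N x) y = - b x (N y)" "\<And>x. N x \<in> Fi"
  shows "\<exists>z. set z \<subseteq> Fi \<and> even (length z) \<and> (\<forall>p. N p = wedge_sum b l z p) \<and>
    length z + dim {x. N x = 0} \<le> 2 * q + 1"
  using assms
proof (induction "2 * q + 1 - dim {x. N x = 0}" arbitrary: N rule: less_induct)
  case less
  note lin = less.prems(1) and skew = less.prems(2) and range = less.prems(3)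
  have self: "b (N x) x = 0" for x using skew[of x x] sym[of x "N x"] by simp
  show ?case
  proof (cases "\<forall>p. N p = 0")
    case True
    then show ?thesis
      using dim_subset_UNIV[of "{x. N x = 0}"] card by (intro exI[of _ "[]"]) simp
  next
    case False
    then obtain p r where "b (N p) r \<noteq> 0" using nondeg by blast
    define p' where "p' = (1 / b (N p) r) *\<^sub>R r"
    have pp': "b (N p) p' = 1" using \<open>b (N p) r \<noteq> 0\<close> by (simp add: p'_def b_simps)
    have p'p: "b (N p') p = -1" using skew[of p' p] pp' sym[of p' "N p"] by simp
    define M where "M w = N w - wedge b (N p) (N p') w" for w
    have linM: "linear M"
      unfolding M_def using lin linear_wedge by (rule linear_compose_sub)
    have skM: "b (M x) y = - b x (M y)" for x y
      using skew[of x y] wedge_skew[of "N p" "N p'" x y] by (simp add: M_def b_simps)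
    have rM: "M x \<in> Fi" for x
      unfolding M_def wedge_def using range subi by (blast intro: subspace_diff subspace_scale)
    have Mp: "M p = 0" "M p' = 0"
      using self pp' p'p by (simp_all add: M_def wedge_def)
    have kM: "M w = 0" if "N w = 0" for w
      using that skew[of p w] skew[of p' w] by (simp add: M_def wedge_def b_simps)
    have sk: "subspace {x. N x = 0}" "subspace {x. M x = 0}"
      using lin linM by (auto intro: linear_subspace_kernel)
    have sp: "span {x. N x = 0} = {x. N x = 0}" using sk(1) by (simp add: span_eq_iff)
    have 1: "p' \<notin> span {x. N x = 0}" unfolding sp using p'p by (auto simp: b_simps)
    have 2: "p \<notin> span (insert p' {x. N x = 0})"
    proof
      assume "p \<in> span (insert p' {x. N x = 0})"
      then obtain k where "p - k *\<^sub>R p' \<in> span {x. N x = 0}" by (auto simp: span_insert)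
      then have "N p = k *\<^sub>R N p'" unfolding sp by (simp add: linear_diff[OF lin] linear_scale[OF lin])
      then show False using pp' self[of p'] by (simp add: b_simps)
    qed
    have "dim {x. N x = 0} + 2 = dim (insert p (insert p' {x. N x = 0}))"
      using 1 2 by (simp add: dim_insert)
    also have "\<dots> \<le> dim {x. M x = 0}" by (rule dim_subset) (use Mp kM in auto)
    finally have d: "dim {x. N x = 0} + 2 \<le> dim {x. M x = 0}" .
    moreover have "dim {x. M x = 0} \<le> 2 * q + 1"
      using dim_subset_UNIV[of "{x. M x = 0}"] card by simp
    ultimately have "2 * q + 1 - dim {x. M x = 0} < 2 * q + 1 - dim {x. N x = 0}" by simp
    from less.hyps[OF this linM skM rM]
    obtain z where z: "set z \<subseteq> Fi" "even (length z)" "\<And>w. M w = wedge_sum b l z w"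
      "length z + dim {x. M x = 0} \<le> 2 * q + 1"
      by blast
    show ?thesis
    proof (intro exI conjI allI)
      show "N w = wedge_sum b l (N p # N p' # z) w" for w
        using z(3)[of w] by (simp add: M_def algebra_simps)
    qed (use z d range in auto)
  qed
qed

lemma wedge_sum_eq_zero:
  "(\<And>x. x \<in> set z \<Longrightarrow> b x p = 0) \<Longrightarrow> b l p = 0 \<Longrightarrow> wedge_sum b l z p = 0"
  by (induction z rule: induct_list012) (auto simp: wedge_def)

text \<open>After removal of the \<open>l\<close>-part, the kernel contains \<open>Oi\<close>, so
  \<open>z\<close> has at most \<open>q\<close> entries; injectivity makes \<open>v\<close> and
  \<open>z\<close> span \<open>Fi\<close>, so there are at least \<open>q - 1\<close>. Since the
  number is even, it is \<open>q\<close> or \<open>q - 1\<close> according to the parity of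
  \<open>q\<close>, and in the odd case \<open>v\<close> completes the basis.\<close>

lemma nilrad_normal_form:
  assumes N: "nilrad N" and inj: "\<And>p. p \<in> F0 \<Longrightarrow> N p = 0 \<Longrightarrow> p = 0"
  shows "\<exists>z v. span (set z) = Fi \<and> length z = q \<and> v \<in> Fi \<and> (odd q \<longrightarrow> v = 0) \<and>
    N = (\<lambda>p. wedge_sum b l z p + wedge b v l p)"
proof -
  \<comment> \<open>This multiple is chosen so that \<open>wedge b v l\<close> agrees with
    \<open>N\<close> at \<open>l\<close>, whence the difference \<open>M\<close> kills
    \<open>Oi\<close> and, by skewness, has values in \<open>Fi\<close>.\<close>
  define v where "v = (- 1 / b l l) *\<^sub>R N l"
  have v: "v \<in> Fi" using nilrad_Fi[OF N l_Oi] subi by (simp add: v_def subspace_scale subspace_neg)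
  define M where "M p = N p - wedge b v l p" for p
  have "nilrad (\<lambda>p. N p + - wedge b v l p)"
    using N nilrad_wedge[OF v l_Oi] nilrad_uminus nilrad_add by blast
  then have M: "nilrad M" by (simp add: M_def[abs_def])
  have Ml: "M l = 0" using li[OF v] ll by (simp add: M_def wedge_def v_def)
  have MOi: "M x = 0" if "x \<in> Oi" for x
  proof -
    obtain a f where "f \<in> Fi" "x = a *\<^sub>R l + f" using Oi_decomp[OF \<open>x \<in> Oi\<close>] by blast
    then show ?thesis using Ml nilrad_0[OF M] nilrad_linear[OF M] by (simp add: linear_add linear_scale)
  qed
  have rM: "M x \<in> Fi" for x
    using nilrad_Oi[OF M] nilrad_skew[OF M, of x l] Ml by (intro Oi_l_Fi) (simp_all add: b_simps)
  obtain z where z: "set z \<subseteq> Fi" "even (length z)" "\<And>p. M p = wedge_sum b l z p"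
    "length z + dim {x. M x = 0} \<le> 2 * q + 1"
    using skew_wedge_sum[OF nilrad_linear[OF M] nilrad_skew[OF M] rM] by blast
  have NM: "N p = wedge_sum b l z p + wedge b v l p" for p using z(3)[of p] unfolding M_def diff_eq_eq .
  have len: "length z \<le> q"
  proof -
    have "dim Oi \<le> dim {x. M x = 0}" using MOi by (intro dim_subset) auto
    then show ?thesis using z(4) dim_Oi by simp
  qed
  have sp: "span (insert v (set z)) = Fi"
  proof (rule span_eq_Fi)
    show "insert v (set z) \<subseteq> Fi" using v z(1) by simp
    fix p assume p: "p \<in> F0" "\<And>x. x \<in> insert v (set z) \<Longrightarrow> b x p = 0"
    then have "wedge_sum b l z p = 0" "wedge b v l p = 0"
      using l0' by (auto intro!: wedge_sum_eq_zero simp: wedge_def)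
    then show "p = 0" using inj[OF p(1)] NM by simp
  qed
  have "q = dim (insert v (set z))" using sp dimi by (metis dim_span)
  also have "\<dots> \<le> card (insert v (set z))" by (rule dim_le_card') simp
  also have "\<dots> \<le> Suc (length z)"
    using card_length[of z] card_insert_le_m1[of "Suc (length z)" "set z" v] by simp
  finally have len': "q \<le> Suc (length z)" .
  show ?thesis
  proof (cases "even q")
    case True
    then have lz: "length z = q" using z(2) len len' by presburger
    have "span (set z) = Fi"
    proof (rule span_eq_Fi[OF z(1)])
      fix p assume p: "p \<in> F0" "\<And>x. x \<in> set z \<Longrightarrow> b x p = 0"
      \<comment> \<open>A nonzero \<open>p\<close> of this kind would be a further kernel vector of
        \<open>M\<close> outside \<open>Oi\<close>, so the kernel would have dimension at least
        \<open>q + 2\<close>, against the bound for \<open>length z = q\<close>.\<close>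
      show "p = 0"
      proof (rule ccontr)
        assume "p \<noteq> 0"
        then have "p \<notin> span Oi" using Oi_Int_F0 p(1) subspace_Oi by (auto simp: span_eq_iff[THEN iffD2])
        then have "q + 2 = dim (insert p Oi)" using dim_Oi by (simp add: dim_insert)
        also have "\<dots> \<le> dim {x. M x = 0}"
        proof (rule dim_subset)
          have "M p = 0" using z(3) wedge_sum_eq_zero[of z p] p l0' by simp
          then show "insert p Oi \<subseteq> {x. M x = 0}" using MOi by auto
        qed
        finally show False using z(4) lz by simp
      qed
    qed
    then show ?thesis using lz v NM True by blast
  next
    case False
    then have lz: "length (z @ [v]) = q" using z(2) len len' by (simp, presburger)
    have "N = (\<lambda>p. wedge_sum b l (z @ [v]) p + wedge b 0 l p)"
      using NM wedge_sum_append[OF z(2), of "[v]"] by (auto simp: wedge_def b_simps)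
    moreover have "span (set (z @ [v])) = Fi" using sp by simp
    ultimately show ?thesis using lz subspace_0[OF subi] by blast
  qed
qed

lemma wedge_sum_even_l:
  "even (length z) \<Longrightarrow> set z \<subseteq> Fi \<Longrightarrow> b (wedge_sum b l z p) l = 0"
proof (induction z rule: induct_list012)
  case (3 x y zs)
  then show ?case using li by (simp add: wedge_def b_simps)
qed (simp_all add: b_simps)

lemma normal_form_inj:
  assumes z: "span (set z) = Fi" "length z = q" and v: "v \<in> Fi" "odd q \<Longrightarrow> v = 0"
    and p: "p \<in> F0" "wedge_sum b l z p + wedge b v l p = 0"
  shows "p = 0"
proof -
  have zF: "set z \<subseteq> Fi" using z(1) span_superset by blast
  have w: "wedge b v l p = b v p *\<^sub>R l" using l0'[OF p(1)] by (simp add: wedge_def)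
  have "b v p = 0"
  proof (cases "even q")
    case True
    \<comment> \<open>Pairing with \<open>l\<close> isolates \<open>b v p\<close>: for an even
      number of entries the wedge sum is orthogonal to \<open>l\<close>.\<close>
    have "b (wedge_sum b l z p + wedge b v l p) l = b v p * b l l"
      using wedge_sum_even_l[of z p] True z(2) zF by (simp add: w b_simps)
    then show ?thesis using p(2) ll by (simp add: b_simps)
  next
    case False
    then show ?thesis using v(2) by (simp add: b_simps)
  qed
  then have 0: "wedge_sum b l z p = 0" using p(2) w by simp
  obtain ps where ps: "dual_lists b z ps" "set ps \<subseteq> F0" using dual_list_exists[OF z] by blast
  have "b x p = 0" if "x \<in> set z" for x using wedge_sum_zero[OF ps 0 p(1) that] .
  then have "b f p = 0" if "f \<in> Fi" for f using b_span_zero[of f "set z" p] z(1) that by blast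
  then show ?thesis using perf0 p(1) by blast
qed

lemma normal_form_Omega:
  assumes z: "span (set z) = Fi" "length z = q" and v: "v \<in> Fi" "odd q \<Longrightarrow> v = 0"
  shows "nilrad (\<lambda>p. wedge_sum b l z p + wedge b v l p)" (is "nilrad ?N")
    and "exp3 (\<lambda>p. wedge_sum b l z p + wedge b v l p) ` F0 \<in> Omega b q F0 \<inter> Omega b q Fi"
proof -
  have "set z \<subseteq> Fi" using z(1) span_superset by blast
  then show nilrad: "nilrad ?N" by (intro nilrad_add nilrad_wedge_sum nilrad_wedge v l_Oi)
  show "exp3 ?N ` F0 \<in> Omega b q F0 \<inter> Omega b q Fi"
    using exp3_image_Omega[OF nilrad] nilrad_exp3_inj_F0[OF nilrad] normal_form_inj[OF z v] by blast
qed

end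

section \<open>The unipotent radical\<close>

lemma matrix_inv_eqI: 
  fixes A B :: "real^'n^'n::finite"
  assumes "A ** B = mat 1" "B ** A = mat 1" shows "matrix_inv A = B"
proof -
  have "A ** matrix_inv A = mat 1 \<and> matrix_inv A ** A = mat 1"
    unfolding matrix_inv_def by (rule someI[of _ B]) (use assms in simp)
  then show ?thesis by (metis assms(2) matrix_mul_assoc matrix_mul_lid matrix_mul_rid)
qed

lemma real_matrix_works:
  fixes f :: "real^'n::finite \<Rightarrow> real^'m::finite"
  assumes "linear f" shows "matrix f *v x = f x"
  by (rule matrix_works) (use assms in \<open>simp add: linear_matrix_vector_mul_eq\<close>)

lemma act_mult: "act (A ** B) F = act A (act B F)"
  by (simp add: act_def image_image matrix_vector_mul_assoc)

lemma act_one: "act (mat 1) F = F"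
  by (simp add: act_def)

lemma act_inverse: "A ** B = mat 1 \<Longrightarrow> act A (act B F) = F"
  by (metis act_mult act_one)

lemma continuous_on_matrix_mult_left:
  "continuous_on S (\<lambda>X. (A::real^'n^'n::finite) ** X)"
  unfolding matrix_matrix_mult_def by (intro continuous_intros)

lemma continuous_on_matrix_of:
  fixes f :: "'t::topological_space \<Rightarrow> real^'n::finite \<Rightarrow> real^'m::finite"
  assumes "\<And>x. continuous_on S (\<lambda>t. f t x)"
  shows "continuous_on S (\<lambda>t. matrix (f t))"
  unfolding matrix_def by (intro continuous_on_vec_lambda continuous_on_component assms)

lemma funpow_scaled:
  fixes f :: "'v::real_vector \<Rightarrow> 'v"
  assumes "linear f" shows "((\<lambda>x. c *\<^sub>R f x) ^^ m) x = (c ^ m) *\<^sub>R (f ^^ m) x"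
  by (induction m) (simp_all add: linear_scale[OF assms])

lemma linear_funpow: "linear f \<Longrightarrow> linear (f ^^ m)"
  for f :: "'v::real_vector \<Rightarrow> 'v"
  by (induction m) (simp_all add: linear_id linear_compose flip: id_def)

text \<open>An exponent that is the same for all nilpotent maps makes nilpotency a closed condition,
  which allows a limit in \<open>normal_unipotent_trivial_on_Fi\<close>.\<close>

lemma nilpotent_power_dim:
  fixes f :: "'v::euclidean_space \<Rightarrow> 'v"
  assumes lin: "linear f" and k: "\<And>x. (f ^^ k) x = 0"
  shows "(f ^^ DIM('v)) x = 0"
proof -
  define K where "K i = {x. (f ^^ i) x = 0}" for i
  have sK: "subspace (K i)" for i
    unfolding K_def by (rule linear_subspace_kernel[OF linear_funpow[OF lin]])
  have mono: "K i \<subseteq> K (Suc i)" for i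
    unfolding K_def using linear_0[OF lin] by auto
  \<comment> \<open>As long as the kernels grow, each step adds at least one dimension. Once two
    consecutive kernels agree the chain is constant, hence already the whole space.\<close>
  have "i \<le> dim (K i) \<or> K i = UNIV" for i
  proof (induction i)
    case (Suc i)
    show ?case
    proof (cases "K i = UNIV")
      case True
      then show ?thesis using mono[of i] by auto
    next
      case False
      have "K i \<noteq> K (Suc i)"
      proof
        assume eq: "K i = K (Suc i)"
        have "K i = K (i + j)" for j
        proof (induction j)
          case (Suc j)
          have "K (i + Suc j) = {x. f x \<in> K (i + j)}"
            unfolding K_def by (auto simp: funpow_Suc_right simp del: funpow.simps)
          also have "\<dots> = {x. f x \<in> K i}" using Suc by simp
          also have "\<dots> = K (Suc i)"
            unfolding K_def by (auto simp: funpow_Suc_right simp del: funpow.simps)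
          finally show ?case using eq by simp
        qed simp
        then have "K i = K (i + k)" .
        moreover have "K (i + k) = UNIV"
          unfolding K_def using k linear_0[OF linear_funpow[OF lin]] by (auto simp: funpow_add)
        ultimately show False using False by simp
      qed
      then have "dim (K i) < dim (K (Suc i))"
        using mono[of i] sK by (intro dim_psubset) (auto simp: span_eq_iff[THEN iffD2])
      then show ?thesis using Suc False by auto
    qed
  qed simp
  from this[of "DIM('v)"] have "K (DIM('v)) = UNIV"
  proof
    assume "DIM('v) \<le> dim (K (DIM('v)))"
    then show ?thesis
      using dim_eq_full[of "K (DIM('v))"] dim_subset_UNIV[of "K (DIM('v))"] sK
      by (metis le_antisym span_eq_iff)
  qed
  then show ?thesis unfolding K_def by blast
qed

section \<open>The identity component and stabilizers as groups\<close>

lemma SO0_subset: "SO0 b \<subseteq> isometry_group b"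
  unfolding SO0_def by (rule connected_component_subset)

lemma isometry_group_one: "mat 1 \<in> isometry_group b"
  by (auto simp: isometry_group_def invertible_def intro!: exI[of _ "mat 1"])

lemma SO0_one: "mat 1 \<in> SO0 b"
  unfolding SO0_def using isometry_group_one by simp

lemma isometry_group_mult:
  "A \<in> isometry_group b \<Longrightarrow> B \<in> isometry_group b \<Longrightarrow> A ** B \<in> isometry_group b"
  by (auto simp: isometry_group_def invertible_mult simp flip: matrix_vector_mul_assoc)

lemma isometry_group_inverse:
  assumes "A \<in> isometry_group b"
  shows "\<exists>B\<in>isometry_group b. A ** B = mat 1 \<and> B ** A = mat 1"
proof -
  obtain B where B: "A ** B = mat 1" "B ** A = mat 1"
    using assms by (auto simp: isometry_group_def invertible_def)
  have "b (B *v x) (B *v y) = b x y" for x y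
  proof -
    have "b (A *v (B *v x)) (A *v (B *v y)) = b (B *v x) (B *v y)"
      using assms by (simp add: isometry_group_def)
    then show ?thesis by (simp add: matrix_vector_mul_assoc B)
  qed
  then have "B \<in> isometry_group b" using B by (auto simp: isometry_group_def invertible_def)
  then show ?thesis using B by blast
qed

lemma connected_SO0_subset:
  assumes "connected T" "T \<subseteq> isometry_group b" "A \<in> T" "A \<in> SO0 b" shows "T \<subseteq> SO0 b"
proof -
  have "connected_component_set (isometry_group b) A = SO0 b"
    using assms(4) connected_component_eq[of A "isometry_group b" "mat 1"] by (simp add: SO0_def)
  then show ?thesis using connected_component_maximal[OF assms(3,1,2)] by simp
qed

text \<open>The left translate of \<open>SO0 b\<close> by \<open>A\<close> is connected and contains
  \<open>A\<close>, so it does not leave the component.\<close>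

lemma SO0_mult:
  assumes "A \<in> SO0 b" "B \<in> SO0 b" shows "A ** B \<in> SO0 b"
proof -
  have "(\<lambda>X. A ** X) ` SO0 b \<subseteq> SO0 b"
  proof (rule connected_SO0_subset)
    show "connected ((\<lambda>X. A ** X) ` SO0 b)"
      unfolding SO0_def
      by (intro connected_continuous_image continuous_on_matrix_mult_left connected_connected_component)
    show "(\<lambda>X. A ** X) ` SO0 b \<subseteq> isometry_group b"
      using SO0_subset assms(1) isometry_group_mult by blast
    show "A \<in> (\<lambda>X. A ** X) ` SO0 b" using SO0_one[of b] by (metis imageI matrix_mul_rid)
  qed fact
  then show ?thesis using assms(2) by blast
qed

lemma SO0_inverse:
  assumes "A \<in> SO0 b" shows "\<exists>B\<in>SO0 b. A ** B = mat 1 \<and> B ** A = mat 1"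
proof -
  obtain B where B: "B \<in> isometry_group b" "A ** B = mat 1" "B ** A = mat 1"
    using isometry_group_inverse assms SO0_subset by blast
  have "(\<lambda>X. B ** X) ` SO0 b \<subseteq> SO0 b"
  proof (rule connected_SO0_subset)
    show "connected ((\<lambda>X. B ** X) ` SO0 b)"
      unfolding SO0_def
      by (intro connected_continuous_image continuous_on_matrix_mult_left connected_connected_component)
    show "(\<lambda>X. B ** X) ` SO0 b \<subseteq> isometry_group b"
      using SO0_subset B(1) isometry_group_mult by blast
    show "mat 1 \<in> (\<lambda>X. B ** X) ` SO0 b" using assms B(3) by (metis imageI)
  qed (rule SO0_one)
  moreover have "B \<in> (\<lambda>X. B ** X) ` SO0 b" using SO0_one[of b] by (metis imageI matrix_mul_rid)
  ultimately show ?thesis using B by blast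
qed

lemma stabilizer_inverse:
  assumes "A \<in> stabilizer b F"
  shows "\<exists>B\<in>stabilizer b F. A ** B = mat 1 \<and> B ** A = mat 1"
proof -
  obtain B where B: "B \<in> SO0 b" "A ** B = mat 1" "B ** A = mat 1"
    using SO0_inverse[of A b] assms unfolding stabilizer_def by blast
  have "act B F = F"
    using act_inverse[OF B(3), of F] assms by (simp add: stabilizer_def)
  then show ?thesis using B by (auto simp: stabilizer_def)
qed

lemma stabilizer_mult:
  "A \<in> stabilizer b F \<Longrightarrow> B \<in> stabilizer b F \<Longrightarrow> A ** B \<in> stabilizer b F"
  by (auto simp: stabilizer_def act_mult SO0_mult)

lemma stabilizer_one: "mat 1 \<in> stabilizer b F"
  by (simp add: stabilizer_def SO0_one act_one)

lemma group_stabilizer: "group (matrix_group (stabilizer b F))"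
proof (rule groupI)
  fix x assume "x \<in> carrier (matrix_group (stabilizer b F))"
  then show "\<exists>y\<in>carrier (matrix_group (stabilizer b F)).
      y \<otimes>\<^bsub>matrix_group (stabilizer b F)\<^esub> x = \<one>\<^bsub>matrix_group (stabilizer b F)\<^esub>"
    using stabilizer_inverse[of x b F] by (auto simp: matrix_group_def)
qed (auto simp: matrix_group_def stabilizer_mult stabilizer_one matrix_mul_assoc)

lemma stabilizer_inv:
  assumes "A \<in> stabilizer b F"
  defines "B \<equiv> inv\<^bsub>matrix_group (stabilizer b F)\<^esub> A"
  shows "B \<in> stabilizer b F" "A ** B = mat 1" "B ** A = mat 1"
proof -
  interpret group "matrix_group (stabilizer b F)" by (rule group_stabilizer)
  have A: "A \<in> carrier (matrix_group (stabilizer b F))" using assms by (simp add: matrix_group_def)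
  show "B \<in> stabilizer b F" "A ** B = mat 1" "B ** A = mat 1"
    using inv_closed[OF A] r_inv[OF A] l_inv[OF A] by (simp_all add: B_def matrix_group_def)
qed

context split_form begin

lemma isometry_groupI:
  assumes "linear g" "linear h" "\<And>x. g (h x) = x" "\<And>x. h (g x) = x" "\<And>x y. b (g x) (g y) = b x y"
  shows "matrix g \<in> isometry_group b" "matrix g ** matrix h = mat 1"
proof -
  show "matrix g ** matrix h = mat 1"
    using assms by (simp add: matrix_eq real_matrix_works flip: matrix_vector_mul_assoc)
  moreover have "matrix h ** matrix g = mat 1"
    using assms by (simp add: matrix_eq real_matrix_works flip: matrix_vector_mul_assoc)
  ultimately show "matrix g \<in> isometry_group b"
    using assms by (auto simp: isometry_group_def real_matrix_works invertible_def)
qed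

text \<open>The explicit candidate for the unipotent radical: isometries acting trivially on
  \<open>Fi\<close> and on \<open>Oi\<close> modulo \<open>Fi\<close>. By duality they also act
  trivially on the whole space modulo \<open>Oi\<close>, which is \<open>U_diff_Oi\<close>.\<close>

definition U :: "(real^'n^'n) set" where
  "U = {A \<in> isometry_group b. (\<forall>x\<in>Fi. A *v x = x) \<and> (\<forall>x\<in>Oi. A *v x - x \<in> Fi)}"

lemma exp3_matrix:
  assumes "nilrad N"
  shows "matrix (exp3 N) *v x = exp3 N x" "matrix (exp3 N) \<in> U"
    and "matrix (exp3 N) ** matrix (exp3 (\<lambda>x. - N x)) = mat 1"
    and "matrix (exp3 (\<lambda>x. - N x)) ** matrix (exp3 N) = mat 1"
    and "act (matrix (exp3 N)) F = exp3 N ` F"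
proof -
  note lin = exp3_linear[OF nilrad_linear[OF assms]]
  note lin' = exp3_linear[OF nilrad_linear[OF nilrad_uminus[OF assms]]]
  show *: "matrix (exp3 N) *v x = exp3 N x" for x by (simp add: real_matrix_works[OF lin])
  show "act (matrix (exp3 N)) F = exp3 N ` F" by (simp add: act_def *)
  show "matrix (exp3 N) ** matrix (exp3 (\<lambda>x. - N x)) = mat 1"
    by (rule isometry_groupI(2)[OF lin lin'])
      (simp_all add: exp3_inverse exp3_inverse' exp3_isometry assms)
  show "matrix (exp3 (\<lambda>x. - N x)) ** matrix (exp3 N) = mat 1"
    by (rule isometry_groupI(2)[OF lin' lin])
      (simp_all add: exp3_inverse exp3_inverse' exp3_isometry nilrad_uminus assms)
  have "matrix (exp3 N) \<in> isometry_group b"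
    by (rule isometry_groupI(1)[OF lin lin'])
      (simp_all add: exp3_inverse exp3_inverse' exp3_isometry assms)
  then show "matrix (exp3 N) \<in> U"
    using * exp3_Fi exp3_diff_Fi assms by (simp add: U_def)
qed

lemma U_diff_Oi: assumes "A \<in> U" shows "A *v x - x \<in> Oi"
  unfolding Oi_iff
proof
  fix f assume f: "f \<in> Fi"
  have "b (A *v x) (A *v f) = b x f" using assms by (simp add: U_def isometry_group_def)
  then show "b (A *v x - x) f = 0" using f assms by (simp add: U_def b_simps)
qed

lemma U_image_Omega: assumes "A \<in> U" shows "act A F0 \<in> Omega b q Fi"
  unfolding act_def
proof (rule isometry_image_Omega)
  show "b (A *v x) (A *v y) = b x y" for x y
    using assms by (simp add: U_def isometry_group_def)
  show "A *v x - x \<in> Oi" for x by (rule U_diff_Oi[OF assms])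
  show "A *v x \<in> Oi" if "x \<in> Oi" for x
    using subspace_add[OF subspace_Oi U_diff_Oi[OF assms, of x] that] by simp
qed simp

text \<open>If \<open>A p = B p'\<close>, then \<open>p\<close> and \<open>p'\<close> are congruent
  modulo \<open>Oi\<close>, hence equal. This settles \<open>F0\<close>. At \<open>l\<close> the
  difference \<open>d\<close> lies in \<open>Fi\<close> and is orthogonal to \<open>A p\<close>,
  hence to \<open>p\<close>, because \<open>A p - p\<close> lies in \<open>Oi\<close>.\<close>

lemma U_unique:
  assumes A: "A \<in> U" and B: "B \<in> U" and eq: "act A F0 = act B F0" shows "A = B"
proof -
  have iso: "b (A *v x) (A *v y) = b x y" "b (B *v x) (B *v y) = b x y" for x y
    using A B by (simp_all add: U_def isometry_group_def)
  have 1: "A *v p = B *v p" if p: "p \<in> F0" for p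
  proof -
    obtain p' where p': "p' \<in> F0" "A *v p = B *v p'" using eq p unfolding act_def by blast
    have "(B *v p' - p') - (A *v p - p) \<in> Oi"
      using U_diff_Oi[OF A] U_diff_Oi[OF B] subspace_Oi by (blast intro: subspace_diff)
    then have "p - p' \<in> Oi" using p'(2) by simp
    then have "p - p' = 0" using Oi_Int_F0 subspace_diff[OF sub0 p p'(1)] by blast
    then show ?thesis using p'(2) by simp
  qed
  have 2: "A *v f = B *v f" if "f \<in> Fi" for f using A B that by (simp add: U_def)
  have 3: "A *v l = B *v l"
  proof -
    define d where "d = A *v l - B *v l"
    have "(A *v l - l) - (B *v l - l) \<in> Fi"
      by (rule subspace_diff[OF subi]) (use A B l_Oi in \<open>simp_all add: U_def\<close>)
    then have d: "d \<in> Fi" by (simp add: d_def)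
    have "b d p = 0" if p: "p \<in> F0" for p
    proof -
      have "b d (A *v p) = 0"
        using iso(1)[of l p] iso(2)[of l p] 1[OF p] by (simp add: d_def b_simps)
      moreover have "b d (A *v p - p) = 0" using Oi_b_Fi(2)[OF U_diff_Oi[OF A] d] .
      ultimately show ?thesis by (simp add: b_simps)
    qed
    then have "d = 0" using perfi d by blast
    then show ?thesis by (simp add: d_def)
  qed
  have "A *v x = B *v x" for x
  proof -
    obtain p a f where x: "p \<in> F0" "f \<in> Fi" "x = p + a *\<^sub>R l + f" using decomp by blast
    show ?thesis unfolding x(3) using 1[OF x(1)] 2[OF x(2)] 3
      by (simp add: matrix_vector_right_distrib matrix_vector_mult_scaleR)
  qed
  then show ?thesis by (simp add: matrix_eq)
qed

text \<open>The subspace \<open>act A F0\<close> is also the image of \<open>F0\<close> under some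
  \<open>exp3 N\<close>, and an element of \<open>U\<close> is determined by that image.\<close>

lemma U_exp3: assumes "A \<in> U" shows "\<exists>N. nilrad N \<and> A = matrix (exp3 N)"
proof -
  obtain N where N: "nilrad N" "act A F0 = exp3 N ` F0"
    using Omega_exp3[OF U_image_Omega[OF assms]] by blast
  then have "A = matrix (exp3 N)"
    using U_unique[OF assms exp3_matrix(2)[OF N(1)]] exp3_matrix(5)[OF N(1)] by simp
  then show ?thesis using N(1) by blast
qed

lemma continuous_on_exp3_matrix:
  fixes N :: "'t::topological_space \<Rightarrow> real^'n \<Rightarrow> real^'n"
  assumes "\<And>x. continuous_on S (\<lambda>t. N t x)" "\<And>x. continuous_on S (\<lambda>t. N t (N t x))"
  shows "continuous_on S (\<lambda>t. matrix (exp3 (N t)))"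
proof (rule continuous_on_matrix_of)
  show "continuous_on S (\<lambda>t. exp3 (N t) x)" for x
    unfolding exp3_def by (intro continuous_intros assms)
qed

lemma connected_U: "connected U"
proof -
  have "connected_component U (mat 1) A" if A: "A \<in> U" for A
  proof -
    obtain N where N: "nilrad N" "A = matrix (exp3 N)" using U_exp3[OF A] by blast
    note lin = nilrad_linear[OF N(1)]
    define \<gamma> where "\<gamma> t = matrix (exp3 (\<lambda>x. t *\<^sub>R N x))" for t
    have "continuous_on {0..1} \<gamma>"
      unfolding \<gamma>_def by (intro continuous_on_exp3_matrix) (auto simp: linear_scale[OF lin] intro!: continuous_intros)
    then have "connected (\<gamma> ` {0..1})" by (intro connected_continuous_image) auto
    moreover have "\<gamma> ` {0..1} \<subseteq> U"
      using exp3_matrix(2)[OF nilrad_scale[OF N(1)]] by (auto simp: \<gamma>_def)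
    moreover have "\<gamma> 1 = A" using N(2) by (simp add: \<gamma>_def)
    moreover have "\<gamma> 0 = mat 1"
      using exp3_matrix(1)[OF nilrad_zero] by (simp add: \<gamma>_def matrix_eq exp3_def)
    moreover have "\<gamma> 0 \<in> \<gamma> ` {0..1}" "\<gamma> 1 \<in> \<gamma> ` {0..1}" by auto
    ultimately show ?thesis unfolding connected_component_def by metis
  qed
  then show ?thesis
    unfolding connected_iff_connected_component
    by (meson connected_component_sym connected_component_trans)
qed

lemma U_SO0: "U \<subseteq> SO0 b"
proof (rule connected_SO0_subset[OF connected_U])
  show "U \<subseteq> isometry_group b" by (auto simp: U_def)
  show "mat 1 \<in> U" using isometry_group_one subi by (auto simp: U_def subspace_0)
qed (rule SO0_one)

lemma U_stabilizer: "U \<subseteq> stabilizer b Fi"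
proof
  fix A assume A: "A \<in> U"
  then have "act A Fi = Fi" by (auto simp: act_def U_def image_iff)
  then show "A \<in> stabilizer b Fi" using A U_SO0 by (auto simp: stabilizer_def)
qed

lemma stabilizer_Fi:
  assumes "A \<in> stabilizer b Fi"
  shows "b (A *v x) (A *v y) = b x y" "x \<in> Fi \<Longrightarrow> A *v x \<in> Fi" "x \<in> Oi \<Longrightarrow> A *v x \<in> Oi"
proof -
  show iso: "b (A *v x) (A *v y) = b x y" for x y
    using assms SO0_subset by (auto simp: stabilizer_def isometry_group_def)
  show "x \<in> Fi \<Longrightarrow> A *v x \<in> Fi" using assms by (auto simp: stabilizer_def act_def)
  assume x: "x \<in> Oi"
  have "b (A *v x) f = 0" if "f \<in> Fi" for f
  proof -
    have "f \<in> act A Fi" using assms that by (simp add: stabilizer_def)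
    then obtain g where "g \<in> Fi" "f = A *v g" unfolding act_def by blast
    then show ?thesis using iso x by (simp add: Oi_iff)
  qed
  then show "A *v x \<in> Oi" by (simp add: Oi_iff)
qed

lemma U_mult: assumes A: "A \<in> U" and B: "B \<in> U" shows "A ** B \<in> U"
proof -
  have "A *v (B *v x) - x \<in> Fi" if "x \<in> Oi" for x
  proof -
    have "B *v x \<in> Oi" using B U_stabilizer stabilizer_Fi that by blast
    then have "(A *v (B *v x) - B *v x) + (B *v x - x) \<in> Fi"
      by (intro subspace_add[OF subi]) (use A B that in \<open>simp_all add: U_def\<close>)
    then show ?thesis by simp
  qed
  then show ?thesis using A B
    by (auto simp: U_def isometry_group_mult simp flip: matrix_vector_mul_assoc)
qed

lemma U_inverse:
  assumes A: "A \<in> U" and B: "B \<in> stabilizer b Fi" "A ** B = mat 1" "B ** A = mat 1"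
  shows "B \<in> U"
proof -
  have BA: "B *v (A *v x) = x" and AB: "A *v (B *v x) = x" for x
    by (simp_all add: matrix_vector_mul_assoc B)
  have "B *v x = x" if "x \<in> Fi" for x using BA[of x] A that by (simp add: U_def)
  moreover have "B *v x - x \<in> Fi" if "x \<in> Oi" for x
  proof -
    have "A *v (B *v x) - B *v x \<in> Fi" using stabilizer_Fi(3)[OF B(1) that] A by (simp add: U_def)
    then have "- (x - B *v x) \<in> Fi" unfolding AB by (rule subspace_neg[OF subi])
    then show ?thesis by simp
  qed
  ultimately show ?thesis using B(1) SO0_subset by (auto simp: U_def stabilizer_def)
qed

text \<open>The stabilizer preserves \<open>Fi\<close> and \<open>Oi\<close>, and \<open>U\<close>
  consists of the elements acting trivially on the successive quotients.\<close>

lemma U_conjugate: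
  assumes A: "A \<in> U" and G: "G \<in> stabilizer b Fi" and H: "H \<in> stabilizer b Fi" "G ** H = mat 1"
  shows "G ** A ** H \<in> U"
proof -
  have GH: "G *v (H *v x) = x" for x by (simp add: matrix_vector_mul_assoc H)
  have "G ** A ** H \<in> stabilizer b Fi"
    using A G H U_stabilizer stabilizer_mult by blast
  then have "G ** A ** H \<in> isometry_group b" using SO0_subset by (auto simp: stabilizer_def)
  moreover have "(G ** A ** H) *v x = x" if "x \<in> Fi" for x
    using stabilizer_Fi(2)[OF H(1) that] A GH by (simp add: U_def flip: matrix_vector_mul_assoc)
  moreover have "(G ** A ** H) *v x - x \<in> Fi" if "x \<in> Oi" for x
  proof -
    have "A *v (H *v x) - H *v x \<in> Fi" using stabilizer_Fi(3)[OF H(1) that] A by (simp add: U_def)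
    from stabilizer_Fi(2)[OF G this] show ?thesis
      by (simp add: GH matrix_vector_mult_diff_distrib flip: matrix_vector_mul_assoc)
  qed
  ultimately show ?thesis by (simp add: U_def)
qed

lemma normal_U: "U \<lhd> matrix_group (stabilizer b Fi)"
proof -
  interpret group "matrix_group (stabilizer b Fi)" by (rule group_stabilizer)
  have "subgroup U (matrix_group (stabilizer b Fi))"
  proof (rule subgroupI)
    show "U \<subseteq> carrier (matrix_group (stabilizer b Fi))"
      using U_stabilizer by (simp add: matrix_group_def)
    show "U \<noteq> {}" using exp3_matrix(2)[OF nilrad_zero] by blast
    show "inv\<^bsub>matrix_group (stabilizer b Fi)\<^esub> A \<in> U" if "A \<in> U" for A
      using U_inverse[OF that] stabilizer_inv[of A b Fi] U_stabilizer that by blast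
    show "A \<otimes>\<^bsub>matrix_group (stabilizer b Fi)\<^esub> B \<in> U" if "A \<in> U" "B \<in> U" for A B
      using U_mult that by (simp add: matrix_group_def)
  qed
  then show ?thesis
    unfolding normal_inv_iff using U_conjugate stabilizer_inv[of _ b Fi]
    by (auto simp: matrix_group_def)
qed

lemma U_unipotent: assumes "A \<in> U" shows "unipotent A"
proof -
  have "((\<lambda>y. (A - mat 1) *v y) ^^ 3) x = 0" for x
  proof -
    have e: "(A - mat 1) *v y = A *v y - y" for y by (simp add: matrix_vector_mult_diff_rdistrib)
    have "A *v x - x \<in> Oi" by (rule U_diff_Oi[OF assms])
    then have "A *v (A *v x - x) - (A *v x - x) \<in> Fi" using assms by (simp add: U_def)
    then show ?thesis unfolding e using assms by (simp add: numeral_3_eq_3 U_def)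
  qed
  then show ?thesis unfolding unipotent_def by blast
qed

lemma closedin_U: "closedin (top_of_set (stabilizer b Fi)) U"
proof -
  have cF: "closed Fi" by (rule closed_subspace[OF subi])
  have "closed {A::real^'n^'n. A *v x = x}" for x
    unfolding matrix_vector_mult_def by (intro closed_Collect_eq continuous_intros)
  then have 1: "closed (\<Inter>x\<in>Fi. {A::real^'n^'n. A *v x = x})" by auto
  have "closed {A::real^'n^'n. A *v x - x \<in> Fi}" for x
  proof -
    have "continuous_on UNIV (\<lambda>A::real^'n^'n. A *v x - x)"
      unfolding matrix_vector_mult_def by (intro continuous_intros)
    from closed_vimage[OF cF this] show ?thesis by (simp add: vimage_def)
  qed
  then have 2: "closed (\<Inter>x\<in>Oi. {A::real^'n^'n. A *v x - x \<in> Fi})" by auto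
  have U_eq: "U = stabilizer b Fi \<inter> ((\<Inter>x\<in>Fi. {A. A *v x = x}) \<inter> (\<Inter>x\<in>Oi. {A. A *v x - x \<in> Fi}))"
    using U_stabilizer SO0_subset by (auto simp: U_def stabilizer_def)
  show ?thesis by (subst U_eq) (rule closedin_closed_Int[OF closed_Int[OF 1 2]])
qed

end

section \<open>Maximality of \<open>U\<close> among normal unipotent subgroups\<close>

lemma eigenvector_power:
  fixes f :: "'v::real_vector \<Rightarrow> 'v"
  assumes "linear f" "f x = c *\<^sub>R x" shows "(f ^^ m) x = c ^ m *\<^sub>R x"
  by (induction m) (simp_all add: assms(2) linear_scale[OF assms(1)])

lemma linear_matrix_minus: "linear (\<lambda>y. (A - mat 1) *v y)" for A :: "real^'n^'n::finite"
  by simp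

lemma unipotent_power_dim:
  fixes A :: "real^'n^'n::finite"
  assumes "unipotent A" shows "((\<lambda>y. (A - mat 1) *v y) ^^ CARD('n)) x = 0"
proof -
  obtain k where "\<And>x. ((\<lambda>y. (A - mat 1) *v y) ^^ k) x = 0"
    using assms unfolding unipotent_def by blast
  from nilpotent_power_dim[OF linear_matrix_minus this] show ?thesis by simp
qed

context split_form begin

lemma unipotent_eigenvalue:
  assumes "unipotent A" "A *v x = r *\<^sub>R x" shows "A *v x = x"
proof -
  obtain k where k: "\<And>x. ((\<lambda>y. (A - mat 1) *v y) ^^ k) x = 0"
    using assms(1) unfolding unipotent_def by blast
  have "(A - mat 1) *v x = (r - 1) *\<^sub>R x"
    using assms(2) by (simp add: matrix_vector_mult_diff_rdistrib algebra_simps)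
  from eigenvector_power[OF linear_matrix_minus this, of k] k
  have "(r - 1) ^ k *\<^sub>R x = 0" by simp
  then have "r = 1 \<or> x = 0" by auto
  then show ?thesis using assms(2) by auto
qed

text \<open>The square of \<open>E = wedge b y x\<close> is zero, so \<open>1 + t E\<close> is a
  one-parameter group of isometries, joined to the identity through varying \<open>t\<close>. On
  \<open>Fi\<close> it only adds multiples of \<open>x\<close>.\<close>

lemma transvection_stabilizer:
  assumes x: "x \<in> Fi" and y: "y \<in> F0" and xy: "b y x = 0"
  defines "g \<equiv> \<lambda>t. matrix (\<lambda>w. w + t *\<^sub>R wedge b y x w)"
  shows "g t *v w = w + t *\<^sub>R wedge b y x w" "g t \<in> stabilizer b Fi" "g t ** g (- t) = mat 1"
proof -
  define E where "E = wedge b y x"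
  have lE: "linear E" unfolding E_def by (rule linear_wedge)
  have sE: "b (E u) v = - b u (E v)" for u v unfolding E_def by (rule wedge_skew)
  have EE: "E (E w) = 0" for w
  proof -
    have "E x = 0" "E y = 0"
      using xy sym[of x y] isoi[OF x x] iso0[OF y y] by (simp_all add: E_def wedge_def)
    then have "E (b y w *\<^sub>R x - b x w *\<^sub>R y) = 0"
      by (simp add: linear_diff[OF lE] linear_scale[OF lE])
    then show ?thesis by (simp add: E_def wedge_def)
  qed
  have lin: "linear (\<lambda>w. w + t *\<^sub>R E w)" for t
    by (rule linearI) (simp_all add: linear_add[OF lE] linear_scale[OF lE] algebra_simps)
  have g: "g t *v w = w + t *\<^sub>R E w" for t w
    unfolding g_def E_def[symmetric] by (rule real_matrix_works[OF lin])
  then show "g t *v w = w + t *\<^sub>R wedge b y x w" by (simp add: E_def)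
  have inv: "(w + s *\<^sub>R E w) + t *\<^sub>R E (w + s *\<^sub>R E w) = w" if "s = - t" for s t w
    using that by (simp add: linear_diff[OF lE] linear_add[OF lE] linear_scale[OF lE] EE)
  have iso: "b (u + t *\<^sub>R E u) (v + t *\<^sub>R E v) = b u v" for t u v
  proof -
    have "b (E u) (E v) = 0" using sE[of u "E v"] EE by (simp add: b_simps)
    then show ?thesis using sE[of u v] by (simp add: b_simps)
  qed
  have gI: "g t \<in> isometry_group b" "g t ** g (- t) = mat 1" for t
    unfolding g_def E_def[symmetric]
    using isometry_groupI[OF lin[of t] lin[of "- t"] inv[OF refl] inv iso] minus_minus[of t]
    by simp_all
  have "g ` UNIV \<subseteq> SO0 b"
  proof (rule connected_SO0_subset)
    have "continuous_on UNIV (\<lambda>t. matrix (\<lambda>w. w + t *\<^sub>R E w))"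
      by (rule continuous_on_matrix_of) (intro continuous_intros)
    then have "continuous_on UNIV g" by (simp add: g_def[abs_def] E_def)
    then show "connected (g ` UNIV)" by (rule connected_continuous_image) (rule connected_UNIV)
    show "g ` UNIV \<subseteq> isometry_group b" using gI by blast
    have "g 0 = mat 1" using g by (simp add: matrix_eq)
    then show "mat 1 \<in> g ` UNIV" by (metis UNIV_I imageI)
  qed (rule SO0_one)
  moreover have sub: "act (g t) Fi \<subseteq> Fi" for t
  proof -
    have "g t *v f \<in> Fi" if "f \<in> Fi" for f
      using that x isoi[OF x that] subi by (simp add: g E_def wedge_def subspace_add subspace_scale)
    then show ?thesis by (auto simp: act_def)
  qed
  moreover have "Fi \<subseteq> act (g t) Fi"
  proof -
    have "act (g t) (act (g (- t)) Fi) = Fi" by (rule act_inverse[OF gI(2)])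
    then show ?thesis using sub[of "- t"] unfolding act_def by blast
  qed
  ultimately show "g t \<in> stabilizer b Fi" by (auto simp: stabilizer_def)
  show "g t ** g (- t) = mat 1" by (rule gI(2))
qed

text \<open>If \<open>A x\<close> is not a multiple of \<open>x\<close>, conjugating \<open>A\<close> by the transvections \<open>1 + t E\<close> with
  \<open>E = wedge b y x\<close> gives unipotent products \<open>A (1 + t E) A (1 - t E)\<close>; their leading coefficient
  \<open>- (A E)\<^sup>2\<close> in \<open>t\<close> would be nilpotent, but \<open>A x\<close> is an eigenvector for a nonzero eigenvalue.\<close>

lemma normal_unipotent_trivial_on_Fi:
  assumes H: "H \<subseteq> stabilizer b Fi" "\<And>A. A \<in> H \<Longrightarrow> unipotent A"
    and mult: "\<And>A B. A \<in> H \<Longrightarrow> B \<in> H \<Longrightarrow> A ** B \<in> H"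
    and conj: "\<And>A G G'. A \<in> H \<Longrightarrow> G \<in> stabilizer b Fi \<Longrightarrow> G' \<in> stabilizer b Fi \<Longrightarrow>
      G ** G' = mat 1 \<Longrightarrow> G ** A ** G' \<in> H"
    and A: "A \<in> H" and x: "x \<in> Fi"
  shows "A *v x = x"
proof (rule ccontr)
  assume Ax: "A *v x \<noteq> x"
  interpret sw: split_form b q Fi F0 l by (rule swap)
  have st: "A \<in> stabilizer b Fi" using H(1) A by blast
  have AxF: "A *v x \<in> Fi" by (rule stabilizer_Fi(2)[OF st x])
  have nz: "A *v x \<noteq> c *\<^sub>R x" for c using unipotent_eigenvalue[OF H(2)[OF A]] Ax by metis
  \<comment> \<open>The component of \<open>A x\<close> perpendicular to \<open>x\<close> for the
    Euclidean inner product. Representing the pairing with \<open>d\<close> by some \<open>y\<close>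
    in \<open>F0\<close> gives \<open>b y x = 0\<close> while \<open>b y (A x)\<close> is
    nonzero.\<close>
  define d where "d = A *v x - ((A *v x) \<bullet> x / (x \<bullet> x)) *\<^sub>R x"
  have "x \<noteq> 0" using Ax by auto
  then have xd: "x \<bullet> d = 0" by (simp add: d_def inner_diff_right inner_commute)
  have "d \<noteq> 0" using nz by (simp add: d_def)
  moreover have "(A *v x) \<bullet> d = d \<bullet> d"
  proof -
    have "A *v x = d + ((A *v x) \<bullet> x / (x \<bullet> x)) *\<^sub>R x" by (simp add: d_def)
    then have "(A *v x) \<bullet> d = (d + ((A *v x) \<bullet> x / (x \<bullet> x)) *\<^sub>R x) \<bullet> d" by simp
    then show ?thesis using xd by (simp add: inner_add_left)
  qed
  ultimately have Axd: "(A *v x) \<bullet> d \<noteq> 0" by simp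
  have "linear (\<lambda>w. w \<bullet> d)" by (rule linearI) (simp_all add: inner_add_left)
  then obtain y where y: "y \<in> F0" "\<And>p. p \<in> Fi \<Longrightarrow> b y p = p \<bullet> d" using sw.riesz by metis
  define c where "c = b y (A *v x)"
  have c: "c \<noteq> 0" using y(2)[OF AxF] Axd by (simp add: c_def)
  have yx: "b y x = 0" using y(2)[OF x] xd by simp
  define E where "E = wedge b y x"
  have lE: "linear E" unfolding E_def by (rule linear_wedge)
  define g where "g t = matrix (\<lambda>w. w + t *\<^sub>R wedge b y x w)" for t
  have g: "g t *v w = w + t *\<^sub>R E w" "g t \<in> stabilizer b Fi" "g t ** g (- t) = mat 1" for t w
    using transvection_stabilizer[OF x y(1) yx, of t] by (simp_all add: g_def E_def)
  \<comment> \<open>With \<open>t = 1 / s\<close> this is \<open>s * s\<close> times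
    \<open>A (1 + t E) A (1 - t E) - 1\<close>. Cleared of denominators it is polynomial in
    \<open>s\<close>, and its value at \<open>s = 0\<close> is the leading coefficient in
    \<open>t\<close>.\<close>
  define K where "K s z = A *v (s *\<^sub>R (A *v (s *\<^sub>R z - E z)) + E (A *v (s *\<^sub>R z - E z))) - (s * s) *\<^sub>R z"
    for s z
  have K0: "(K s ^^ CARD('n)) w = 0" if "s \<noteq> 0" for s w
  proof -
    define h where "h = A ** (g (1/s) ** A ** g (- (1/s)))"
    have "h \<in> H" unfolding h_def using A g by (intro mult conj) auto
    then have "((\<lambda>y. (h - mat 1) *v y) ^^ CARD('n)) w = 0" by (intro unipotent_power_dim H(2))
    moreover have "K s = (\<lambda>z. (s * s) *\<^sub>R ((h - mat 1) *v z))"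
    proof
      fix z
      define u where "u = A *v (z - (1/s) *\<^sub>R E z)"
      have "A *v (s *\<^sub>R z - E z) = s *\<^sub>R u"
      proof -
        have "s *\<^sub>R z - E z = s *\<^sub>R (z - (1/s) *\<^sub>R E z)" using that by (simp add: algebra_simps)
        then show ?thesis by (simp add: u_def matrix_vector_mult_scaleR)
      qed
      then have "K s z = A *v (s *\<^sub>R s *\<^sub>R u + s *\<^sub>R E u) - (s * s) *\<^sub>R z"
        by (simp add: K_def linear_scale[OF lE])
      also have "s *\<^sub>R s *\<^sub>R u + s *\<^sub>R E u = (s * s) *\<^sub>R (u + (1/s) *\<^sub>R E u)"
        using that by (simp add: algebra_simps)
      also have "A *v \<dots> - (s * s) *\<^sub>R z = (s * s) *\<^sub>R (A *v (u + (1/s) *\<^sub>R E u) - z)"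
        by (simp add: matrix_vector_mult_scaleR algebra_simps)
      also have "A *v (u + (1/s) *\<^sub>R E u) = h *v z"
        using g(1)[of "1/s" u] g(1)[of "- (1/s)" z]
        by (simp add: h_def u_def flip: matrix_vector_mul_assoc)
      finally show "K s z = (s * s) *\<^sub>R ((h - mat 1) *v z)"
        by (simp add: matrix_vector_mult_diff_rdistrib)
    qed
    ultimately show ?thesis by (simp add: funpow_scaled)
  qed
  have cA: "continuous_on S (\<lambda>s. A *v f s)" if "continuous_on S f" for S and f :: "real \<Rightarrow> real^'n"
    using linear_continuous_on_compose[OF that, of "(*v) A"] by simp
  have cE: "continuous_on S (\<lambda>s. E (f s))" if "continuous_on S f" for S and f :: "real \<Rightarrow> real^'n"
    using linear_continuous_on_compose[OF that lE] .
  have cK: "continuous_on UNIV (\<lambda>s. (K s ^^ m) w)" for m w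
  proof (induction m)
    case (Suc m)
    then show ?case by (simp add: K_def) (intro continuous_intros cA cE)
  qed simp
  \<comment> \<open>The exponent \<open>CARD('n)\<close> does not depend on \<open>s\<close>, so the
    vanishing for nonzero \<open>s\<close> passes to the limit \<open>s = 0\<close>.\<close>
  have "closed {s. (K s ^^ CARD('n)) w = 0}" for w
    by (intro closed_Collect_eq cK continuous_on_const)
  moreover have "(\<lambda>n. 1 / real (Suc n)) \<longlonglongrightarrow> 0" by (rule LIMSEQ_Suc[OF lim_1_over_n])
  ultimately have K00: "(K 0 ^^ CARD('n)) w = 0" for w
    using closed_sequentially[of "{s. (K s ^^ CARD('n)) w = 0}" "\<lambda>n. 1 / real (Suc n)" 0] K0 by simp
  have EAx: "E (A *v x) = c *\<^sub>R x"
    using isoi[OF x AxF] by (simp add: E_def wedge_def c_def)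
  have linK: "linear (K 0)"
    by (rule linearI) (simp_all add: K_def linear_add[OF lE] linear_scale[OF lE] linear_neg[OF lE]
        linear_diff[OF lE] linear_neg[OF matrix_vector_mul_linear] matrix_vector_right_distrib matrix_vector_mult_scaleR
        matrix_vector_mult_diff_distrib)
  have "A *v (- E (A *v x)) = (- c) *\<^sub>R (A *v x)"
    unfolding EAx by (metis matrix_vector_mult_scaleR scaleR_minus_left)
  then have "K 0 (A *v x) = A *v E ((- c) *\<^sub>R (A *v x))" by (simp add: K_def)
  also have "\<dots> = (- c * c) *\<^sub>R (A *v x)"
    by (simp add: linear_neg[OF lE] linear_scale[OF lE] EAx)
      (metis matrix_vector_mult_scaleR scaleR_minus_left)
  finally have "(K 0 ^^ CARD('n)) (A *v x) = (- c * c) ^ CARD('n) *\<^sub>R (A *v x)"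
    by (rule eigenvector_power[OF linK])
  then have "A *v x = 0" using K00 c by simp
  then show False using nz[of 0] by simp
qed

text \<open>\<open>A\<close> acts on the line \<open>Oi\<close> modulo \<open>Fi\<close> by a scalar
  \<open>\<alpha>\<close>, and unipotence forces \<open>\<alpha> = 1\<close>.\<close>

lemma unipotent_trivial_on_Fi_in_U:
  assumes A: "A \<in> stabilizer b Fi" "unipotent A" and Fi: "\<And>x. x \<in> Fi \<Longrightarrow> A *v x = x"
  shows "A \<in> U"
proof -
  have "A *v l \<in> Oi" by (rule stabilizer_Fi(3)[OF A(1) l_Oi])
  then obtain \<alpha> f where f: "f \<in> Fi" "A *v l = \<alpha> *\<^sub>R l + f" using Oi_decomp by blast
  have e: "(A - mat 1) *v y = A *v y - y" for y by (simp add: matrix_vector_mult_diff_rdistrib)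
  have pow: "\<exists>f\<in>Fi. ((\<lambda>y. (A - mat 1) *v y) ^^ k) l = (\<alpha> - 1) ^ k *\<^sub>R l + f" for k
  proof (induction k)
    case 0
    then show ?case using subspace_0[OF subi] by (intro bexI[of _ 0]) auto
  next
    case (Suc k)
    then obtain f' where f': "f' \<in> Fi" "((\<lambda>y. (A - mat 1) *v y) ^^ k) l = (\<alpha> - 1) ^ k *\<^sub>R l + f'" by blast
    have "((\<lambda>y. (A - mat 1) *v y) ^^ Suc k) l = (\<alpha> - 1) ^ Suc k *\<^sub>R l + (\<alpha> - 1) ^ k *\<^sub>R f"
      using f' f(2) Fi[OF f'(1)]
      by (simp add: e matrix_vector_right_distrib matrix_vector_mult_scaleR algebra_simps)
    moreover have "(\<alpha> - 1) ^ k *\<^sub>R f \<in> Fi" using f(1) subi by (simp add: subspace_scale)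
    ultimately show ?case by blast
  qed
  obtain k where "((\<lambda>y. (A - mat 1) *v y) ^^ k) l = 0" using A(2) unfolding unipotent_def by blast
  then obtain f' where f': "f' \<in> Fi" "(\<alpha> - 1) ^ k *\<^sub>R l + f' = 0" using pow[of k] by auto
  then have "b ((\<alpha> - 1) ^ k *\<^sub>R l + f') l = 0" by (simp add: b_simps)
  then have "(\<alpha> - 1) ^ k * b l l = 0" using li[OF f'(1)] by (simp add: b_simps)
  then have "\<alpha> = 1" using ll by auto
  then have Al: "A *v l = l + f" using f by simp
  have "A *v x - x \<in> Fi" if x: "x \<in> Oi" for x
  proof -
    obtain a g where g: "g \<in> Fi" "x = a *\<^sub>R l + g" using Oi_decomp[OF x] by blast
    then have "A *v x - x = a *\<^sub>R f"
      using Fi[OF g(1)] Al by (simp add: matrix_vector_right_distrib matrix_vector_mult_scaleR algebra_simps)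
    then show ?thesis using f(1) subi by (simp add: subspace_scale)
  qed
  then show ?thesis using A(1) Fi SO0_subset by (auto simp: U_def stabilizer_def)
qed

text \<open>\<open>U\<close> is itself one of the subgroups in the union, and every other one is
  contained in it.\<close>

lemma unipotent_radical_eq_U: "unipotent_radical (stabilizer b Fi) = U"
proof
  show "U \<subseteq> unipotent_radical (stabilizer b Fi)"
    unfolding unipotent_radical_def
    using normal_U closedin_U connected_U U_unipotent by blast
  show "unipotent_radical (stabilizer b Fi) \<subseteq> U"
  proof
    fix A assume "A \<in> unipotent_radical (stabilizer b Fi)"
    then obtain H where H: "H \<lhd> matrix_group (stabilizer b Fi)" "\<And>B. B \<in> H \<Longrightarrow> unipotent B" "A \<in> H"
      unfolding unipotent_radical_def by blast
    interpret normal H "matrix_group (stabilizer b Fi)" by (rule H(1))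
    have sub: "H \<subseteq> stabilizer b Fi" using subset by (simp add: matrix_group_def)
    have "A *v x = x" if x: "x \<in> Fi" for x
    proof (rule normal_unipotent_trivial_on_Fi[OF sub H(2) _ _ H(3) x])
      show "B ** C \<in> H" if "B \<in> H" "C \<in> H" for B C
        using subgroup.m_closed[OF normal_imp_subgroup[OF H(1)] that] by (simp add: matrix_group_def)
      show "G ** B ** G' \<in> H"
        if "B \<in> H" and G: "G \<in> stabilizer b Fi" "G' \<in> stabilizer b Fi" "G ** G' = mat 1" for B G G'
      proof -
        have "inv\<^bsub>matrix_group (stabilizer b Fi)\<^esub> G' = G"
          using G by (intro inv_equality) (auto simp: matrix_group_def)
        then show ?thesis
          using inv_op_closed1[of G' B] that by (simp add: matrix_group_def)
      qed
    qed
    then show "A \<in> U" using unipotent_trivial_on_Fi_in_U sub H by blast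
  qed
qed

lemma opp_involution_exp3:
  assumes "nilrad N"
  shows "opp_involution b F0 Fi (exp3 N ` F0) = exp3 (\<lambda>x. - N x) ` F0"
proof -
  have "(THE u. u \<in> U \<and> act u F0 = exp3 N ` F0) = matrix (exp3 N)"
    using exp3_matrix[OF assms] U_unique by (intro the_equality) auto
  moreover have "matrix_inv (matrix (exp3 N)) = matrix (exp3 (\<lambda>x. - N x))"
    using exp3_matrix[OF assms] by (intro matrix_inv_eqI)
  ultimately show ?thesis
    using exp3_matrix(5)[OF nilrad_uminus[OF assms]]
    by (simp add: opp_involution_def unipotent_radical_eq_U)
qed

end

section \<open>The sign of the Pfaffian\<close>

lemma continuous_on_det:
  fixes A :: "'t::topological_space \<Rightarrow> real^'n^'n::finite"
  assumes "\<And>i j. continuous_on S (\<lambda>t. A t $ i $ j)" shows "continuous_on S (\<lambda>t. det (A t))"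
  unfolding det_def by (intro continuous_intros assms)

context split_form begin

text \<open>For a linear \<open>J\<close> mapping \<open>F0\<close> onto \<open>F\<close>, the subspace \<open>act g F\<close> is transverse to \<open>Fi\<close> iff the
  map \<open>B g\<close>, equal to \<open>g J\<close> on \<open>F0\<close> and to the identity on \<open>Oi\<close>, is invertible. Cramer's rule for
  \<open>B g\<close> then shows that the projection depends continuously on \<open>g\<close>.\<close>

lemma openin_orbit_Omega:
  assumes F: "F \<in> isotropic_subspaces b q"
  defines "S \<equiv> {g \<in> SO0 b. act g F \<in> Omega b q Fi}"
  shows "openin (top_of_set (SO0 b)) S" "continuous_on S (\<lambda>g. proj (act g F) x)"
proof -
  define \<pi> where "\<pi> = proj F0"
  have lp: "linear \<pi>" and p: "\<pi> x \<in> F0" "x - \<pi> x \<in> Oi" for x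
    using proj_linear proj_in proj_diff F0_Omega by (auto simp: \<pi>_def)
  have sF: "subspace F" and dF: "dim F0 = dim F"
    using F dim0 by (auto simp: isotropic_subspaces_def)
  obtain J J' where J: "linear J" "J ` F0 = F" "\<And>x. x \<in> F0 \<Longrightarrow> J' (J x) = x" "linear J'"
    by (rule isometries_subspaces[OF sub0 sF dF]) blast
  define B where "B g x = g *v J (\<pi> x) + (x - \<pi> x)" for g x
  have lB: "linear (B g)" for g
    by (rule linearI) (simp_all add: B_def linear_add[OF lp] linear_scale[OF lp] linear_add[OF J(1)]
        linear_scale[OF J(1)] matrix_vector_right_distrib matrix_vector_mult_scaleR algebra_simps)
  define M where "M g = matrix (B g)" for g
  have MB: "M g *v x = B g x" for g x unfolding M_def by (rule real_matrix_works[OF lB])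
  have cM: "continuous_on T (\<lambda>g. M g $ i $ j)" for T i j
    unfolding M_def matrix_def B_def by (auto simp: matrix_vector_mult_def intro!: continuous_intros)
  have cdet: "continuous_on T (\<lambda>g. det (M g))" for T by (intro continuous_on_det cM)
  have inj: "det (M g) \<noteq> 0 \<longleftrightarrow> (\<forall>x. B g x = 0 \<longrightarrow> x = 0)" for g
    unfolding M_def det_nz_iff_inj[OF lB] by (rule linear_injective_0[OF lB])
  have iff: "act g F \<in> Omega b q Fi \<longleftrightarrow> det (M g) \<noteq> 0" if g: "g \<in> SO0 b" for g
  proof -
    have iso: "b (g *v x) (g *v y) = b x y" for x y
      using g SO0_subset by (auto simp: isometry_group_def)
    have injg: "inj ((*v) g)"
      using g SO0_subset[of b] inj_matrix_vector_mult by (auto simp: isometry_group_def)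
    have gF: "subspace (act g F)" "dim (act g F) = q" "\<forall>x\<in>act g F. \<forall>y\<in>act g F. b x y = 0"
    proof -
      show "subspace (act g F)"
        using F unfolding act_def by (auto simp: isotropic_subspaces_def intro: linear_subspace_image)
      show "dim (act g F) = q"
        unfolding act_def using F dim_image_eq[of "(*v) g" F] injg
        by (auto simp: isotropic_subspaces_def intro: inj_on_subset)
      show "\<forall>x\<in>act g F. \<forall>y\<in>act g F. b x y = 0"
        using F by (auto simp: act_def iso isotropic_subspaces_def)
    qed
    have "act g F \<in> Omega b q Fi \<longleftrightarrow> (\<forall>y\<in>act g F. y \<in> Oi \<longrightarrow> y = 0)"
    proof
      assume "act g F \<in> Omega b q Fi"
      then show "\<forall>y\<in>act g F. y \<in> Oi \<longrightarrow> y = 0" by (auto simp: Omega_Fi_iff direct_sum_eq_UNIV_def)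
    next
      assume "\<forall>y\<in>act g F. y \<in> Oi \<longrightarrow> y = 0"
      then show "act g F \<in> Omega b q Fi" using gF direct_sum_OiI[OF gF(1,2)] by (simp add: Omega_Fi_iff)
    qed
    also have "\<dots> \<longleftrightarrow> (\<forall>x. B g x = 0 \<longrightarrow> x = 0)"
    proof (intro iffI allI impI ballI)
      fix x assume *: "\<forall>y\<in>act g F. y \<in> Oi \<longrightarrow> y = 0" and x: "B g x = 0"
      have "g *v J (\<pi> x) \<in> act g F" using p(1) J(2) by (auto simp: act_def)
      moreover have "g *v J (\<pi> x) = - (x - \<pi> x)" using x unfolding B_def by (simp only: eq_neg_iff_add_eq_0)
      then have "g *v J (\<pi> x) \<in> Oi" using subspace_neg[OF subspace_Oi p(2)] by simp
      ultimately have 0: "g *v J (\<pi> x) = 0" using * by blast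
      then have "J (\<pi> x) = 0" using injg by (metis injD matrix_vector_mult_0_right)
      then have "\<pi> x = 0" using J(3)[OF p(1)] linear_0[OF J(4)] by metis
      then show "x = 0" using x 0 by (simp add: B_def)
    next
      fix y assume *: "\<forall>x. B g x = 0 \<longrightarrow> x = 0" and y: "y \<in> act g F" "y \<in> Oi"
      obtain r where r: "r \<in> F0" "y = g *v J r" using y(1) J(2) by (auto simp: act_def)
      have "\<pi> (r - y) = r"
        unfolding \<pi>_def using r(1) y(2) subspace_neg[OF subspace_Oi y(2)] by (intro proj_eqI[OF F0_Omega]) auto
      then have "B g (r - y) = 0" using r(2) by (simp add: B_def)
      then have "r - y = 0" using * by blast
      then show "y = 0" using Oi_Int_F0[of y] y(2) r(1) by simp
    qed
    finally show ?thesis using inj by simp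
  qed
  have S: "S = SO0 b \<inter> (\<lambda>g. det (M g)) -` (- {0})" using iff by (auto simp: S_def)
  show "openin (top_of_set (SO0 b)) S"
    unfolding S by (rule continuous_openin_preimage_gen[OF cdet]) auto
  define z where "z g = (\<chi> k. det (\<chi> i j. if j = k then x $ i else M g $ i $ j) / det (M g))" for g
  have pr: "proj (act g F) x = g *v J (\<pi> (z g))" if g: "g \<in> S" for g
  proof -
    have d: "det (M g) \<noteq> 0" using g S by blast
    have "M g *v z g = x" using cramer[OF d, of "z g" x] by (simp add: z_def)
    then have zx: "g *v J (\<pi> (z g)) + (z g - \<pi> (z g)) = x" by (simp add: MB B_def)
    show ?thesis
    proof (rule proj_eqI)
      show "act g F \<in> Omega b q Fi" using g by (simp add: S_def)
      show "g *v J (\<pi> (z g)) \<in> act g F" using p(1) J(2) by (auto simp: act_def)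
      have "x - g *v J (\<pi> (z g)) = z g - \<pi> (z g)" using zx by (metis add_diff_cancel_left')
      then show "x - g *v J (\<pi> (z g)) \<in> Oi" using p(2) by simp
    qed
  qed
  have cz: "continuous_on S z"
    unfolding z_def
  proof (intro continuous_on_vec_lambda continuous_on_divide cdet continuous_on_det)
    show "continuous_on S (\<lambda>g. (\<chi> i j. if j = k then x $ i else M g $ i $ j) $ i $ j)" for k i j
      by (cases "j = k") (simp_all add: cM)
    show "\<forall>g\<in>S. det (M g) \<noteq> 0" using S by blast
  qed
  have "continuous_on S (\<lambda>g. J (\<pi> (z g)))"
    using linear_continuous_on_compose[OF cz linear_compose[OF lp J(1)]] by (simp add: o_def)
  then have "continuous_on S (\<lambda>g. g *v J (\<pi> (z g)))"
    by (auto simp: matrix_vector_mult_def intro!: continuous_intros)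
  then show "continuous_on S (\<lambda>g. proj (act g F) x)"
    by (rule continuous_on_eq) (simp add: pr)
qed

text \<open>A substitute for the alternating form of \<open>N\<close> that refers to
  \<open>G\<close> alone. This makes its continuity along orbits visible and avoids inverting the
  exponential.\<close>

definition proj_form :: "(real^'n) set \<Rightarrow> real^'n \<Rightarrow> real^'n \<Rightarrow> real" where
  "proj_form G x y = b (proj G x) y - b (proj G y) x"

lemma proj_form_antisym: "proj_form G x y = - proj_form G y x"
  by (simp add: proj_form_def)

lemma proj_form_linear:
  assumes "G \<in> Omega b q Fi"
  shows "linear (proj_form G x)" "linear (\<lambda>x. proj_form G x y)"
  by (rule linearI; simp add: proj_form_def b_simps linear_add[OF proj_linear[OF assms]]
      linear_scale[OF proj_linear[OF assms]] algebra_simps)+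

lemma continuous_on_b:
  "continuous_on S f \<Longrightarrow> continuous_on S g \<Longrightarrow> continuous_on S (\<lambda>t. b (f t) (g t))"
  using bounded_bilinear.continuous_on[OF bilin[unfolded bilinear_conv_bounded_bilinear]] .

text \<open>Openness is tested along each orbit map, where the projection is continuous on the open
  set of transverse positions. The factor \<open>s\<close> treats both signs at once.\<close>

lemma openin_pfaffian_sign:
  "openin (isotropic_topology b q)
     {G \<in> Omega b q Fi. 0 < s * pfaffian (proj_form G) m L}"
  unfolding openin_isotropic_topology
proof (intro conjI ballI)
  show "{G \<in> Omega b q Fi. 0 < s * pfaffian (proj_form G) m L} \<subseteq> isotropic_subspaces b q"
    by (auto simp: Omega_def)
  fix F assume F: "F \<in> isotropic_subspaces b q"
  define S where "S = {g \<in> SO0 b. act g F \<in> Omega b q Fi}"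
  have "continuous_on S (\<lambda>g. pfaffian (proj_form (act g F)) m L)"
    unfolding proj_form_def S_def
    by (intro continuous_on_pfaffian continuous_intros continuous_on_b openin_orbit_Omega(2)[OF F])
  then have "continuous_on S (\<lambda>g. s * pfaffian (proj_form (act g F)) m L)"
    by (intro continuous_intros)
  then have "openin (top_of_set S) (S \<inter> (\<lambda>g. s * pfaffian (proj_form (act g F)) m L) -` {0<..})"
    by (rule continuous_openin_preimage_gen) auto
  from openin_trans[OF this openin_orbit_Omega(1)[OF F, folded S_def]]
  show "openin (top_of_set (SO0 b))
      {g \<in> SO0 b. act g F \<in> {G \<in> Omega b q Fi. 0 < s * pfaffian (proj_form G) m L}}"
    by (rule back_subst[of "openin (top_of_set (SO0 b))"]) (auto simp: S_def)
qed

text \<open>The contribution of \<open>b (N (N p)) r\<close> is symmetric in \<open>p\<close> and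
  \<open>r\<close> and cancels, while the skew part is doubled. Against \<open>l\<close> there is no
  doubling, because \<open>l\<close> projects to 0.\<close>

lemma proj_form_exp3:
  assumes N: "nilrad N" and p: "p \<in> F0"
  shows "r \<in> F0 \<Longrightarrow> proj_form (exp3 N ` F0) p r = 2 * b (N p) r"
    and "proj_form (exp3 N ` F0) p l = b (N p) l"
proof -
  note G = exp3_image_Omega[OF N]
  have pr: "proj (exp3 N ` F0) x = exp3 N x" if "x \<in> F0" for x
    using exp3_diff_Oi[OF N, of x] subspace_neg[OF subspace_Oi, of "exp3 N x - x"] that
    by (intro proj_eqI[OF G]) auto
  show "proj_form (exp3 N ` F0) p l = b (N p) l"
  proof -
    have 1: "proj (exp3 N ` F0) l = 0" by (rule proj_Oi[OF G l_Oi])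
    have "b (N (N p)) l = 0"
      using nilrad_skew[OF N, of "N p" l] Oi_b_Fi(1)[OF nilrad_Oi[OF N] nilrad_Fi[OF N l_Oi]] by simp
    then show ?thesis
      unfolding proj_form_def 1 pr[OF p] using l0[OF p] by (simp add: exp3_def b_simps)
  qed
  assume r: "r \<in> F0"
  have "b (N (N p)) r = b (N (N r)) p"
    using nilrad_skew[OF N, of "N p" r] nilrad_skew[OF N, of "N r" p] sym[of "N p" "N r"] by simp
  moreover have "b (N r) p = - b (N p) r"
    using nilrad_skew[OF N, of r p] sym[of r "N p"] by simp
  ultimately show "proj_form (exp3 N ` F0) p r = 2 * b (N p) r"
    unfolding proj_form_def pr[OF p] pr[OF r] using iso0[OF p r] iso0[OF r p]
    by (simp add: exp3_def b_simps)
qed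

text \<open>Appended to a list of length \<open>k\<close>, it makes the total length even; for odd
  \<open>q\<close> the form lives on \<open>F0\<close> together with \<open>l\<close>.\<close>

definition tail :: "nat \<Rightarrow> (real^'n) list" where
  "tail k = (if odd k then [l] else [])"

text \<open>On the first dual pair \<open>p\<close>, \<open>r\<close> the wedge sum takes the values
  \<open>y\<close> and \<open>- x\<close>, so the pair is orthogonal to the rest and contributes the
  factor 2. An unpaired last vector contributes \<open>b l l\<close>.\<close>

lemma pfaffian_dual:
  assumes "dual_lists b z ps" "set ps \<subseteq> F0"
    and "\<And>p r. p \<in> set ps \<Longrightarrow> r \<in> set ps \<Longrightarrow> \<omega> p r = 2 * b (wedge_sum b l z p) r"
    and "\<And>p. p \<in> set ps \<Longrightarrow> odd (length z) \<Longrightarrow> \<omega> p l = b (wedge_sum b l z p) l"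
    and "set z \<subseteq> Fi"
  shows "pfaffian \<omega> ((length z + 1) div 2) (ps @ tail (length z)) =
    2 ^ (length z div 2) * (if odd (length z) then b l l else 1)"
  using assms
proof (induction z arbitrary: ps rule: induct_list012)
  case 1
  then show ?case by (simp add: dual_lists_def tail_def)
next
  case (2 x)
  then obtain p where ps: "ps = [p]" by (auto simp: dual_lists_def length_Suc_conv)
  then have "b x p = 1" "p \<in> F0" using dual_lists_Cons[of x "[]" p "[]"] 2 by auto
  then have "\<omega> p l = b l l" using 2(4)[of p] ps l0' by (simp add: wedge_def b_simps)
  then show ?case using ps by (simp add: tail_def)
next
  case (3 x y zs)
  then obtain p r rs where ps: "ps = p # r # rs"
    by (cases ps; cases "tl ps") (auto simp: dual_lists_def)
  have d1: "dual_lists b (x # y # zs) (p # r # rs)" using 3 ps by simp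
  note c1 = dual_lists_Cons[OF d1]
  note c2 = dual_lists_Cons[OF c1(1)]
  have F: "p \<in> F0" "r \<in> F0" "set rs \<subseteq> F0" using 3(4) ps by auto
  have wp: "wedge_sum b l (x # y # zs) p = y"
  proof -
    have "wedge_sum b l zs p = 0" using c1(3) l0'[OF F(1)] by (intro wedge_sum_eq_zero) auto
    then show ?thesis using c1(2) c1(3)[of y] by (simp add: wedge_def)
  qed
  have wr: "wedge_sum b l (x # y # zs) r = - x"
  proof -
    have "wedge_sum b l zs r = 0" using c2(3) l0'[OF F(2)] by (intro wedge_sum_eq_zero) auto
    then show ?thesis using c2(2) c1(4)[of r] by (simp add: wedge_def)
  qed
  have ws: "wedge_sum b l (x # y # zs) s = wedge_sum b l zs s" if "s \<in> set rs" for s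
    using c1(4)[of s] c2(4)[of s] that by (simp add: wedge_def)
  have pr: "\<omega> p r = 2" using 3(5)[of p r] ps wp c2(2) by simp
  have p0: "\<omega> p s = 0" and r0: "\<omega> r s = 0" if s: "s \<in> set (rs @ tail (length zs))" for s
  proof -
    have *: "\<omega> p s = 0 \<and> \<omega> r s = 0" 
    proof (cases "s \<in> set rs")
      case True
      then show ?thesis
        using 3(5)[of p s] 3(5)[of r s] ps wp wr c1(4)[of s] c2(4)[of s]
        by (simp add: b_simps del: wedge_sum.simps)
    next
      case False
      then have s: "s = l" "odd (length zs)" using s by (auto simp: tail_def split: if_splits)
      have "b x l = 0" "b y l = 0" using 3(7) li by auto
      then show ?thesis
        using 3(6)[of p] 3(6)[of r] ps wp wr s by (simp add: b_simps del: wedge_sum.simps)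
    qed
    then show "\<omega> p s = 0" "\<omega> r s = 0" by auto
  qed
  have "pfaffian \<omega> ((length zs + 1) div 2) (rs @ tail (length zs)) =
      2 ^ (length zs div 2) * (if odd (length zs) then b l l else 1)"
  proof (rule 3(1)[OF c2(1) F(3)])
    show "\<omega> s t = 2 * b (wedge_sum b l zs s) t" if "s \<in> set rs" "t \<in> set rs" for s t
      using 3(5)[of s t] ps that ws by (simp del: wedge_sum.simps)
    show "\<omega> s l = b (wedge_sum b l zs s) l" if "s \<in> set rs" "odd (length zs)" for s
      using 3(6)[of s] ps that ws by (simp del: wedge_sum.simps)
    show "set zs \<subseteq> Fi" using 3(7) by simp
  qed
  then show ?case
    using pfaffian_hyperbolic[of "rs @ tail (length zs)" \<omega> p r "(length zs + 1) div 2"] p0 r0 pr ps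
    by (simp add: tail_def)
qed

end

section \<open>Connected components\<close>

lemma topspace_isotropic_topology:
  "topspace (isotropic_topology b k) \<subseteq> isotropic_subspaces b k"
  unfolding topspace_def using openin_isotropic_topology by blast

lemma isotropic_orbit:
  assumes "bilinear b" "g \<in> SO0 b" "F \<in> isotropic_subspaces b k"
  shows "act g F \<in> isotropic_subspaces b k"
proof -
  have g: "invertible g" "\<And>x y. b (g *v x) (g *v y) = b x y"
    using assms(2) SO0_subset[of b] by (auto simp: isometry_group_def)
  have "dim (act g F) = k"
    unfolding act_def using assms(3) dim_image_eq[of "(*v) g" F] inj_matrix_vector_mult[OF g(1)]
    by (auto simp: isotropic_subspaces_def intro: inj_on_subset)
  then show ?thesis
    using assms(3) g(2) unfolding isotropic_subspaces_def act_def
    by (auto intro: linear_subspace_image)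
qed

lemma topspace_isotropic_topology_eq:
  assumes "bilinear b"
  shows "topspace (isotropic_topology b k) = isotropic_subspaces b k"
proof (rule subset_antisym[OF topspace_isotropic_topology openin_subset])
  have "{g \<in> SO0 b. act g F \<in> isotropic_subspaces b k} = SO0 b" if "F \<in> isotropic_subspaces b k" for F
    using isotropic_orbit[OF assms _ that] by blast
  then show "openin (isotropic_topology b k) (isotropic_subspaces b k)"
    unfolding openin_isotropic_topology by simp
qed

lemma continuous_map_orbit:
  assumes "bilinear b" "F \<in> isotropic_subspaces b k"
  shows "continuous_map (top_of_set (SO0 b)) (isotropic_topology b k) (\<lambda>g. act g F)"
  unfolding continuous_map topspace_isotropic_topology_eq[OF assms(1)]
  using assms isotropic_orbit[OF assms(1)] by (auto simp: openin_isotropic_topology)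

context split_form begin

definition cell_top :: "(real^'n) set topology" where
  "cell_top = subtopology (isotropic_topology b q) (Omega b q F0 \<inter> Omega b q Fi)"

lemma topspace_cell_top: "topspace cell_top = Omega b q F0 \<inter> Omega b q Fi"
  unfolding cell_top_def topspace_subtopology topspace_isotropic_topology_eq[OF bilin] by (auto simp: Omega_def)

text \<open>The path is continuous as a path of matrices in \<open>SO0 b\<close>, and the orbit map
  of \<open>F0\<close> carries it into the space of subspaces. The second continuity hypothesis
  controls the quadratic term of \<open>exp3\<close>.\<close>

lemma connected_component_exp3_path:
  assumes N: "\<And>t. t \<in> {0..1} \<Longrightarrow> nilrad (N t)"
    and \<Omega>: "\<And>t. t \<in> {0..1} \<Longrightarrow> exp3 (N t) ` F0 \<in> Omega b q F0"
    and cont: "\<And>x. continuous_on {0..1::real} (\<lambda>t. N t x)"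
      "\<And>x. continuous_on {0..1} (\<lambda>t. N t (N t x))"
  shows "connected_component_of cell_top (exp3 (N 0) ` F0) (exp3 (N 1) ` F0)"
proof -
  define K where "K = (\<lambda>t. matrix (exp3 (N t))) ` {0..1}"
  have F: "F0 \<in> isotropic_subspaces b q"
    using sub0 dim0 iso0 by (simp add: isotropic_subspaces_def)
  have "connected K"
    unfolding K_def
    by (rule connected_continuous_image[OF continuous_on_exp3_matrix[OF cont]]) simp
  moreover have "K \<subseteq> SO0 b" using exp3_matrix(2)[OF N] U_SO0 by (auto simp: K_def)
  ultimately have "connectedin (top_of_set (SO0 b)) K" by (simp add: connectedin_subtopology)
  from connectedin_continuous_map_image[OF continuous_map_orbit[OF bilin F] this]
  have "connectedin (isotropic_topology b q) ((\<lambda>g. act g F0) ` K)" .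
  moreover have e: "(\<lambda>g. act g F0) ` K = (\<lambda>t. exp3 (N t) ` F0) ` {0..1}"
    unfolding K_def image_image using exp3_matrix(5)[OF N] by (intro image_cong) auto
  moreover have "(\<lambda>t. exp3 (N t) ` F0) ` {0..1} \<subseteq> Omega b q F0 \<inter> Omega b q Fi"
    using \<Omega> exp3_image_Omega[OF N] by blast
  ultimately have "connectedin cell_top ((\<lambda>t. exp3 (N t) ` F0) ` {0..1})"
    by (simp add: cell_top_def connectedin_subtopology)
  then show ?thesis unfolding connected_component_of_def
    by (rule_tac exI) (erule conjI, auto)
qed

lemma continuous_on_wedge_sum:
  "(\<And>h. h \<in> set hs \<Longrightarrow> continuous_on S h) \<Longrightarrow> continuous_on S f \<Longrightarrow>
    continuous_on S (\<lambda>t. wedge_sum b l (map (\<lambda>h. h t) hs) (f t))"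
proof (induction hs rule: induct_list012)
  case (2 h)
  then show ?case by (auto simp: wedge_def intro!: continuous_intros continuous_on_b)
next
  case (3 h h' hs)
  have "continuous_on S (\<lambda>t. wedge_sum b l (map (\<lambda>h. h t) hs) (f t))" using 3 by simp
  moreover have "continuous_on S (\<lambda>t. wedge b (h t) (h' t) (f t))"
    using 3 by (auto simp: wedge_def intro!: continuous_intros continuous_on_b)
  ultimately show ?case by (simp add: continuous_on_add)
qed simp

definition cell :: "(real^'n) list \<Rightarrow> (real^'n) set" where
  "cell z = exp3 (wedge_sum b l z) ` F0"

lemma cell_in: 
  assumes "span (set z) = Fi" "length z = q"
  shows "nilrad (wedge_sum b l z)" "cell z \<in> Omega b q F0" "cell z \<in> Omega b q Fi"
  using normal_form_Omega[OF assms subspace_0[OF subi]]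
  by (simp_all add: wedge_def b_simps cell_def)

lemma basis_step_connected:
  assumes z: "span (set z) = Fi" "length z = q" and st: "basis_step z z'"
  shows "connected_component_of cell_top (cell z) (cell z')"
  using st
proof cases
  case (basis_stepI c s xs ys u)
  define h where "h t = ((1 - t) + t * c) *\<^sub>R u + t *\<^sub>R s" for t
  \<comment> \<open>The moving basis is encoded as a list of functions of \<open>t\<close>, constant
    except at one place, to fit \<open>continuous_on_wedge_sum\<close>.\<close>
  define hs where "hs = map (\<lambda>x t::real. x) xs @ h # map (\<lambda>x t. x) ys"
  define zt where "zt t = map (\<lambda>h. h t) hs" for t
  have zt: "zt t = xs @ h t # ys" for t by (simp add: zt_def hs_def o_def)
  have ch: "continuous_on S g" if "g \<in> set hs" for g S
    using that by (auto simp: hs_def h_def[abs_def] intro!: continuous_intros)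
  have sp: "span (set (zt t)) = Fi" "length (zt t) = q" if "t \<in> {0..1}" for t
  proof -
    have "(1 - t) + t * c > 0"
    proof (cases "t = 0")
      case False
      then have "t * c > 0" using that basis_stepI(3) by simp
      then show ?thesis using that by simp
    qed simp
    then show "span (set (zt t)) = Fi"
      using z(1) basis_stepI(1) span_replace[of "(1 - t) + t * c" "t *\<^sub>R s" "set xs \<union> set ys" u]
        span_scale[OF basis_stepI(4), of t]
      by (simp add: zt h_def)
    show "length (zt t) = q" using z(2) basis_stepI(1) by (simp add: zt)
  qed
  have "zt 0 = z" "zt 1 = z'" using basis_stepI by (simp_all add: zt h_def)
  moreover have "connected_component_of cell_top (exp3 (wedge_sum b l (zt 0)) ` F0) (exp3 (wedge_sum b l (zt 1)) ` F0)"
  proof (rule connected_component_exp3_path)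
    show "nilrad (wedge_sum b l (zt t))" "exp3 (wedge_sum b l (zt t)) ` F0 \<in> Omega b q F0"
      if "t \<in> {0..1}" for t
      using cell_in[OF sp[OF that]] by (simp_all add: cell_def)
    have c: "continuous_on {0..1} (\<lambda>t. wedge_sum b l (zt t) (f t))" if "continuous_on {0..1} f" for f
      unfolding zt_def by (rule continuous_on_wedge_sum[OF ch that])
    show "continuous_on {0..1} (\<lambda>t. wedge_sum b l (zt t) x)" for x
      by (rule c) (rule continuous_on_const)
    then show "continuous_on {0..1} (\<lambda>t. wedge_sum b l (zt t) (wedge_sum b l (zt t) x))" for x
      by (rule c)
  qed
  ultimately show ?thesis by (simp add: cell_def)
qed

lemma basis_steps_connected:
  assumes "basis_steps z z'" "span (set z) = Fi" "length z = q"
  shows "connected_component_of cell_top (cell z) (cell z')"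
  using assms(1)
proof induction
  case base
  then show ?case unfolding connected_component_of_refl topspace_cell_top using cell_in[OF assms(2,3)] by blast
next
  case (step y z')
  have "connected_component_of cell_top (cell y) (cell z')"
    using basis_steps_span[OF step(1)] assms step(2) by (intro basis_step_connected) auto
  then show ?case by (rule connected_component_of_trans[OF step(3)])
qed

lemma Omega_normal_form:
  assumes "G \<in> Omega b q F0 \<inter> Omega b q Fi"
  shows "\<exists>z v. span (set z) = Fi \<and> length z = q \<and> v \<in> Fi \<and> (odd q \<longrightarrow> v = 0) \<and>
    G = exp3 (\<lambda>p. wedge_sum b l z p + wedge b v l p) ` F0"
proof -
  obtain N where N: "nilrad N" "G = exp3 N ` F0" using Omega_exp3 assms by blast
  then have inj: "\<And>p. p \<in> F0 \<Longrightarrow> N p = 0 \<Longrightarrow> p = 0" using nilrad_exp3_inj_F0[OF N(1)] assms by blast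
  show ?thesis using nilrad_normal_form[OF N(1) inj] N(2) by blast
qed

text \<open>Shrink \<open>v\<close> to 0. For even \<open>q\<close> every \<open>v\<close> in
  \<open>Fi\<close> is admissible, and for odd \<open>q\<close> it is already 0.\<close>

lemma connected_to_cell:
  assumes z: "span (set z) = Fi" "length z = q" and v: "v \<in> Fi" "odd q \<Longrightarrow> v = 0"
  shows "connected_component_of cell_top (exp3 (\<lambda>p. wedge_sum b l z p + wedge b v l p) ` F0) (cell z)"
proof -
  define N where "N t p = wedge_sum b l z p + wedge b ((1 - t) *\<^sub>R v) l p" for t p
  have "connected_component_of cell_top (exp3 (N 0) ` F0) (exp3 (N 1) ` F0)"
  proof (rule connected_component_exp3_path)
    fix t :: real
    have "(1 - t) *\<^sub>R v \<in> Fi" using v(1) subi by (simp add: subspace_scale)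
    then show "nilrad (N t)" "exp3 (N t) ` F0 \<in> Omega b q F0"
      using normal_form_Omega[OF z, of "(1 - t) *\<^sub>R v"] v(2) by (auto simp: N_def[abs_def])
  next
    have "continuous_on {0..1} (\<lambda>t. wedge_sum b l (map (\<lambda>h. h t) (map (\<lambda>x t. x) z)) (f t))"
      if "continuous_on {0..1} f" for f :: "real \<Rightarrow> real^'n"
      by (rule continuous_on_wedge_sum) (use that in auto)
    then have c: "continuous_on {0..1} (\<lambda>t. N t (f t))" if "continuous_on {0..1} f"
      for f :: "real \<Rightarrow> real^'n"
      using that by (auto simp: N_def wedge_def o_def intro!: continuous_intros continuous_on_b)
    show "continuous_on {0..1} (\<lambda>t. N t x)" for x
      by (rule c) (rule continuous_on_const)
    then show "continuous_on {0..1} (\<lambda>t. N t (N t x))" for x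
      by (rule c)
  qed
  then show ?thesis by (simp add: N_def[abs_def] cell_def wedge_def b_simps)
qed

abbreviation half :: nat where "half \<equiv> (q + 1) div 2"

text \<open>The sign of the Pfaffian in a basis dual to the normal form: for odd \<open>q\<close>
  the unpaired vector brings in \<open>b l l\<close>, whose sign is left open.\<close>

definition orient :: real where "orient = (if odd q then sgn (b l l) else 1)"

lemma orient_nz: "orient \<noteq> 0" using ll by (simp add: orient_def sgn_0_0)

lemma sgn_pfaffian_dual:
  assumes z: "span (set z) = Fi" "length z = q" and v: "v \<in> Fi" "odd q \<Longrightarrow> v = 0"
    and ps: "dual_lists b z ps" "set ps \<subseteq> F0"
  shows "sgn (pfaffian (proj_form (exp3 (\<lambda>p. wedge_sum b l z p + wedge b v l p) ` F0)) half (ps @ tail q))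
    = orient"
proof -
  define N where "N p = wedge_sum b l z p + wedge b v l p" for p
  have N: "nilrad N" using normal_form_Omega(1)[OF z v] by (simp add: N_def[abs_def])
  have zF: "set z \<subseteq> Fi" using z(1) span_superset by blast
  have "pfaffian (proj_form (exp3 N ` F0)) ((length z + 1) div 2) (ps @ tail (length z)) =
    2 ^ (length z div 2) * (if odd (length z) then b l l else 1)"
  proof (rule pfaffian_dual[OF ps])
    show "proj_form (exp3 N ` F0) p r = 2 * b (wedge_sum b l z p) r" if "p \<in> set ps" "r \<in> set ps" for p r
    proof -
      have "p \<in> F0" "r \<in> F0" using that ps(2) by auto
      then show ?thesis using proj_form_exp3(1)[OF N, of p r] l0'
        by (simp add: N_def wedge_def b_simps)
    qed
    show "proj_form (exp3 N ` F0) p l = b (wedge_sum b l z p) l" if "p \<in> set ps" "odd (length z)" for p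
    proof -
      have "p \<in> F0" "v = 0" using that ps(2) v(2) z(2) by auto
      then show ?thesis using proj_form_exp3(2)[OF N, of p] by (simp add: N_def wedge_def b_simps)
    qed
  qed (rule zF)
  then show ?thesis unfolding z(2) N_def[abs_def] by (simp add: orient_def sgn_mult)
qed

lemma pfaffian_tail_alternating:
  assumes "G \<in> Omega b q Fi"
  shows "antisymmetric_list (\<lambda>ps. pfaffian (proj_form G) m (ps @ w))"
    "multilinear_list (\<lambda>ps. pfaffian (proj_form G) m (ps @ w))"
proof -
  have "antisymmetric_list (pfaffian (proj_form G) m)"
    by (rule antisymmetric_list_pfaffian) (rule proj_form_antisym)
  then show "antisymmetric_list (\<lambda>ps. pfaffian (proj_form G) m (ps @ w))"
    unfolding antisymmetric_list_def by (metis append_Cons append_assoc)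
  have "multilinear_list (pfaffian (proj_form G) m)"
    by (rule multilinear_list_pfaffian) (rule proj_form_linear[OF assms])+
  then have "linear (\<lambda>u. pfaffian (proj_form G) m (xs @ u # (ys @ w)))" for xs ys
    unfolding multilinear_list_def by blast
  then show "multilinear_list (\<lambda>ps. pfaffian (proj_form G) m (ps @ w))"
    unfolding multilinear_list_def by simp
qed

lemma multilinear_list_neg_last:
  assumes "multilinear_list g" "ps \<noteq> []"
  shows "g (butlast ps @ [- last ps]) = - g ps"
proof -
  have lin: "linear (\<lambda>u. g (butlast ps @ u # []))" using assms(1) unfolding multilinear_list_def by blast
  have "g (butlast ps @ [- last ps]) = - g (butlast ps @ [last ps])" by (rule linear_neg[OF lin])
  then show ?thesis using assms(2) by simp
qed

lemma dual_lists_neg_last: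
  assumes "dual_lists b z ps" "z \<noteq> []"
  shows "dual_lists b (butlast z @ [- last z]) (butlast ps @ [- last ps])"
proof -
  have len: "length ps = length z" "ps \<noteq> []" using assms by (auto simp: dual_lists_def)
  obtain k where k: "length z = Suc k" using assms(2) by (cases z) auto
  have n: "(butlast w @ [- last w]) ! i = (if i = k then - (w ! i) else w ! i)"
    if "length w = Suc k" "i < Suc k" for w :: "(real^'n) list" and i
  proof -
    have "w \<noteq> []" using that by auto
    then show ?thesis using that by (auto simp: nth_append nth_butlast last_conv_nth)
  qed
  show ?thesis
    using assms(1) len k unfolding dual_lists_def by (auto simp: n b_simps)
qed

lemma span_neg_last:
  assumes "z \<noteq> []" shows "span (set (butlast z @ [- last z])) = span (set z)"
proof -
  have "span (insert ((-1) *\<^sub>R last z + 0) (set (butlast z))) = span (insert (last z) (set (butlast z)))"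
    by (rule span_replace) (auto simp: span_zero)
  also have "insert (last z) (set (butlast z)) = set z"
    by (metis append_butlast_last_id assms list.simps(15) set_append sup_commute insert_is_Un list.set(1) sup_bot.right_neutral)
  finally show ?thesis by simp
qed

theorem components_and_involution:
  defines "i \<equiv> opp_involution b F0 Fi"
  shows "\<exists>C D. C \<noteq> D \<and> connected_components_of cell_top = {C, D} \<and>
      (odd half \<longrightarrow> i ` C = D \<and> i ` D = C) \<and> (even half \<longrightarrow> i ` C = C \<and> i ` D = D)"
proof -
  interpret sw: split_form b q Fi F0 l by (rule swap)
  obtain f where f: "span (set f) = F0" "length f = q" using sw.ex_basis_list by blast
  obtain e where fe: "dual_lists b f e" "set e \<subseteq> Fi" using sw.dual_list_exists[OF f] by blast
  have ef: "dual_lists b e f" using fe(1) dual_lists_flip by blast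
  have e: "span (set e) = Fi" "length e = q"
    using sw.dual_list_span[OF f fe] fe(1) f(2) by (auto simp: dual_lists_def)
  have ne: "e \<noteq> []" "f \<noteq> []" using e(2) f(2) qpos by auto
  have fF: "set f \<subseteq> F0" using f(1) span_superset by blast
  \<comment> \<open>Negating the last vector in both lists preserves duality but reverses the
    Pfaffian, so \<open>P\<close> takes opposite signs at \<open>cell e\<close> and
    \<open>cell e'\<close>.\<close>
  define e' where "e' = butlast e @ [- last e]"
  define f' where "f' = butlast f @ [- last f]"
  have e': "span (set e') = Fi" "length e' = q"
    using span_neg_last[OF ne(1)] e qpos by (simp_all add: e'_def)
  have f': "span (set f') = F0" "length f' = q"
    using span_neg_last[OF ne(2)] f qpos by (simp_all add: f'_def)
  have f'F: "set f' \<subseteq> F0" using f'(1) span_superset by blast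
  have ef': "dual_lists b e' f'" unfolding e'_def f'_def by (rule dual_lists_neg_last[OF ef ne(1)])
  define P where "P G = pfaffian (proj_form G) half (f @ tail q)" for G
  have neg: "pfaffian (proj_form G) half (f' @ tail q) = - P G" if "G \<in> Omega b q Fi" for G
    unfolding P_def f'_def
    using multilinear_list_neg_last[OF pfaffian_tail_alternating(2)[OF that] ne(2)] .
  have cell: "sgn (pfaffian (proj_form (cell z)) half (ps @ tail q)) = orient"
    if "span (set z) = Fi" "length z = q" "dual_lists b z ps" "set ps \<subseteq> F0" for z ps
    using sgn_pfaffian_dual[OF that(1,2) subspace_0[OF subi] _ that(3,4)]
    by (simp add: cell_def wedge_def b_simps)
  have Pe: "sgn (P (cell e)) = orient" unfolding P_def by (rule cell[OF e ef fF])
  have Pe': "sgn (P (cell e')) = - orient"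
    using cell[OF e' ef' f'F] neg[OF cell_in(3)[OF e']] by (simp add: sgn_minus)
  \<comment> \<open>In the basis dual to the \<open>z\<close> of a normal form the Pfaffian has sign
    \<open>orient\<close>. Moves carry that basis to \<open>f\<close> or \<open>f'\<close> without
    changing the sign, and the values for \<open>f\<close> and \<open>f'\<close> are negatives of
    each other.\<close>
  have P_nz: "P G \<noteq> 0" if G: "G \<in> topspace cell_top" for G
  proof -
    have GO: "G \<in> Omega b q F0 \<inter> Omega b q Fi" using G topspace_cell_top by simp
    obtain z v where zv: "span (set z) = Fi" "length z = q" "v \<in> Fi" "odd q \<longrightarrow> v = 0"
      "G = exp3 (\<lambda>p. wedge_sum b l z p + wedge b v l p) ` F0"
      using Omega_normal_form[OF GO] by blast
    obtain ps where ps: "dual_lists b z ps" "set ps \<subseteq> F0" using dual_list_exists[OF zv(1,2)] by blast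
    have o: "sgn (pfaffian (proj_form G) half (ps @ tail q)) = orient"
      using sgn_pfaffian_dual[OF zv(1-3) zv(4)[rule_format] ps] zv(5) by simp
    have "length ps = q" using ps(1) zv(2) by (simp add: dual_lists_def)
    then have "basis_steps ps f \<or> basis_steps ps f'"
      unfolding f'_def using dual_list_span[OF zv(1,2) ps] f dim0 ne(2)
      by (intro basis_steps_dichotomy[of ps F0 f]) auto
    moreover have GF: "G \<in> Omega b q Fi" using GO by blast
    ultimately have "sgn (P G) = orient \<or> sgn (- P G) = orient"
      using o basis_steps_alternating[OF _ pfaffian_tail_alternating[OF GF, of half "tail q"]] neg[OF GF]
      unfolding P_def by metis
    then show ?thesis using orient_nz by auto
  qed
  have sign_open: "openin cell_top {G \<in> topspace cell_top. 0 < s * P G}" for s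
  proof -
    have "{G \<in> topspace cell_top. 0 < s * P G} =
        {G \<in> Omega b q Fi. 0 < s * pfaffian (proj_form G) half (f @ tail q)} \<inter> (Omega b q F0 \<inter> Omega b q Fi)"
      unfolding topspace_cell_top P_def by auto
    then show ?thesis
      unfolding cell_top_def openin_subtopology using openin_pfaffian_sign by blast
  qed
  have same: "sgn (P G) = sgn (P G')" if conn: "connected_component_of cell_top G G'" for G G'
  proof (rule ccontr)
    assume ne: "sgn (P G) \<noteq> sgn (P G')"
    obtain S where S: "connectedin cell_top S" "G \<in> S" "G' \<in> S"
      using conn unfolding connected_component_of_def by blast
    have ST: "S \<subseteq> topspace cell_top" using S(1) connectedin_subset_topspace by blast
    have "P G \<noteq> 0" "P G' \<noteq> 0" using P_nz S ST by auto
    then have "(P G > 0 \<and> P G' < 0) \<or> (P G < 0 \<and> P G' > 0)" using ne by (auto simp: sgn_if split: if_splits)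
    then have "{G \<in> topspace cell_top. 0 < 1 * P G} \<inter> S \<noteq> {}" "{G \<in> topspace cell_top. 0 < (-1) * P G} \<inter> S \<noteq> {}"
      using S ST by auto
    moreover have "S \<subseteq> {G \<in> topspace cell_top. 0 < 1 * P G} \<union> {G \<in> topspace cell_top. 0 < (-1) * P G}"
    proof
      fix H assume "H \<in> S"
      then have "H \<in> topspace cell_top" "P H \<noteq> 0" using ST P_nz by auto
      then show "H \<in> {G \<in> topspace cell_top. 0 < 1 * P G} \<union> {G \<in> topspace cell_top. 0 < (-1) * P G}" by auto
    qed
    moreover have "{G \<in> topspace cell_top. 0 < 1 * P G} \<inter> {G \<in> topspace cell_top. 0 < (-1) * P G} \<inter> S = {}"
      by auto
    ultimately show False
      using S(1) sign_open[of 1] sign_open[of "-1"] unfolding connectedin by blast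
  qed
  \<comment> \<open>A normal form contracts to \<open>cell z\<close>, and moves of \<open>z\<close>
    lead on to one of the two reference cells; this bounds the number of components by two.\<close>
  have dich: "connected_component_of cell_top G (cell e) \<or> connected_component_of cell_top G (cell e')"
    if G: "G \<in> topspace cell_top" for G
  proof -
    have GO: "G \<in> Omega b q F0 \<inter> Omega b q Fi" using G topspace_cell_top by simp
    obtain z v where zv: "span (set z) = Fi" "length z = q" "v \<in> Fi" "odd q \<longrightarrow> v = 0"
      "G = exp3 (\<lambda>p. wedge_sum b l z p + wedge b v l p) ` F0"
      using Omega_normal_form[OF GO] by blast
    have 1: "connected_component_of cell_top G (cell z)" using connected_to_cell[OF zv(1-3) zv(4)[rule_format]] zv(5) by simp
    have "basis_steps z e \<or> basis_steps z e'"
      unfolding e'_def using zv(1,2) e dimi ne(1) by (intro basis_steps_dichotomy[of z Fi e]) auto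
    then show ?thesis
      using basis_steps_connected zv(1,2) connected_component_of_trans[OF 1] by blast
  qed
  have T: "cell e \<in> topspace cell_top" "cell e' \<in> topspace cell_top"
    using cell_in[OF e] cell_in[OF e'] by (auto simp: topspace_cell_top)
  define C where "C s = {G \<in> topspace cell_top. sgn (P G) = s}" for s
  \<comment> \<open>Components are exactly the sign classes: the sign is constant along connections,
    and two points of equal sign cannot be joined to different reference cells.\<close>
  have CC: "connected_component_of_set cell_top G = C (sgn (P G))" if G: "G \<in> topspace cell_top" for G
  proof
    show "connected_component_of_set cell_top G \<subseteq> C (sgn (P G))"
    proof
      fix H assume "H \<in> connected_component_of_set cell_top G"
      then have H: "connected_component_of cell_top G H" by simp
      then show "H \<in> C (sgn (P G))"
        using same[OF H] connected_component_in_topspace[OF H] by (simp add: C_def)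
    qed
    show "C (sgn (P G)) \<subseteq> connected_component_of_set cell_top G"
    proof
      fix H assume "H \<in> C (sgn (P G))"
      then have H: "H \<in> topspace cell_top" "sgn (P H) = sgn (P G)" by (auto simp: C_def)
      have pm: "orient \<noteq> - orient" using orient_nz by simp
      from dich[OF G] show "H \<in> connected_component_of_set cell_top G"
      proof
        assume 1: "connected_component_of cell_top G (cell e)"
        then have "\<not> connected_component_of cell_top H (cell e')"
          using same[OF 1] same[of H "cell e'"] Pe Pe' H(2) pm by metis
        then have "connected_component_of cell_top (cell e) H"
          using dich[OF H(1)] connected_component_of_sym by metis
        then show ?thesis using connected_component_of_trans[OF 1] by blast
      next
        assume 1: "connected_component_of cell_top G (cell e')"
        then have "\<not> connected_component_of cell_top H (cell e)"
          using same[OF 1] same[of H "cell e"] Pe Pe' H(2) pm by metis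
        then have "connected_component_of cell_top (cell e') H"
          using dich[OF H(1)] connected_component_of_sym by metis
        then show ?thesis using connected_component_of_trans[OF 1] by blast
      qed
    qed
  qed
  have comps: "connected_components_of cell_top = {C orient, C (- orient)}"
  proof
    show "connected_components_of cell_top \<subseteq> {C orient, C (- orient)}"
    proof
      fix K assume "K \<in> connected_components_of cell_top"
      then obtain G where G: "G \<in> topspace cell_top" "K = C (sgn (P G))"
        unfolding connected_components_of_def using CC by blast
      have "sgn (P G) = orient \<or> sgn (P G) = - orient"
        using dich[OF G(1)] same Pe Pe' by metis
      then show "K \<in> {C orient, C (- orient)}" using G(2) by auto
    qed
    show "{C orient, C (- orient)} \<subseteq> connected_components_of cell_top"
    proof -
      have "C orient = connected_component_of_set cell_top (cell e)"
        "C (- orient) = connected_component_of_set cell_top (cell e')"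
        using CC[OF T(1)] CC[OF T(2)] Pe Pe' by simp_all
      then show ?thesis using T unfolding connected_components_of_def by blast
    qed
  qed
  have i: "i G \<in> topspace cell_top \<and> i (i G) = G \<and> P (i G) = (-1) ^ half * P G" if G: "G \<in> topspace cell_top" for G
  proof -
    have GO: "G \<in> Omega b q F0" "G \<in> Omega b q Fi" using G topspace_cell_top by auto
    obtain N where N: "nilrad N" "G = exp3 N ` F0" using Omega_exp3 GO(2) by blast
    note N' = nilrad_uminus[OF N(1)]
    have iG: "i G = exp3 (\<lambda>x. - N x) ` F0" using opp_involution_exp3 N by (simp add: i_def)
    have "i (i G) = G" using opp_involution_exp3[OF N'] N iG by (simp add: i_def)
    moreover have "i G \<in> topspace cell_top"
      unfolding iG topspace_cell_top
      using nilrad_exp3_inj_F0[OF N(1)] nilrad_exp3_inj_F0[OF N'] exp3_image_Omega[OF N'] GO N(2)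
      by simp
    moreover have "P (i G) = (-1) ^ half * P G"
      unfolding P_def pfaffian_uminus[symmetric]
    proof (rule pfaffian_cong)
      fix x y assume xy: "x \<in> set (f @ tail q)" "y \<in> set (f @ tail q)"
      have cases: "x \<in> F0 \<or> x = l" "y \<in> F0 \<or> y = l"
        using xy fF by (auto simp: tail_def split: if_splits)
      \<comment> \<open>Passing from \<open>N\<close> to \<open>- N\<close> negates every entry that
        pairs \<open>F0\<close> with \<open>F0\<close> or \<open>l\<close>. The remaining entries
        follow by antisymmetry, the one at \<open>l\<close>, \<open>l\<close> being 0.\<close>
      have *: "proj_form (i G) p r = - proj_form G p r" if "p \<in> F0" "r \<in> F0 \<or> r = l" for p r
        unfolding iG unfolding N(2) using that(2)
        by (auto simp: proj_form_exp3[OF N(1) that(1)] proj_form_exp3[OF N' that(1)] b_simps)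
      show "proj_form (i G) x y = - proj_form G x y"
      proof (cases "x \<in> F0")
        case True
        then show ?thesis using * cases by blast
      next
        case False
        then have "x = l" using cases by blast
        then show ?thesis
          using *[of y l] cases proj_form_antisym[of _ l y] by (auto simp: proj_form_def)
      qed
    qed
    ultimately show ?thesis by blast
  qed
  have image: "i ` C s = C (((-1) ^ half) * s)" for s
  proof
    have 1: "sgn (P (i G)) = (-1) ^ half * sgn (P G)" if "G \<in> topspace cell_top" for G
      using i[OF that] by (cases "even half") (simp_all add: sgn_minus)
    then show "i ` C s \<subseteq> C (((-1) ^ half) * s)" using i by (auto simp: C_def)
    \<comment> \<open>Surjectivity comes from \<open>i (i G) = G\<close>: the preimage of
      \<open>G\<close> is \<open>i G\<close>.\<close>
    show "C (((-1) ^ half) * s) \<subseteq> i ` C s"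
    proof
      fix G assume "G \<in> C (((-1) ^ half) * s)"
      then have G: "G \<in> topspace cell_top" "sgn (P G) = (-1) ^ half * s" by (auto simp: C_def)
      then have "sgn (P (i G)) = s" using 1[OF G(1)] by (cases "even half") simp_all
      then have "i G \<in> C s" using i[OF G(1)] by (simp add: C_def)
      then show "G \<in> i ` C s" using i[OF G(1)] by (metis imageI)
    qed
  qed
  have "cell e \<in> C orient" "cell e \<notin> C (- orient)"
    using T Pe orient_nz by (auto simp: C_def)
  then have "C orient \<noteq> C (- orient)" by blast
  then show ?thesis
    using comps image[of orient] image[of "- orient"]
    by (intro exI[of _ "C orient"] exI[of _ "C (- orient)"]) simp
qed

end

section \<open>From a transverse pair to a splitting, and the conclusion\<close>

lemma split_form_exists:
  fixes b :: "real^'n::finite \<Rightarrow> real^'n \<Rightarrow> real"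
  assumes q: "q > 0" and card: "CARD('n) = 2 * q + 1" and b: "nondegenerate_symmetric_form b"
    and F0: "F0 \<in> isotropic_subspaces b q" and Fi: "Fi \<in> isotropic_subspaces b q"
    and tr: "transverse b F0 Fi"
  shows "\<exists>l. split_form b q F0 Fi l"
proof -
  have bl: "bilinear b" and sym: "\<And>x y. b x y = b y x" and nd: "\<And>x. (\<And>y. b x y = 0) \<Longrightarrow> x = 0"
    using b by (auto simp: nondegenerate_symmetric_form_def)
  have s0: "subspace F0" "dim F0 = q" "\<And>x y. x \<in> F0 \<Longrightarrow> y \<in> F0 \<Longrightarrow> b x y = 0"
    and si: "subspace Fi" "dim Fi = q" "\<And>x y. x \<in> Fi \<Longrightarrow> y \<in> Fi \<Longrightarrow> b x y = 0"
    using F0 Fi by (auto simp: isotropic_subspaces_def)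
  define W where "W = form_orthogonal b Fi"
  have W: "x \<in> W \<longleftrightarrow> (\<forall>f\<in>Fi. b x f = 0)" for x by (simp add: W_def form_orthogonal_def)
  note bs = bilinear_ladd[OF bl] bilinear_radd[OF bl] bilinear_lmul[OF bl] bilinear_rmul[OF bl]
    bilinear_lzero[OF bl] bilinear_rzero[OF bl]
  have sW: "subspace W" by (auto simp: subspace_def W bs)
  have ds: "F0 \<inter> W = {0}" "{x + y |x y. x \<in> F0 \<and> y \<in> W} = UNIV"
    using tr by (auto simp: transverse_def direct_sum_eq_UNIV_def W_def)
  have dW: "dim W = q + 1"
    using dim_sums_Int[OF s0(1) sW] ds s0(2) card by simp
  have perf0: "p = 0" if "p \<in> F0" "\<And>f. f \<in> Fi \<Longrightarrow> b f p = 0" for p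
  proof -
    have "p \<in> W" using that(2) sym by (auto simp: W)
    then show ?thesis using ds(1) that(1) by blast
  qed
  have perfi: "f = 0" if "f \<in> Fi" "\<And>p. p \<in> F0 \<Longrightarrow> b f p = 0" for f
  proof (rule nd)
    fix y
    obtain p r where "y = p + r" "p \<in> F0" "r \<in> W" using ds(2) by blast
    then show "b f y = 0" using that W[of r] sym[of f r] by (simp add: bs)
  qed
  \<comment> \<open>Together the two subspaces span at most \<open>2 * q\<close> dimensions, which
    leaves room for a nonzero \<open>l\<close> orthogonal to both.\<close>
  have "dim (F0 \<union> Fi) < dim (UNIV :: (real^'n) set)"
  proof -
    obtain B0 where B0: "B0 \<subseteq> F0" "independent B0" "F0 \<subseteq> span B0" "card B0 = dim F0"
      by (rule basis_exists)
    obtain Bi where Bi: "Bi \<subseteq> Fi" "independent Bi" "Fi \<subseteq> span Bi" "card Bi = dim Fi"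
      by (rule basis_exists)
    have fin: "finite (B0 \<union> Bi)" using B0(2) Bi(2) independent_imp_finite by blast
    have "F0 \<union> Fi \<subseteq> span (B0 \<union> Bi)"
      using B0(3) Bi(3) span_mono[of B0 "B0 \<union> Bi"] span_mono[of Bi "B0 \<union> Bi"] by blast
    then have "dim (F0 \<union> Fi) \<le> card (B0 \<union> Bi)" using fin by (rule dim_le_card)
    also have "\<dots> \<le> q + q" using card_Un_le[of B0 Bi] B0(4) Bi(4) s0(2) si(2) by simp
    finally show ?thesis using card by simp
  qed
  from bilinear_annihilator_exists[OF bl subspace_UNIV this]
  obtain l where l: "l \<noteq> 0" "\<And>x. x \<in> F0 \<union> Fi \<Longrightarrow> b x l = 0" by blast
  have l': "b l x = 0" if "x \<in> F0 \<union> Fi" for x using l(2)[OF that] sym[of l x] by simp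
  have lFi: "l \<notin> Fi" using perfi[of l] l(1) l' by blast
  have lW: "l \<in> W" using l' by (simp add: W)
  \<comment> \<open>\<open>Fi\<close> has codimension one in \<open>W\<close>, and \<open>l\<close>
    lies in \<open>W\<close> but not in \<open>Fi\<close>, since a vector of \<open>Fi\<close>
    orthogonal to \<open>F0\<close> is 0.\<close>
  have "span (insert l Fi) = W"
  proof (rule subspace_dim_equal)
    have FW: "Fi \<subseteq> W" using si(3) by (auto simp: W)
    show "span (insert l Fi) \<subseteq> W" using FW lW sW by (simp add: span_minimal)
    have "l \<notin> span Fi" using lFi si(1) by (simp add: span_eq_iff[THEN iffD2])
    then show "dim W \<le> dim (span (insert l Fi))" using dW si(2) by (simp add: dim_insert)
  qed (use sW in auto)
  then have decomp: "\<exists>p\<in>F0. \<exists>a. \<exists>f\<in>Fi. x = p + a *\<^sub>R l + f" for x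
  proof -
    obtain p r where pr: "x = p + r" "p \<in> F0" "r \<in> W" using ds(2) by blast
    then obtain a where "r - a *\<^sub>R l \<in> span Fi" using \<open>span (insert l Fi) = W\<close> by (auto simp: span_insert)
    then have "r - a *\<^sub>R l \<in> Fi" using si(1) by (simp add: span_eq_iff[THEN iffD2])
    moreover have "x = p + a *\<^sub>R l + (r - a *\<^sub>R l)" using pr(1) by simp
    ultimately show ?thesis using pr(2) by blast
  qed
  \<comment> \<open>An isotropic \<open>l\<close> would be orthogonal to \<open>F0\<close>, to
    \<open>Fi\<close> and to itself, hence to everything.\<close>
  have ll: "b l l \<noteq> 0"
  proof
    assume ll: "b l l = 0"
    have "b l y = 0" for y
    proof -
      obtain p a f where "p \<in> F0" "f \<in> Fi" "y = p + a *\<^sub>R l + f" using decomp by blast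
      then show ?thesis using l' ll by (simp add: bs)
    qed
    then show False using nd l(1) by blast
  qed
  have "split_form b q F0 Fi l"
    by unfold_locales (use bl sym s0 si l(2) ll decomp perf0 perfi card q in auto)
  then show ?thesis by blast
qed

theorem proposition4p9:
  fixes b :: "real^'n::finite \<Rightarrow> real^'n \<Rightarrow> real"
    and q :: nat
    and F0 Finf :: "(real^'n) set"
  assumes "q \<ge> 2"
    and "CARD('n) = 2 * q + 1"
    and "nondegenerate_symmetric_form b"
    and "has_signature b (q + 1) q"
    and "F0 \<in> isotropic_subspaces b q"
    and "Finf \<in> isotropic_subspaces b q"
    and "transverse b F0 Finf"
  defines "\<C> \<equiv> connected_components_of
      (subtopology (isotropic_topology b q) (Omega b q F0 \<inter> Omega b q Finf))"
    and "i \<equiv> opp_involution b F0 Finf"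
  shows "\<exists>C D. C \<noteq> D \<and> \<C> = {C, D} \<and>
      (q mod 4 = 1 \<or> q mod 4 = 2 \<longrightarrow> i ` C = D \<and> i ` D = C) \<and>
      (q mod 4 = 3 \<or> q mod 4 = 0 \<longrightarrow> i ` C = C \<and> i ` D = D)"
proof -
  obtain l where "split_form b q F0 Finf l"
    using split_form_exists[of q b F0 Finf] assms(1-3,5-7) by auto
  then interpret split_form b q F0 Finf l .
  \<comment> \<open>The number of pairings in the Pfaffian is \<open>q / 2\<close> rounded up; its
    parity is what the residue of \<open>q\<close> modulo 4 records.\<close>
  have "odd ((q + 1) div 2)" if "q mod 4 = 1 \<or> q mod 4 = 2" using that by presburger
  moreover have "even ((q + 1) div 2)" if "q mod 4 = 3 \<or> q mod 4 = 0" using that by presburger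
  ultimately show ?thesis using components_and_involution unfolding \<C>_def i_def cell_top_def by metis
qed

end
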